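(* Let $\vec{\mathcal{H}}$ be a locally coherent Grothendieck category, let $\mathcal{H}$ be the class of finitely presented objects of $\vec{\mathcal{H}}$, and let $\mathscr{S}\subseteq\mathcal{H}$ be a resolving class such that $\mathrm{pd}(S)\leq 1$ for all $S\in\mathscr{S}$. Then there is a tilting object $T$ in $\vec{\mathcal{H}}$ with $T^{\perp_1}=\mathscr{S}^{\perp_1}$.
   Context: For a class $\mathcal{X}$ of objects (or a single object) in $\vec{\mathcal{H}}$ put $\mathcal{X}^{\perp_1}=\{F\in\vec{\mathcal{H}}\mid \mathrm{Ext}^1(X,F)=0\text{ for all }X\in\mathcal{X}\}$. $\mathrm{Add}(T)$ is the class of direct summands of arbitrary direct sums of copies of $T$, and $\mathrm{Gen}(T)$ is the class of all objects $Y$ admitting an epimorphism $X\to Y$ with $X\in\mathrm{Add}(T)$. An object $T\in\vec{\mathcal{H}}$ is called tilting if $\mathrm{Gen}(T)=T^{\perp_1}$. A class $\mathscr{S}\subseteq\mathcal{H}$ is called resolving if it generates $\vec{\mathcal{H}}$ (i.e. contains a system of generators of $\vec{\mathcal{H}}$), is closed under extensions and under direct summands, and satisfies $S'\in\mathscr{S}$ whenever $0\to S'\to S\to S''\to 0$ is exact with $S,S''\in\mathscr{S}$. $\mathrm{pd}(S)\le 1$ means that the projective dimension of $S$ is at most one, i.e. $\mathrm{Ext}^2_{\vec{\mathcal{H}}}(S,-)=0$. *)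

theory Defs
  imports "HOL-Algebra.Group"
begin

unbundle cardinal_syntax

section \<open>Categories enriched in abelian groups\<close>

text \<open>
  A category is a record, so that the same predicates apply to a category and to its full
  subcategories. \<open>g \<cdot> f\<close> is the composite of \<open>g\<close> after \<open>f\<close>; the morphism sets between
  different pairs of objects are disjoint.
\<close>

record ('o, 'm) cat =
  Ob :: "'o set"
  Ar :: "'m set"
  Dom :: "'m \<Rightarrow> 'o"
  Cod :: "'m \<Rightarrow> 'o"
  Id :: "'o \<Rightarrow> 'm"
  Comp :: "'m \<Rightarrow> 'm \<Rightarrow> 'm"  (infixl \<open>\<cdot>\<index>\<close> 70)
  Add :: "'m \<Rightarrow> 'm \<Rightarrow> 'm"  (infixl \<open>\<oplus>\<index>\<close> 65)
  Zero :: "'o \<Rightarrow> 'o \<Rightarrow> 'm"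

definition Hom :: "('o, 'm) cat \<Rightarrow> 'o \<Rightarrow> 'o \<Rightarrow> 'm set" where
  "Hom C X Y = {f \<in> Ar C. Dom C f = X \<and> Cod C f = Y}"

definition full_subcategory :: "('o, 'm) cat \<Rightarrow> 'o set \<Rightarrow> ('o, 'm) cat" where
  "full_subcategory C P = C\<lparr>Ob := P, Ar := {f \<in> Ar C. Dom C f \<in> P \<and> Cod C f \<in> P}\<rparr>"

locale preadditive_category =
  fixes C :: "('o, 'm) cat" (structure)
  assumes Dom_in_Ob: "f \<in> Ar C \<Longrightarrow> Dom C f \<in> Ob C"
    and Cod_in_Ob: "f \<in> Ar C \<Longrightarrow> Cod C f \<in> Ob C"
    and Id_in_Hom: "X \<in> Ob C \<Longrightarrow> Id C X \<in> Hom C X X"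
    and Comp_in_Hom: "\<lbrakk>f \<in> Hom C X Y; g \<in> Hom C Y Z\<rbrakk> \<Longrightarrow> g \<cdot> f \<in> Hom C X Z"
    and Comp_assoc:
      "\<lbrakk>f \<in> Hom C W X; g \<in> Hom C X Y; h \<in> Hom C Y Z\<rbrakk> \<Longrightarrow> h \<cdot> (g \<cdot> f) = (h \<cdot> g) \<cdot> f"
    and Comp_Id: "f \<in> Hom C X Y \<Longrightarrow> f \<cdot> Id C X = f"
    and Id_Comp: "f \<in> Hom C X Y \<Longrightarrow> Id C Y \<cdot> f = f"
    and Hom_comm_group:
      "\<lbrakk>X \<in> Ob C; Y \<in> Ob C\<rbrakk> \<Longrightarrow>
         comm_group \<lparr>carrier = Hom C X Y, monoid.mult = Add C, one = Zero C X Y\<rparr>"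
    and Comp_Add:
      "\<lbrakk>f \<in> Hom C X Y; f' \<in> Hom C X Y; g \<in> Hom C Y Z\<rbrakk> \<Longrightarrow> g \<cdot> (f \<oplus> f') = g \<cdot> f \<oplus> g \<cdot> f'"
    and Add_Comp:
      "\<lbrakk>f \<in> Hom C X Y; g \<in> Hom C Y Z; g' \<in> Hom C Y Z\<rbrakk> \<Longrightarrow> (g \<oplus> g') \<cdot> f = g \<cdot> f \<oplus> g' \<cdot> f"


section \<open>Abelian categories\<close>

context
  fixes C :: "('o, 'm) cat" (structure)
begin

definition monic :: "'m \<Rightarrow> bool" where
  "monic f \<longleftrightarrow> f \<in> Ar C \<and>
     (\<forall>X\<in>Ob C. \<forall>g\<in>Hom C X (Dom C f). \<forall>h\<in>Hom C X (Dom C f). f \<cdot> g = f \<cdot> h \<longrightarrow> g = h)"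

definition epic :: "'m \<Rightarrow> bool" where
  "epic f \<longleftrightarrow> f \<in> Ar C \<and>
     (\<forall>X\<in>Ob C. \<forall>g\<in>Hom C (Cod C f) X. \<forall>h\<in>Hom C (Cod C f) X. g \<cdot> f = h \<cdot> f \<longrightarrow> g = h)"

definition zero_object :: "'o \<Rightarrow> bool" where
  "zero_object Z \<longleftrightarrow> Z \<in> Ob C \<and>
     (\<forall>X\<in>Ob C. (\<exists>!f. f \<in> Hom C X Z) \<and> (\<exists>!f. f \<in> Hom C Z X))"

definition is_kernel :: "'m \<Rightarrow> 'm \<Rightarrow> bool" where
  "is_kernel k f \<longleftrightarrow> f \<in> Ar C \<and> k \<in> Ar C \<and> Cod C k = Dom C f \<and>
     f \<cdot> k = Zero C (Dom C k) (Cod C f) \<and>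
     (\<forall>X\<in>Ob C. \<forall>g\<in>Hom C X (Dom C f). f \<cdot> g = Zero C X (Cod C f) \<longrightarrow>
        (\<exists>!h. h \<in> Hom C X (Dom C k) \<and> k \<cdot> h = g))"

definition is_cokernel :: "'m \<Rightarrow> 'm \<Rightarrow> bool" where
  "is_cokernel c f \<longleftrightarrow> f \<in> Ar C \<and> c \<in> Ar C \<and> Dom C c = Cod C f \<and>
     c \<cdot> f = Zero C (Dom C f) (Cod C c) \<and>
     (\<forall>X\<in>Ob C. \<forall>g\<in>Hom C (Cod C f) X. g \<cdot> f = Zero C (Dom C f) X \<longrightarrow>
        (\<exists>!h. h \<in> Hom C (Cod C c) X \<and> h \<cdot> c = g))"

definition is_biproduct :: "'o \<Rightarrow> 'o \<Rightarrow> 'o \<Rightarrow> bool" where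
  "is_biproduct X Y B \<longleftrightarrow> X \<in> Ob C \<and> Y \<in> Ob C \<and> B \<in> Ob C \<and>
     (\<exists>i\<in>Hom C X B. \<exists>j\<in>Hom C Y B. \<exists>p\<in>Hom C B X. \<exists>q\<in>Hom C B Y.
        p \<cdot> i = Id C X \<and> q \<cdot> j = Id C Y \<and> p \<cdot> j = Zero C Y X \<and> q \<cdot> i = Zero C X Y \<and>
        i \<cdot> p \<oplus> j \<cdot> q = Id C B)"

definition direct_summand :: "'o \<Rightarrow> 'o \<Rightarrow> bool" where
  "direct_summand A B \<longleftrightarrow> (\<exists>A'. is_biproduct A A' B)"

text \<open>Exactness of \<open>\<cdot> \<rightarrow> \<cdot> \<rightarrow> \<cdot>\<close> at the middle term: the image of \<open>f\<close> is the kernel of \<open>g\<close>.\<close>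

definition exact :: "'m \<Rightarrow> 'm \<Rightarrow> bool" where
  "exact f g \<longleftrightarrow> (\<exists>k e. is_kernel k g \<and> epic e \<and> Cod C e = Dom C k \<and> f = k \<cdot> e)"

definition short_exact :: "'m \<Rightarrow> 'm \<Rightarrow> bool" where
  "short_exact f g \<longleftrightarrow> monic f \<and> exact f g \<and> epic g"

end

locale abelian_category = preadditive_category +
  assumes ex_zero_object: "\<exists>Z. zero_object C Z"
    and ex_biproduct: "\<lbrakk>X \<in> Ob C; Y \<in> Ob C\<rbrakk> \<Longrightarrow> \<exists>B. is_biproduct C X Y B"
    and ex_kernel: "f \<in> Ar C \<Longrightarrow> \<exists>k. is_kernel C k f"
    and ex_cokernel: "f \<in> Ar C \<Longrightarrow> \<exists>c. is_cokernel C c f"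
    and monic_is_kernel: "monic C k \<Longrightarrow> \<exists>f. is_kernel C k f"
    and epic_is_cokernel: "epic C c \<Longrightarrow> \<exists>f. is_cokernel C c f"


section \<open>Yoneda Ext\<close>

context
  fixes C :: "('o, 'm) cat" (structure)
begin

text \<open>
  For \<open>n \<ge> 1\<close>, the exact sequences \<open>0 \<rightarrow> Y \<rightarrow> E\<^sub>1 \<rightarrow> \<dots> \<rightarrow> E\<^sub>n \<rightarrow> X \<rightarrow> 0\<close>, represented by the list of
  their \<open>n + 1\<close> morphisms between \<open>Y\<close> and \<open>X\<close>.
\<close>

definition extensions :: "nat \<Rightarrow> 'o \<Rightarrow> 'o \<Rightarrow> 'm list set" where
  "extensions n X Y = {es. length es = n + 1 \<and> set es \<subseteq> Ar C \<and>
     Dom C (es ! 0) = Y \<and> Cod C (es ! n) = X \<and> monic C (es ! 0) \<and> epic C (es ! n) \<and>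
     (\<forall>i<n. exact C (es ! i) (es ! (i + 1)))}"

text \<open>Morphisms of such sequences are the identity on \<open>Y\<close> (position 0) and on \<open>X\<close> (position \<open>n + 1\<close>).\<close>

definition extension_maps :: "nat \<Rightarrow> 'o \<Rightarrow> 'o \<Rightarrow> ('m list \<times> 'm list) set" where
  "extension_maps n X Y = {(es, fs). es \<in> extensions n X Y \<and> fs \<in> extensions n X Y \<and>
     (\<exists>\<phi>. \<phi> 0 = Id C Y \<and> \<phi> (n + 1) = Id C X \<and>
       (\<forall>i\<le>n. \<phi> i \<in> Hom C (Dom C (es ! i)) (Dom C (fs ! i)) \<and>
               \<phi> (i + 1) \<cdot> es ! i = fs ! i \<cdot> \<phi> i))}"

definition Ext :: "nat \<Rightarrow> 'o \<Rightarrow> 'o \<Rightarrow> 'm list set set" where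
  "Ext n X Y = extensions n X Y // (extension_maps n X Y \<union> (extension_maps n X Y)\<inverse>)\<^sup>*"

text \<open>Under the Baer sum, \<open>Ext n X Y\<close> is a group, so it is zero iff it has exactly one element.\<close>

definition Ext_zero :: "nat \<Rightarrow> 'o \<Rightarrow> 'o \<Rightarrow> bool" where
  "Ext_zero n X Y \<longleftrightarrow> is_singleton (Ext n X Y)"

definition perp1 :: "'o set \<Rightarrow> 'o set" where
  "perp1 \<X> = {F \<in> Ob C. \<forall>X\<in>\<X>. Ext_zero 1 X F}"

definition proj_dim_le :: "'o \<Rightarrow> nat \<Rightarrow> bool" where
  "proj_dim_le X n \<longleftrightarrow> (\<forall>F\<in>Ob C. Ext_zero (n + 1) X F)"

end


section \<open>Coproducts, direct limits and generators\<close>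

text \<open>
  Small sets are those of cardinality less than a cardinal \<open>\<kappa>\<close> (assumed uncountable and regular
  below). The index sets are subsets of the type \<open>'u\<close> on which \<open>\<kappa>\<close> lives; up to bijection these
  are all small sets.
\<close>

definition small :: "'u rel \<Rightarrow> 'a set \<Rightarrow> bool" where
  "small \<kappa> A \<longleftrightarrow> |A| <o \<kappa>"

definition directed_set :: "'i set \<Rightarrow> 'i rel \<Rightarrow> bool" where
  "directed_set I r \<longleftrightarrow> partial_order_on I r \<and> I \<noteq> {} \<and>
     (\<forall>i\<in>I. \<forall>j\<in>I. \<exists>k\<in>I. (i, k) \<in> r \<and> (j, k) \<in> r)"

context
  fixes C :: "('o, 'm) cat" (structure)
begin

definition is_coproduct :: "'i set \<Rightarrow> ('i \<Rightarrow> 'o) \<Rightarrow> 'o \<Rightarrow> ('i \<Rightarrow> 'm) \<Rightarrow> bool" where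
  "is_coproduct I X S \<iota> \<longleftrightarrow> S \<in> Ob C \<and> (\<forall>i\<in>I. X i \<in> Ob C \<and> \<iota> i \<in> Hom C (X i) S) \<and>
     (\<forall>Y\<in>Ob C. \<forall>f. (\<forall>i\<in>I. f i \<in> Hom C (X i) Y) \<longrightarrow>
        (\<exists>!h. h \<in> Hom C S Y \<and> (\<forall>i\<in>I. h \<cdot> \<iota> i = f i)))"

definition direct_system ::
    "'i set \<Rightarrow> 'i rel \<Rightarrow> ('i \<Rightarrow> 'o) \<Rightarrow> ('i \<Rightarrow> 'i \<Rightarrow> 'm) \<Rightarrow> bool" where
  "direct_system I r D d \<longleftrightarrow> directed_set I r \<and>
     (\<forall>i\<in>I. D i \<in> Ob C \<and> d i i = Id C (D i)) \<and>
     (\<forall>i j. (i, j) \<in> r \<longrightarrow> d i j \<in> Hom C (D i) (D j)) \<and>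
     (\<forall>i j k. (i, j) \<in> r \<and> (j, k) \<in> r \<longrightarrow> d j k \<cdot> d i j = d i k)"

definition cocone ::
    "'i set \<Rightarrow> 'i rel \<Rightarrow> ('i \<Rightarrow> 'o) \<Rightarrow> ('i \<Rightarrow> 'i \<Rightarrow> 'm) \<Rightarrow> 'o \<Rightarrow> ('i \<Rightarrow> 'm) \<Rightarrow> bool" where
  "cocone I r D d L l \<longleftrightarrow> L \<in> Ob C \<and> (\<forall>i\<in>I. l i \<in> Hom C (D i) L) \<and>
     (\<forall>i j. (i, j) \<in> r \<longrightarrow> l j \<cdot> d i j = l i)"

definition is_direct_limit ::
    "'i set \<Rightarrow> 'i rel \<Rightarrow> ('i \<Rightarrow> 'o) \<Rightarrow> ('i \<Rightarrow> 'i \<Rightarrow> 'm) \<Rightarrow> 'o \<Rightarrow> ('i \<Rightarrow> 'm) \<Rightarrow> bool" where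
  "is_direct_limit I r D d L l \<longleftrightarrow> direct_system I r D d \<and> cocone I r D d L l \<and>
     (\<forall>L' l'. cocone I r D d L' l' \<longrightarrow>
        (\<exists>!h. h \<in> Hom C L L' \<and> (\<forall>i\<in>I. h \<cdot> l i = l' i)))"

definition separating :: "'o set \<Rightarrow> bool" where
  "separating \<G> \<longleftrightarrow> \<G> \<subseteq> Ob C \<and>
     (\<forall>X\<in>Ob C. \<forall>Y\<in>Ob C. \<forall>f\<in>Hom C X Y. \<forall>g\<in>Hom C X Y.
        f \<noteq> g \<longrightarrow> (\<exists>G\<in>\<G>. \<exists>h\<in>Hom C G X. f \<cdot> h \<noteq> g \<cdot> h))"

end


section \<open>Locally coherent Grothendieck categories\<close>

text \<open>
  Usually all sets \<open>Hom C X Y\<close> are taken to be small. With small coproducts this forces \<open>\<kappa>\<close> to be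
  strongly inaccessible (or all objects to be zero), and no HOL type can be shown to carry such a
  cardinal. Here smallness is required only for the morphisms out of some generator. This covers
  the usual situation, where \<open>\<kappa>\<close> is inaccessible and all \<open>Hom C X Y\<close> are small, but also, for
  example, the modules of cardinality at most \<open>\<mu>\<close> over a ring of cardinality at most \<open>\<mu>\<close>,
  with \<open>\<mu>\<close> infinite and \<open>\<kappa>\<close> the successor of \<open>\<mu>\<close>.

  An abelian category with small coproducts has all small colimits. Exactness of direct limits is
  stated for short exact sequences of direct systems, with \<open>U\<close> and \<open>V\<close> the induced morphisms
  between their limits.
\<close>

locale grothendieck_category = abelian_category C
  for C :: "('o, 'm) cat" (structure) +
  fixes \<kappa> :: "'u rel"
  assumes Card_order_\<kappa>: "Card_order \<kappa>"
    and uncountable_\<kappa>: "natLeq <o \<kappa>"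
    and regular_\<kappa>: "regularCard \<kappa>"
    and ex_coproduct: "\<And>(I :: 'u set) X. \<lbrakk>small \<kappa> I; \<forall>i\<in>I. X i \<in> Ob C\<rbrakk> \<Longrightarrow> \<exists>S \<iota>. is_coproduct C I X S \<iota>"
    and direct_limit_exact:
      "\<And>(I :: 'u set) r A a B b D d LA la LB lb LD ld u v U V.
        \<lbrakk>small \<kappa> I; is_direct_limit C I r A a LA la; is_direct_limit C I r B b LB lb;
         is_direct_limit C I r D d LD ld;
         \<forall>i\<in>I. u i \<in> Hom C (A i) (B i) \<and> v i \<in> Hom C (B i) (D i) \<and> short_exact C (u i) (v i);
         \<forall>i j. (i, j) \<in> r \<longrightarrow> u j \<cdot> a i j = b i j \<cdot> u i \<and> v j \<cdot> b i j = d i j \<cdot> v i;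
         U \<in> Hom C LA LB; V \<in> Hom C LB LD;
         \<forall>i\<in>I. U \<cdot> la i = lb i \<cdot> u i \<and> V \<cdot> lb i = ld i \<cdot> v i\<rbrakk> \<Longrightarrow> short_exact C U V"
    and ex_generator: "\<exists>G. separating C {G} \<and> (\<forall>X\<in>Ob C. small \<kappa> (Hom C G X))"

context
  fixes C :: "('o, 'm) cat" (structure) and \<kappa> :: "'u rel"
begin

text \<open>
  The two last conjuncts say that the canonical map from the direct limit of the sets
  \<open>Hom C X (D i)\<close> to \<open>Hom C X L\<close> is surjective and injective.
\<close>

definition finitely_presented :: "'o \<Rightarrow> bool" where
  "finitely_presented X \<longleftrightarrow> X \<in> Ob C \<and>
     (\<forall>(I :: 'u set) r D d L l. small \<kappa> I \<and> is_direct_limit C I r D d L l \<longrightarrow>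
        (\<forall>f\<in>Hom C X L. \<exists>i\<in>I. \<exists>g\<in>Hom C X (D i). f = l i \<cdot> g) \<and>
        (\<forall>i\<in>I. \<forall>j\<in>I. \<forall>f\<in>Hom C X (D i). \<forall>g\<in>Hom C X (D j). l i \<cdot> f = l j \<cdot> g \<longrightarrow>
           (\<exists>k\<in>I. (i, k) \<in> r \<and> (j, k) \<in> r \<and> d i k \<cdot> f = d j k \<cdot> g)))"

definition contains_generators :: "'o set \<Rightarrow> bool" where
  "contains_generators \<S> \<longleftrightarrow> (\<exists>\<G>\<subseteq>\<S>. small \<kappa> \<G> \<and> separating C \<G>)"

definition Add_class :: "'o \<Rightarrow> 'o set" where
  "Add_class T = {A. \<exists>(I :: 'u set) B \<iota>. small \<kappa> I \<and> is_coproduct C I (\<lambda>_. T) B \<iota> \<and>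
     direct_summand C A B}"

definition Gen_class :: "'o \<Rightarrow> 'o set" where
  "Gen_class T = {Y. \<exists>X\<in>Add_class T. \<exists>f\<in>Hom C X Y. epic C f}"

definition tilting :: "'o \<Rightarrow> bool" where
  "tilting T \<longleftrightarrow> T \<in> Ob C \<and> Gen_class T = perp1 C {T}"

definition resolving :: "'o set \<Rightarrow> bool" where
  "resolving \<S> \<longleftrightarrow> \<S> \<subseteq> Ob C \<and> contains_generators \<S> \<and>
     (\<forall>f g. short_exact C f g \<and> Dom C f \<in> \<S> \<and> Cod C g \<in> \<S> \<longrightarrow> Dom C g \<in> \<S>) \<and>
     (\<forall>A B. direct_summand C A B \<and> B \<in> \<S> \<longrightarrow> A \<in> \<S>) \<and>
     (\<forall>f g. short_exact C f g \<and> Dom C g \<in> \<S> \<and> Cod C g \<in> \<S> \<longrightarrow> Dom C f \<in> \<S>)"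

end

text \<open>Locally finitely presented, with the finitely presented objects forming an abelian category.\<close>

locale locally_coherent_grothendieck_category = grothendieck_category +
  assumes ex_fp_generators: "contains_generators C \<kappa> {X. finitely_presented C \<kappa> X}"
    and fp_abelian: "abelian_category (full_subcategory C {X. finitely_presented C \<kappa> X})"

end

theory Submission
  imports Defs
begin

text \<open>
  Write \<open>\<B>\<close> for \<open>perp1 C \<S>\<close>. Since \<open>\<S>\<close> consists of finitely presented objects, contains generators
  and is closed under kernels of epimorphisms, every extension of an object of \<open>\<S>\<close> is a pushout of one
  \<open>0 \<rightarrow> K \<rightarrow> P \<rightarrow> S \<rightarrow> 0\<close> within \<open>\<S>\<close>. So \<open>\<B>\<close> is the class of objects that are injective with
  respect to a small set of such monomorphisms \<open>K \<rightarrow> P\<close>; as \<open>K\<close> is finitely presented, \<open>\<B>\<close> is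
  closed under coproducts, and the bound on the projective dimension makes it closed under quotients.

  The small object argument, which stops after \<open>\<omega>\<close> steps because each \<open>K\<close> is finitely presented,
  embeds the coproduct \<open>X\<close> of the generators in \<open>\<S>\<close> into an object \<open>T\<^sub>0\<close> of \<open>\<B>\<close> such that
  \<open>X \<rightarrow> T\<^sub>0\<close> has the left lifting property against all epimorphisms with kernel in \<open>\<B>\<close>. Let
  \<open>T = T\<^sub>0 \<oplus> T\<^sub>0 / X\<close>. Then \<open>Gen T \<subseteq> \<B>\<close>, the lifting property gives \<open>Ext\<^sup>1(T, \<B>) = 0\<close>, and if
  \<open>Ext\<^sup>1(T, F) = 0\<close>, then every morphism from \<open>X\<close> to \<open>F\<close> extends to \<open>T\<^sub>0\<close>, so that \<open>F\<close> lies in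
  \<open>Gen T\<close>.
\<close>

section \<open>Preadditive categories\<close>

text \<open>What is carried through the small object argument is the lifting property itself. It
  passes to coproducts, pushouts and sequential limits by universal properties alone, and it is used
  twice at the end: a lift over \<open>T\<^sub>0\<close> that prolongs a given lift on
  \<open>X\<close> splits extensions over \<open>T\<^sub>0\<close>, and a lift that vanishes on
  \<open>X\<close> descends to \<open>T\<^sub>0 / X\<close>. Two obstacles shape the rest.
  \<open>Ext\<close> consists of Yoneda extensions modulo chains of morphisms, with no long exact
  sequence at hand; so degree one is translated into splitting, and from degree two only the
  exactness needed for quotients is extracted. Moreover, \<open>\<S>\<close> may contain many
  isomorphic copies of its objects, and only the morphisms out of one generator are assumed to form
  small sets. Finite presentation transfers smallness to \<open>Hom C S X\<close> for
  \<open>S\<close> in \<open>\<S>\<close>, and the test monomorphisms are obtained from morphisms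
  between chosen finite sums of generators.\<close>

context preadditive_category
begin

lemma Hom_iff [simp]: "f \<in> Hom C X Y \<longleftrightarrow> f \<in> Ar C \<and> Dom C f = X \<and> Cod C f = Y"
  by (auto simp: Hom_def)

lemma Ar_Ob [simp]: "f \<in> Ar C \<Longrightarrow> Dom C f \<in> Ob C" "f \<in> Ar C \<Longrightarrow> Cod C f \<in> Ob C"
  by (simp_all add: Dom_in_Ob Cod_in_Ob)

lemma Id_typing [simp]:
  assumes "X \<in> Ob C"
  shows "Id C X \<in> Ar C" "Dom C (Id C X) = X" "Cod C (Id C X) = X"
  using Id_in_Hom[OF assms] by auto

lemma Comp_typing [simp]:
  assumes "f \<in> Ar C" "g \<in> Ar C" "Dom C g = Cod C f"
  shows "g \<cdot> f \<in> Ar C" "Dom C (g \<cdot> f) = Dom C f" "Cod C (g \<cdot> f) = Cod C g"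
  using Comp_in_Hom[of f "Dom C f" "Cod C f" g "Cod C g"] assms by auto

lemma Comp_assoc_right [simp]:
  assumes "f \<in> Ar C" "g \<in> Ar C" "h \<in> Ar C" "Dom C g = Cod C f" "Dom C h = Cod C g"
  shows "(h \<cdot> g) \<cdot> f = h \<cdot> (g \<cdot> f)"
  using Comp_assoc[of f "Dom C f" "Cod C f" g "Cod C g" h "Cod C h"] assms by auto

lemma Comp_Id_right [simp]: "f \<in> Ar C \<Longrightarrow> Dom C f = X \<Longrightarrow> f \<cdot> Id C X = f"
  using Comp_Id[of f X "Cod C f"] by auto

lemma Id_Comp_left [simp]: "f \<in> Ar C \<Longrightarrow> Cod C f = Y \<Longrightarrow> Id C Y \<cdot> f = f"
  using Id_Comp[of f "Dom C f" Y] by auto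

abbreviation Hom_group :: "'o \<Rightarrow> 'o \<Rightarrow> 'm monoid" where
  "Hom_group X Y \<equiv> \<lparr>carrier = Hom C X Y, monoid.mult = Add C, one = Zero C X Y\<rparr>"

lemma Zero_typing [simp]:
  assumes "X \<in> Ob C" "Y \<in> Ob C"
  shows "Zero C X Y \<in> Ar C" "Dom C (Zero C X Y) = X" "Cod C (Zero C X Y) = Y"
proof -
  interpret comm_group "Hom_group X Y" using Hom_comm_group assms .
  show "Zero C X Y \<in> Ar C" "Dom C (Zero C X Y) = X" "Cod C (Zero C X Y) = Y"
    using one_closed by auto
qed

lemma Add_typing [simp]:
  assumes "f \<in> Ar C" "g \<in> Ar C" "Dom C f = Dom C g" "Cod C f = Cod C g"
  shows "f \<oplus> g \<in> Ar C" "Dom C (f \<oplus> g) = Dom C g" "Cod C (f \<oplus> g) = Cod C g"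
proof -
  interpret comm_group "Hom_group (Dom C g) (Cod C g)" by (rule Hom_comm_group) (use assms in auto)
  show "f \<oplus> g \<in> Ar C" "Dom C (f \<oplus> g) = Dom C g" "Cod C (f \<oplus> g) = Cod C g"
    using m_closed[of f g] assms by auto
qed

lemma Add_commute:
  assumes "f \<in> Ar C" "g \<in> Ar C" "Dom C f = Dom C g" "Cod C f = Cod C g"
  shows "f \<oplus> g = g \<oplus> f"
proof -
  interpret comm_group "Hom_group (Dom C g) (Cod C g)" by (rule Hom_comm_group) (use assms in auto)
  show ?thesis using m_comm[of f g] assms by auto
qed

lemma Zero_Add [simp]:
  assumes "f \<in> Ar C" "Dom C f = X" "Cod C f = Y"
  shows "Zero C X Y \<oplus> f = f" "f \<oplus> Zero C X Y = f"
proof -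
  interpret comm_group "Hom_group X Y" by (rule Hom_comm_group) (use assms in auto)
  show "Zero C X Y \<oplus> f = f" "f \<oplus> Zero C X Y = f" using l_one[of f] r_one[of f] assms by auto
qed

lemma Add_left_cancel:
  assumes "a \<oplus> b = a \<oplus> c" "a \<in> Hom C X Y" "b \<in> Hom C X Y" "c \<in> Hom C X Y"
  shows "b = c"
proof -
  interpret comm_group "Hom_group X Y" by (rule Hom_comm_group) (use assms in auto)
  show ?thesis using assms Units_l_cancel[of a b c] Units_eq by auto
qed

text \<open>Zero is recognized without subtraction: adding \<open>b\<close> to some \<open>a\<close>
  changes nothing. Together with \<open>ex_diff\<close> this is how error terms are shown to vanish
  below.\<close>

lemma Add_eq_self:
  assumes "a \<oplus> b = a" "a \<in> Hom C X Y" "b \<in> Hom C X Y"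
  shows "b = Zero C X Y"
  using Add_left_cancel[of a b "Zero C X Y" X Y] assms Ar_Ob by auto

text \<open>This lemma replaces subtraction throughout.\<close>

lemma ex_diff:
  assumes "f \<in> Hom C X Y" "g \<in> Hom C X Y"
  obtains d where "d \<in> Hom C X Y" "f = g \<oplus> d"
proof -
  interpret comm_group "Hom_group X Y" by (rule Hom_comm_group) (use assms in auto)
  let ?n = "inv\<^bsub>Hom_group X Y\<^esub> g"
  have n: "?n \<in> Hom C X Y" using inv_closed[of g] assms by auto
  have "g \<oplus> ?n = Zero C X Y" using r_inv[of g] assms by auto
  then have "f = g \<oplus> (?n \<oplus> f)"
    using m_assoc[of g ?n f] l_one[of f] assms n by auto
  then show ?thesis using that[of "?n \<oplus> f"] n assms by auto
qed

lemma ex_neg: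
  assumes "f \<in> Hom C X Y"
  obtains n where "n \<in> Hom C X Y" "f \<oplus> n = Zero C X Y"
  using ex_diff[of "Zero C X Y" X Y f] assms Ar_Ob by (metis Hom_iff Zero_typing)

lemma Comp_Add_right [simp]:
  assumes "f \<in> Ar C" "f' \<in> Ar C" "g \<in> Ar C" "Dom C f = Dom C f'" "Cod C f = Cod C f'"
    "Dom C g = Cod C f'"
  shows "g \<cdot> (f \<oplus> f') = g \<cdot> f \<oplus> g \<cdot> f'"
  using Comp_Add[of f "Dom C f'" "Cod C f'" f' g "Cod C g"] assms by auto

lemma Add_Comp_left [simp]:
  assumes "f \<in> Ar C" "g \<in> Ar C" "g' \<in> Ar C" "Dom C g = Cod C f" "Dom C g' = Cod C f"
    "Cod C g = Cod C g'"
  shows "(g \<oplus> g') \<cdot> f = g \<cdot> f \<oplus> g' \<cdot> f"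
  using Add_Comp[of f "Dom C f" "Cod C f" g "Cod C g'" g'] assms by auto

lemma Comp_Zero [simp]:
  assumes "g \<in> Ar C" "Dom C g = Y" "X \<in> Ob C"
  shows "g \<cdot> Zero C X Y = Zero C X (Cod C g)"
proof -
  have Y: "Y \<in> Ob C" using assms by auto
  have "g \<cdot> (Zero C X Y \<oplus> Zero C X Y) = g \<cdot> Zero C X Y \<oplus> g \<cdot> Zero C X Y"
    by (rule Comp_Add_right) (use assms Y in auto)
  then show ?thesis
    using Add_eq_self[of "g \<cdot> Zero C X Y" "g \<cdot> Zero C X Y" X "Cod C g"] assms Y by auto
qed

lemma Zero_Comp [simp]:
  assumes "f \<in> Ar C" "Cod C f = Y" "Z \<in> Ob C"
  shows "Zero C Y Z \<cdot> f = Zero C (Dom C f) Z"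
proof -
  have Y: "Y \<in> Ob C" using assms by auto
  have "(Zero C Y Z \<oplus> Zero C Y Z) \<cdot> f = Zero C Y Z \<cdot> f \<oplus> Zero C Y Z \<cdot> f"
    by (rule Add_Comp_left) (use assms Y in auto)
  then show ?thesis
    using Add_eq_self[of "Zero C Y Z \<cdot> f" "Zero C Y Z \<cdot> f" "Dom C f" Z] assms Y by auto
qed

text \<open>Rewrites by \<open>g \<cdot> f = h\<close> inside the right-nested composites to which simp normalizes.\<close>

lemma Comp_eq_right:
  assumes "g \<cdot> f = h" "f \<in> Ar C" "g \<in> Ar C" "Dom C g = Cod C f" "x \<in> Ar C" "Dom C f = Cod C x"
  shows "g \<cdot> (f \<cdot> x) = h \<cdot> x"
  using Comp_assoc_right[of x f g] assms by auto

lemma monicD: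
  assumes "monic C f" "f \<cdot> g = f \<cdot> h" "f \<in> Hom C X Y" "g \<in> Hom C W X" "h \<in> Hom C W X"
  shows "g = h"
  using assms Ar_Ob(1)[of g] unfolding monic_def by auto

lemma epicD:
  assumes "epic C f" "g \<cdot> f = h \<cdot> f" "f \<in> Hom C X Y" "g \<in> Hom C Y W" "h \<in> Hom C Y W"
  shows "g = h"
  using assms Ar_Ob(2)[of g] unfolding epic_def by auto

lemma monicD0:
  assumes "monic C f" "f \<cdot> g = Zero C W Y" "f \<in> Hom C X Y" "g \<in> Hom C W X"
  shows "g = Zero C W X"
  by (rule monicD[OF assms(1) _ assms(3,4)]) (use assms Ar_Ob in auto)

lemma epicD0:
  assumes "epic C f" "g \<cdot> f = Zero C X W" "f \<in> Hom C X Y" "g \<in> Hom C Y W"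
  shows "g = Zero C Y W"
  by (rule epicD[OF assms(1) _ assms(3,4)]) (use assms Ar_Ob in auto)

text \<open>Two morphisms with the same composite differ by some \<open>d\<close> whose own
  composite is zero, so it is enough to test composites equal to zero.\<close>

lemma monicI:
  assumes f: "f \<in> Hom C X Y" and 0: "\<And>W g. g \<in> Hom C W X \<Longrightarrow> f \<cdot> g = Zero C W Y \<Longrightarrow> g = Zero C W X"
  shows "monic C f"
  unfolding monic_def
proof (intro conjI ballI impI)
  show "f \<in> Ar C" using f by auto
  fix W g h assume *: "g \<in> Hom C W (Dom C f)" "h \<in> Hom C W (Dom C f)" "f \<cdot> g = f \<cdot> h"
  obtain d where d: "d \<in> Hom C W X" "g = h \<oplus> d" using ex_diff[of g W X h] * f by auto
  have "f \<cdot> d = Zero C W Y"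
    by (rule Add_eq_self[of "f \<cdot> h"]) (use * d f in auto)
  then show "g = h" using 0[of d W] d * f by auto
qed

lemma epicI:
  assumes f: "f \<in> Hom C X Y" and 0: "\<And>W g. g \<in> Hom C Y W \<Longrightarrow> g \<cdot> f = Zero C X W \<Longrightarrow> g = Zero C Y W"
  shows "epic C f"
  unfolding epic_def
proof (intro conjI ballI impI)
  show "f \<in> Ar C" using f by auto
  fix W g h assume *: "g \<in> Hom C (Cod C f) W" "h \<in> Hom C (Cod C f) W" "g \<cdot> f = h \<cdot> f"
  obtain d where d: "d \<in> Hom C Y W" "g = h \<oplus> d" using ex_diff[of g Y W h] * f by auto
  have "d \<cdot> f = Zero C X W"
    by (rule Add_eq_self[of "h \<cdot> f"]) (use * d f in auto)
  then show "g = h" using 0[of d W] d * f by auto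
qed

lemma monic_Id: "X \<in> Ob C \<Longrightarrow> monic C (Id C X)"
  by (auto simp: monic_def)

lemma epic_Id: "X \<in> Ob C \<Longrightarrow> epic C (Id C X)"
  by (auto simp: epic_def)

lemma monic_Comp:
  assumes "monic C f" "monic C g" "f \<in> Hom C X Y" "g \<in> Hom C Y Z"
  shows "monic C (g \<cdot> f)"
proof (rule monicI)
  fix W t assume t: "t \<in> Hom C W X" "(g \<cdot> f) \<cdot> t = Zero C W Z"
  have "f \<cdot> t = Zero C W Y" by (rule monicD0[OF assms(2) _ assms(4)]) (use t assms in auto)
  then show "t = Zero C W X" using monicD0[OF assms(1)] assms t by blast
qed (use assms in auto)

lemma epic_Comp:
  assumes "epic C f" "epic C g" "f \<in> Hom C X Y" "g \<in> Hom C Y Z"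
  shows "epic C (g \<cdot> f)"
proof (rule epicI)
  fix W t assume t: "t \<in> Hom C Z W" "t \<cdot> (g \<cdot> f) = Zero C X W"
  have "t \<cdot> g = Zero C Y W" by (rule epicD0[OF assms(1) _ assms(3)]) (use t assms in auto)
  then show "t = Zero C Z W" using epicD0[OF assms(2)] assms t by blast
qed (use assms in auto)

lemma epic_Comp_cancel:
  assumes "epic C (g \<cdot> f)" "f \<in> Hom C X Y" "g \<in> Hom C Y Z"
  shows "epic C g"
proof (rule epicI)
  fix W t assume "t \<in> Hom C Z W" "t \<cdot> g = Zero C Y W"
  then show "t = Zero C Z W"
    using assms epicD0[OF assms(1), of t X W Z] Comp_assoc_right[of f g t] Ar_Ob(2)[of t] by auto
qed (use assms in auto)

lemma is_kernelI:
  assumes "k \<in> Hom C K X" "f \<in> Hom C X Y" "f \<cdot> k = Zero C K Y" "monic C k"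
    and "\<And>W g. g \<in> Hom C W X \<Longrightarrow> f \<cdot> g = Zero C W Y \<Longrightarrow> \<exists>h\<in>Hom C W K. k \<cdot> h = g"
  shows "is_kernel C k f"
  unfolding is_kernel_def
proof (intro conjI ballI impI)
  fix W g assume "g \<in> Hom C W (Dom C f)" "f \<cdot> g = Zero C W (Cod C f)"
  then obtain h where h: "h \<in> Hom C W K" "k \<cdot> h = g" using assms(5)[of g W] assms(2) by auto
  show "\<exists>!h. h \<in> Hom C W (Dom C k) \<and> k \<cdot> h = g"
  proof (rule ex1I[of _ h])
    fix h' assume h': "h' \<in> Hom C W (Dom C k) \<and> k \<cdot> h' = g"
    show "h' = h" by (rule monicD[OF assms(4)]) (use h h' assms(1) in auto)
  qed (use h assms in auto)
qed (use assms in auto)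

lemma is_cokernelI:
  assumes "c \<in> Hom C Y Q" "f \<in> Hom C X Y" "c \<cdot> f = Zero C X Q" "epic C c"
    and "\<And>W g. g \<in> Hom C Y W \<Longrightarrow> g \<cdot> f = Zero C X W \<Longrightarrow> \<exists>h\<in>Hom C Q W. h \<cdot> c = g"
  shows "is_cokernel C c f"
  unfolding is_cokernel_def
proof (intro conjI ballI impI)
  fix W g assume "g \<in> Hom C (Cod C f) W" "g \<cdot> f = Zero C (Dom C f) W"
  then obtain h where h: "h \<in> Hom C Q W" "h \<cdot> c = g" using assms(5)[of g W] assms(2) by auto
  show "\<exists>!h. h \<in> Hom C (Cod C c) W \<and> h \<cdot> c = g"
  proof (rule ex1I[of _ h])
    fix h' assume h': "h' \<in> Hom C (Cod C c) W \<and> h' \<cdot> c = g"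
    show "h' = h" by (rule epicD[OF assms(4)]) (use h h' assms(1) in auto)
  qed (use h assms in auto)
qed (use assms in auto)

lemma is_kernelD:
  assumes "is_kernel C k f"
  shows "k \<in> Ar C" "f \<in> Ar C" "Cod C k = Dom C f" "f \<cdot> k = Zero C (Dom C k) (Cod C f)" "monic C k"
proof -
  show *: "k \<in> Ar C" "f \<in> Ar C" "Cod C k = Dom C f" "f \<cdot> k = Zero C (Dom C k) (Cod C f)"
    using assms by (auto simp: is_kernel_def)
  show "monic C k"
    unfolding monic_def
  proof (intro conjI ballI impI *)
    fix W g h assume W: "W \<in> Ob C" and g: "g \<in> Hom C W (Dom C k)" and h: "h \<in> Hom C W (Dom C k)"
      and eq: "k \<cdot> g = k \<cdot> h"
    have "f \<cdot> (k \<cdot> h) = Zero C W (Cod C f)"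
      using Comp_assoc_right[of h k f] * h by auto
    then have "\<exists>!u. u \<in> Hom C W (Dom C k) \<and> k \<cdot> u = k \<cdot> h"
      using assms W h * unfolding is_kernel_def by auto
    then show "g = h" using g h eq by auto
  qed
qed

lemma is_cokernelD:
  assumes "is_cokernel C c f"
  shows "c \<in> Ar C" "f \<in> Ar C" "Dom C c = Cod C f" "c \<cdot> f = Zero C (Dom C f) (Cod C c)" "epic C c"
proof -
  show *: "c \<in> Ar C" "f \<in> Ar C" "Dom C c = Cod C f" "c \<cdot> f = Zero C (Dom C f) (Cod C c)"
    using assms by (auto simp: is_cokernel_def)
  show "epic C c"
    unfolding epic_def
  proof (intro conjI ballI impI *)
    fix W g h assume W: "W \<in> Ob C" and g: "g \<in> Hom C (Cod C c) W" and h: "h \<in> Hom C (Cod C c) W"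
      and eq: "g \<cdot> c = h \<cdot> c"
    have "(h \<cdot> c) \<cdot> f = Zero C (Dom C f) W" using * h by auto
    then have "\<exists>!u. u \<in> Hom C (Cod C c) W \<and> u \<cdot> c = h \<cdot> c"
      using assms W h * unfolding is_cokernel_def by auto
    then show "g = h" using g h eq by auto
  qed
qed

lemma is_kernel_lift:
  assumes "is_kernel C k f" "k \<in> Hom C K X" "f \<in> Hom C X Y" "g \<in> Hom C W X" "f \<cdot> g = Zero C W Y"
  obtains h where "h \<in> Hom C W K" "k \<cdot> h = g"
proof -
  have "\<exists>!h. h \<in> Hom C W (Dom C k) \<and> k \<cdot> h = g"
    using assms Ar_Ob(1)[of g] unfolding is_kernel_def by auto
  then show ?thesis using that assms(2) by auto
qed

lemma is_cokernel_desc: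
  assumes "is_cokernel C c f" "c \<in> Hom C Y Q" "f \<in> Hom C X Y" "g \<in> Hom C Y W" "g \<cdot> f = Zero C X W"
  obtains h where "h \<in> Hom C Q W" "h \<cdot> c = g"
proof -
  have "\<exists>!h. h \<in> Hom C (Cod C c) W \<and> h \<cdot> c = g"
    using assms Ar_Ob(2)[of g] unfolding is_cokernel_def by auto
  then show ?thesis using that assms(2) by auto
qed

text \<open>\<open>is_biproduct\<close> hides the injections and projections behind quantifiers;
  here they are parameters, so that they can be fixed once and computed with.\<close>

definition biproduct_maps :: "'o \<Rightarrow> 'o \<Rightarrow> 'o \<Rightarrow> 'm \<Rightarrow> 'm \<Rightarrow> 'm \<Rightarrow> 'm \<Rightarrow> bool" where
  "biproduct_maps X Y B i j p q \<longleftrightarrow>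
     i \<in> Hom C X B \<and> j \<in> Hom C Y B \<and> p \<in> Hom C B X \<and> q \<in> Hom C B Y \<and>
     p \<cdot> i = Id C X \<and> q \<cdot> j = Id C Y \<and> p \<cdot> j = Zero C Y X \<and> q \<cdot> i = Zero C X Y \<and>
     i \<cdot> p \<oplus> j \<cdot> q = Id C B"

lemma biproduct_mapsD:
  assumes "biproduct_maps X Y B i j p q"
  shows "i \<in> Hom C X B" "j \<in> Hom C Y B" "p \<in> Hom C B X" "q \<in> Hom C B Y"
    "p \<cdot> i = Id C X" "q \<cdot> j = Id C Y" "p \<cdot> j = Zero C Y X" "q \<cdot> i = Zero C X Y"
    "i \<cdot> p \<oplus> j \<cdot> q = Id C B"
  using assms unfolding biproduct_maps_def by blast+

lemma is_biproductE:
  assumes "is_biproduct C X Y B"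
  obtains i j p q where "biproduct_maps X Y B i j p q" "B \<in> Ob C"
  using assms unfolding is_biproduct_def biproduct_maps_def by blast

end

section \<open>Short exact sequences\<close>

context abelian_category
begin

text \<open>The axiom makes \<open>k\<close> a kernel of some \<open>f\<close>, which need not be
  \<open>c\<close>. But \<open>f\<close> factors through the cokernel \<open>c\<close>, so whatever
  \<open>c\<close> kills is killed by \<open>f\<close> and factors through \<open>k\<close>.\<close>

lemma monic_is_kernel_of_cokernel:
  assumes "monic C k" "is_cokernel C c k"
  shows "is_kernel C k c"
proof -
  obtain f where f: "is_kernel C k f" using monic_is_kernel assms(1) by blast
  note F = is_kernelD[OF f] and c = is_cokernelD[OF assms(2)]
  obtain u where u: "u \<in> Hom C (Cod C c) (Cod C f)" "u \<cdot> c = f"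
    using is_cokernel_desc[OF assms(2), of "Cod C k" "Cod C c" "Dom C k" f "Cod C f"] F c by auto
  show ?thesis
  proof (rule is_kernelI)
    fix W g assume g: "g \<in> Hom C W (Cod C k)" "c \<cdot> g = Zero C W (Cod C c)"
    have "f \<cdot> g = u \<cdot> (c \<cdot> g)" using Comp_assoc_right[of g c u] g u c by auto
    then have "f \<cdot> g = Zero C W (Cod C f)" using g u c Ar_Ob(1)[of g] by auto
    then obtain h where "h \<in> Hom C W (Dom C k)" "k \<cdot> h = g"
      using is_kernel_lift[OF f, of "Dom C k" "Cod C k" "Cod C f" g W] F g(1) by auto
    then show "\<exists>h\<in>Hom C W (Dom C k). k \<cdot> h = g" by blast
  qed (use F c assms in auto)
qed

lemma epic_is_cokernel_of_kernel:
  assumes "epic C c" "is_kernel C k c"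
  shows "is_cokernel C c k"
proof -
  obtain f where f: "is_cokernel C c f" using epic_is_cokernel assms(1) by blast
  note F = is_cokernelD[OF f] and k = is_kernelD[OF assms(2)]
  obtain u where u: "u \<in> Hom C (Dom C f) (Dom C k)" "k \<cdot> u = f"
    using is_kernel_lift[OF assms(2), of "Dom C k" "Dom C c" "Cod C c" f "Dom C f"] F k by auto
  show ?thesis
  proof (rule is_cokernelI)
    fix W g assume g: "g \<in> Hom C (Dom C c) W" "g \<cdot> k = Zero C (Dom C k) W"
    have "g \<cdot> f = (g \<cdot> k) \<cdot> u" using Comp_assoc_right[of u k g] g u k by auto
    then have "g \<cdot> f = Zero C (Dom C f) W" using g u k Ar_Ob(2)[of g] by auto
    then obtain h where "h \<in> Hom C (Cod C c) W" "h \<cdot> c = g"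
      using is_cokernel_desc[OF f, of "Dom C c" "Cod C c" "Dom C f" g W] F g(1) by auto
    then show "\<exists>h\<in>Hom C (Cod C c) W. h \<cdot> c = g" by blast
  qed (use F k assms in auto)
qed

lemma short_exactI:
  assumes "is_kernel C f g" "epic C g"
  shows "short_exact C f g"
proof -
  note k = is_kernelD[OF assms(1)]
  have "exact C f g"
    unfolding exact_def
    by (intro exI[of _ f] exI[of _ "Id C (Dom C f)"]) (use k assms epic_Id in auto)
  then show ?thesis using k assms by (simp add: short_exact_def)
qed

lemma short_exactI':
  assumes "monic C f" "is_cokernel C g f"
  shows "short_exact C f g"
  using short_exactI monic_is_kernel_of_cokernel[OF assms] is_cokernelD[OF assms(2)] by blast

text \<open>Since \<open>f\<close> is monic, so is its epic factor \<open>e\<close>. Then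
  \<open>e\<close> is the kernel of some \<open>t\<close>, and \<open>t \<cdot> e = 0\<close> forces
  \<open>t = 0\<close>; hence the identity factors through \<open>e\<close>, and the resulting right
  inverse \<open>i\<close> of \<open>e\<close> turns factorizations through \<open>k\<close> into
  factorizations through \<open>f\<close>.\<close>

lemma exact_monic_is_kernel:
  assumes "monic C f" "exact C f g"
  shows "is_kernel C f g"
proof -
  obtain k e where k: "is_kernel C k g" and e: "epic C e" "Cod C e = Dom C k" and f: "f = k \<cdot> e"
    using assms(2) unfolding exact_def by blast
  note K = is_kernelD[OF k]
  have eA: "e \<in> Ar C" using e by (simp add: epic_def)
  have em: "monic C e"
  proof (rule monicI)
    fix W t assume t: "t \<in> Hom C W (Dom C e)" "e \<cdot> t = Zero C W (Cod C e)"
    have "f \<cdot> t = Zero C W (Cod C f)" using t f e eA K Ar_Ob(1)[of t] by auto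
    then show "t = Zero C W (Dom C e)"
      using monicD0[OF assms(1), of t W "Cod C f" "Dom C e"] t f e eA K by auto
  qed (use eA in auto)
  obtain t where t: "is_kernel C e t" using monic_is_kernel em by blast
  note T = is_kernelD[OF t]
  have "t = Zero C (Cod C e) (Cod C t)"
    by (rule epicD0[OF e(1), of _ "Dom C e"]) (use T in auto)
  then obtain i where i: "i \<in> Hom C (Cod C e) (Dom C e)" "e \<cdot> i = Id C (Cod C e)"
    using is_kernel_lift[OF t, of "Dom C e" "Cod C e" "Cod C t" "Id C (Cod C e)" "Cod C e"] T
    by (metis Ar_Ob(2) Comp_Id_right Hom_iff Id_in_Hom)
  show ?thesis
  proof (rule is_kernelI)
    show "g \<cdot> f = Zero C (Dom C f) (Cod C g)"
      using K e eA f Comp_eq_right[OF K(4), of e] by auto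
    fix W x assume x: "x \<in> Hom C W (Dom C g)" "g \<cdot> x = Zero C W (Cod C g)"
    then obtain y where y: "y \<in> Hom C W (Dom C k)" "k \<cdot> y = x"
      using is_kernel_lift[OF k, of "Dom C k" "Dom C g" "Cod C g" x W] K by auto
    have "f \<cdot> (i \<cdot> y) = x" using f y i e eA K Comp_eq_right[OF i(2), of y] by auto
    then show "\<exists>h\<in>Hom C W (Dom C f). f \<cdot> h = x"
      by (intro bexI[of _ "i \<cdot> y"]) (use f y i e eA K in auto)
  qed (use f K eA e assms in auto)
qed

lemma short_exactD:
  assumes "short_exact C f g"
  shows "is_kernel C f g" "is_cokernel C g f" "monic C f" "epic C g"
    "f \<in> Ar C" "g \<in> Ar C" "Cod C f = Dom C g" "g \<cdot> f = Zero C (Dom C f) (Cod C g)"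
proof -
  show k: "is_kernel C f g" and e: "monic C f" "epic C g"
    using assms exact_monic_is_kernel unfolding short_exact_def by auto
  show "is_cokernel C g f" using epic_is_cokernel_of_kernel k e by blast
  show "f \<in> Ar C" "g \<in> Ar C" "Cod C f = Dom C g" "g \<cdot> f = Zero C (Dom C f) (Cod C g)"
    using is_kernelD[OF k] by auto
qed

lemma short_exact_lift:
  assumes "short_exact C f g" "x \<in> Hom C W (Dom C g)" "g \<cdot> x = Zero C W (Cod C g)"
  obtains y where "y \<in> Hom C W (Dom C f)" "f \<cdot> y = x"
  using is_kernel_lift[OF short_exactD(1)[OF assms(1)], of "Dom C f" "Dom C g" "Cod C g" x W]
    assms short_exactD[OF assms(1)] by auto

lemma short_exact_desc:
  assumes "short_exact C f g" "x \<in> Hom C (Dom C g) W" "x \<cdot> f = Zero C (Dom C f) W"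
  obtains y where "y \<in> Hom C (Cod C g) W" "y \<cdot> g = x"
  using is_cokernel_desc[OF short_exactD(2)[OF assms(1)], of "Dom C g" "Cod C g" "Dom C f" x W]
    assms short_exactD[OF assms(1)] by auto

lemma ex_short_exact_monic:
  assumes "monic C f"
  obtains g where "short_exact C f g"
  using assms ex_cokernel[of f] short_exactI' unfolding monic_def by blast

lemma ex_short_exact_epic:
  assumes "epic C g"
  obtains f where "short_exact C f g"
  using assms ex_kernel[of g] short_exactI unfolding epic_def by blast

section \<open>Biproducts and their universal properties\<close>

lemma biproduct_short_exact:
  assumes "biproduct_maps X Y B i j p q"
  shows "short_exact C i q"
proof (rule short_exactI)
  note bp = biproduct_mapsD[OF assms]
  have Ob: "X \<in> Ob C" "Y \<in> Ob C" "B \<in> Ob C" using bp Ar_Ob by auto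
  show "is_kernel C i q"
  proof (rule is_kernelI)
    show "monic C i"
    proof (rule monicI)
      fix W g assume g: "g \<in> Hom C W X" "i \<cdot> g = Zero C W B"
      have "g = p \<cdot> (i \<cdot> g)" using Comp_eq_right[OF bp(5), of g] g bp Ob by auto
      also have "\<dots> = Zero C W X" unfolding g(2) using g bp Ar_Ob(1)[of g] by auto
      finally show "g = Zero C W X" .
    qed (use bp in auto)
    fix W g assume g: "g \<in> Hom C W B" "q \<cdot> g = Zero C W Y"
    have "g = Id C B \<cdot> g" using g bp by auto
    also have "\<dots> = (i \<cdot> p \<oplus> j \<cdot> q) \<cdot> g" using bp by simp
    also have "\<dots> = i \<cdot> (p \<cdot> g) \<oplus> j \<cdot> (q \<cdot> g)"
      by (subst Add_Comp_left) (use g bp Ob in auto)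
    also have "\<dots> = i \<cdot> (p \<cdot> g)" using g bp Ar_Ob(1)[of g] by auto
    finally have "i \<cdot> (p \<cdot> g) = g" by (rule sym)
    then show "\<exists>h\<in>Hom C W X. i \<cdot> h = g" using g bp by (intro bexI[of _ "p \<cdot> g"]) auto
  qed (use bp in auto)
  show "epic C q"
  proof (rule epicI)
    fix W g assume g: "g \<in> Hom C Y W" "g \<cdot> q = Zero C B W"
    have "g = (g \<cdot> q) \<cdot> j" using g(1) bp Ob by auto
    also have "\<dots> = Zero C Y W" unfolding g(2) using g bp Ar_Ob(2)[of g] by auto
    finally show "g = Zero C Y W" .
  qed (use bp in auto)
qed

lemma biproduct_arrow_eqI:
  assumes "biproduct_maps X Y B i j p q" "f \<in> Hom C B W" "g \<in> Hom C B W" "f \<cdot> i = g \<cdot> i" "f \<cdot> j = g \<cdot> j"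
  shows "f = g"
proof -
  note bp = biproduct_mapsD[OF assms(1)]
  have *: "h = (h \<cdot> i) \<cdot> p \<oplus> (h \<cdot> j) \<cdot> q" if "h \<in> Hom C B W" for h
  proof -
    have "h = h \<cdot> (i \<cdot> p \<oplus> j \<cdot> q)" unfolding bp(9) using bp(1) that by auto
    also have "\<dots> = (h \<cdot> i) \<cdot> p \<oplus> (h \<cdot> j) \<cdot> q"
      by (subst Comp_Add_right) (use bp that in auto)
    finally show ?thesis .
  qed
  show ?thesis using *[OF assms(2)] *[OF assms(3)] assms(4,5) by metis
qed

lemma biproduct_arrow_eqI':
  assumes "biproduct_maps X Y B i j p q" "f \<in> Hom C W B" "g \<in> Hom C W B" "p \<cdot> f = p \<cdot> g" "q \<cdot> f = q \<cdot> g"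
  shows "f = g"
proof -
  note bp = biproduct_mapsD[OF assms(1)]
  have *: "h = i \<cdot> (p \<cdot> h) \<oplus> j \<cdot> (q \<cdot> h)" if "h \<in> Hom C W B" for h
  proof -
    have "h = (i \<cdot> p \<oplus> j \<cdot> q) \<cdot> h" unfolding bp(9) using bp(1) that by auto
    also have "\<dots> = i \<cdot> (p \<cdot> h) \<oplus> j \<cdot> (q \<cdot> h)"
      by (subst Add_Comp_left) (use bp that in auto)
    finally show ?thesis .
  qed
  show ?thesis using *[OF assms(2)] *[OF assms(3)] assms(4,5) by metis
qed

lemma biproduct_pair:
  assumes "biproduct_maps X Y B i j p q" "a \<in> Hom C W X" "b \<in> Hom C W Y"
  obtains h where "h \<in> Hom C W B" "p \<cdot> h = a" "q \<cdot> h = b"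
proof (rule that[of "i \<cdot> a \<oplus> j \<cdot> b"])
  note bp = biproduct_mapsD[OF assms(1)]
  have Ob: "X \<in> Ob C" "Y \<in> Ob C" "W \<in> Ob C" using bp assms(2,3) Ar_Ob by auto
  show "i \<cdot> a \<oplus> j \<cdot> b \<in> Hom C W B" using bp assms(2,3) by auto
  show "p \<cdot> (i \<cdot> a \<oplus> j \<cdot> b) = a"
    using bp assms(2,3) Ob Comp_eq_right[OF bp(5), of a] Comp_eq_right[OF bp(7), of b] by auto
  show "q \<cdot> (i \<cdot> a \<oplus> j \<cdot> b) = b"
    using bp assms(2,3) Ob Comp_eq_right[OF bp(8), of a] Comp_eq_right[OF bp(6), of b] by auto
qed

lemma biproduct_copair:
  assumes "biproduct_maps X Y B i j p q" "a \<in> Hom C X W" "b \<in> Hom C Y W"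
  obtains h where "h \<in> Hom C B W" "h \<cdot> i = a" "h \<cdot> j = b"
proof (rule that[of "a \<cdot> p \<oplus> b \<cdot> q"])
  note bp = biproduct_mapsD[OF assms(1)]
  have Ob: "X \<in> Ob C" "Y \<in> Ob C" "W \<in> Ob C" using bp assms(2,3) Ar_Ob by auto
  show "a \<cdot> p \<oplus> b \<cdot> q \<in> Hom C B W" using bp assms(2,3) by auto
  show "(a \<cdot> p \<oplus> b \<cdot> q) \<cdot> i = a" using bp assms(2,3) Ob by auto
  show "(a \<cdot> p \<oplus> b \<cdot> q) \<cdot> j = b" using bp assms(2,3) Ob by auto
qed

section \<open>Pullbacks and pushouts of short exact sequences\<close>

lemma pullback_short_exact:
  assumes fg: "short_exact C f g" and h: "h \<in> Hom C X (Cod C g)"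
  obtains E' f' g' h' where "short_exact C f' g'" "f' \<in> Hom C (Dom C f) E'" "g' \<in> Hom C E' X"
    "h' \<in> Hom C E' (Dom C g)" "h' \<cdot> f' = f" "g \<cdot> h' = h \<cdot> g'"
    "\<And>W a b. a \<in> Hom C W (Dom C g) \<Longrightarrow> b \<in> Hom C W X \<Longrightarrow> g \<cdot> a = h \<cdot> b \<Longrightarrow>
       \<exists>y\<in>Hom C W E'. h' \<cdot> y = a \<and> g' \<cdot> y = b"
proof -
  let ?F = "Dom C f" and ?E = "Dom C g" and ?Y = "Cod C g"
  note s = short_exactD[OF fg]
  have Ob: "X \<in> Ob C" "?E \<in> Ob C" "?Y \<in> Ob C" "?F \<in> Ob C" using h s by auto
  obtain B where B: "is_biproduct C ?E X B" using ex_biproduct Ob by blast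
  obtain i j p q where bp: "biproduct_maps ?E X B i j p q" using is_biproductE[OF B] .
  note ijpq = biproduct_mapsD[OF bp]
  \<comment> \<open>\<open>n\<close> is the negative of \<open>h\<close>, so \<open>m\<close> is the
    difference of \<open>g \<cdot> p\<close> and \<open>h \<cdot> q\<close> on the biproduct, and
    the pullback is the kernel of \<open>m\<close>. It is epic because it restricts to
    \<open>g\<close> on \<open>Dom C g\<close>.\<close>
  obtain n where n: "n \<in> Hom C X ?Y" "h \<oplus> n = Zero C X ?Y" using ex_neg[OF h] by blast
  define m where "m = g \<cdot> p \<oplus> n \<cdot> q"
  have m: "m \<in> Hom C B ?Y" using n ijpq s by (auto simp: m_def)
  have mi: "m \<cdot> i = g" using n ijpq s Ob by (auto simp: m_def)
  have meq: "m \<cdot> x = Zero C W ?Y \<longleftrightarrow> g \<cdot> (p \<cdot> x) = h \<cdot> (q \<cdot> x)" if x: "x \<in> Hom C W B" for W x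
  proof -
    have W: "W \<in> Ob C" using x Ar_Ob by auto
    have 1: "m \<cdot> x = n \<cdot> (q \<cdot> x) \<oplus> g \<cdot> (p \<cdot> x)" using x n ijpq s
      by (auto simp: m_def intro!: Add_commute)
    have "n \<cdot> (q \<cdot> x) \<oplus> h \<cdot> (q \<cdot> x) = (h \<oplus> n) \<cdot> (q \<cdot> x)"
      by (subst Add_Comp_left) (use x n ijpq s h in \<open>auto intro!: Add_commute\<close>)
    then have 2: "n \<cdot> (q \<cdot> x) \<oplus> h \<cdot> (q \<cdot> x) = Zero C W ?Y"
      using x n ijpq s by auto
    have "n \<cdot> (q \<cdot> x) \<in> Hom C W ?Y" "g \<cdot> (p \<cdot> x) \<in> Hom C W ?Y" "h \<cdot> (q \<cdot> x) \<in> Hom C W ?Y"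
      using x n ijpq s h by auto
    then show ?thesis unfolding 1 using 2 Add_left_cancel by metis
  qed
  have me: "epic C m" using epic_Comp_cancel[of m i] mi s(4) ijpq m by auto
  obtain k where k: "short_exact C k m" using ex_short_exact_epic[OF me] .
  note K = short_exactD[OF k]
  define E' where "E' = Dom C k"
  have kH: "k \<in> Hom C E' B" using K m by (auto simp: E'_def)
  have pk: "p \<cdot> k \<in> Hom C E' ?E" and qk: "q \<cdot> k \<in> Hom C E' X" using kH ijpq by auto
  have sq: "g \<cdot> (p \<cdot> k) = h \<cdot> (q \<cdot> k)" using meq[OF kH] K m kH by auto
  have univ: "\<exists>y\<in>Hom C W E'. (p \<cdot> k) \<cdot> y = a \<and> (q \<cdot> k) \<cdot> y = b"
    if a: "a \<in> Hom C W ?E" and b: "b \<in> Hom C W X" and eq: "g \<cdot> a = h \<cdot> b" for W a b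
  proof -
    obtain x where x: "x \<in> Hom C W B" "p \<cdot> x = a" "q \<cdot> x = b"
      using biproduct_pair[OF bp a b] .
    then have "m \<cdot> x = Zero C W ?Y" using meq eq by auto
    then obtain y where y: "y \<in> Hom C W E'" "k \<cdot> y = x"
      using short_exact_lift[OF k, of x W] x m by (auto simp: E'_def)
    have "y \<in> Hom C W E'" "(p \<cdot> k) \<cdot> y = a" "(q \<cdot> k) \<cdot> y = b" using x y kH ijpq by simp_all
    then show ?thesis by blast
  qed
  have mono: "y = y'" if "y \<in> Hom C W E'" "y' \<in> Hom C W E'" "(p \<cdot> k) \<cdot> y = (p \<cdot> k) \<cdot> y'"
    "(q \<cdot> k) \<cdot> y = (q \<cdot> k) \<cdot> y'" for W y y'
  proof -
    have "k \<cdot> y = k \<cdot> y'"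
      by (rule biproduct_arrow_eqI'[OF bp, of _ W]) (use that kH ijpq in auto)
    then show ?thesis using monicD[OF K(3) _ kH] that by blast
  qed
  have "\<exists>y\<in>Hom C ?F E'. (p \<cdot> k) \<cdot> y = f \<and> (q \<cdot> k) \<cdot> y = Zero C ?F X"
    by (rule univ) (use s h Ob in auto)
  then obtain f' where f': "f' \<in> Hom C ?F E'" "(p \<cdot> k) \<cdot> f' = f" "(q \<cdot> k) \<cdot> f' = Zero C ?F X"
    by blast
  have ses: "short_exact C f' (q \<cdot> k)"
  proof (rule short_exactI)
    show "epic C (q \<cdot> k)"
    proof (rule epicI[OF qk])
      fix W t assume t: "t \<in> Hom C X W" "t \<cdot> (q \<cdot> k) = Zero C E' W"
      have WO: "W \<in> Ob C" using t Ar_Ob by auto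
      have "(t \<cdot> q) \<cdot> k = Zero C E' W" using t kH ijpq by auto
      \<comment> \<open>If \<open>t\<close> kills the pullback, \<open>t \<cdot> q\<close> factors
        through \<open>m\<close> as \<open>u\<close>. Restricting to \<open>Dom C g\<close> gives
        \<open>u \<cdot> g = 0\<close>, so \<open>u\<close> and with it \<open>t\<close>
        vanish.\<close>
      then obtain u where u: "u \<in> Hom C ?Y W" "u \<cdot> m = t \<cdot> q"
        using short_exact_desc[OF k, of "t \<cdot> q" W] t ijpq m kH by (auto simp: E'_def)
      have "u \<cdot> g = (t \<cdot> q) \<cdot> i" using u mi ijpq m Comp_assoc_right[of i m u] by auto
      also have "\<dots> = Zero C ?E W" using t ijpq Ob by auto
      finally have "u = Zero C ?Y W" using epicD0[OF s(4), of u ?E W ?Y] u s by auto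
      then have "t \<cdot> q = Zero C B W" using u m WO by auto
      then have "(t \<cdot> q) \<cdot> j = Zero C X W" using ijpq WO by auto
      then show "t = Zero C X W" using t ijpq by auto
    qed
    show "is_kernel C f' (q \<cdot> k)"
    proof (rule is_kernelI[OF f'(1) qk f'(3)])
      show "monic C f'"
      proof (rule monicI[OF f'(1)])
        fix W x assume x: "x \<in> Hom C W ?F" "f' \<cdot> x = Zero C W E'"
        have "f \<cdot> x = (p \<cdot> k) \<cdot> (f' \<cdot> x)"
          using f' x pk Comp_assoc_right[of x f' "p \<cdot> k"] by auto
        also have "\<dots> = Zero C W ?E" using x pk Ar_Ob(1)[of x] by (metis Comp_Zero Hom_iff)
        finally show "x = Zero C W ?F" using monicD0[OF s(3), of x W ?E ?F] x s by auto
      qed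
      fix W x assume x: "x \<in> Hom C W E'" "(q \<cdot> k) \<cdot> x = Zero C W X"
      have WO: "W \<in> Ob C" using x Ar_Ob by auto
      have "g \<cdot> ((p \<cdot> k) \<cdot> x) = (g \<cdot> (p \<cdot> k)) \<cdot> x" using x pk s kH ijpq by auto
      also have "\<dots> = h \<cdot> ((q \<cdot> k) \<cdot> x)" unfolding sq using x(1) qk h kH ijpq by auto
      also have "\<dots> = Zero C W ?Y" using x h WO by auto
      finally obtain y where y: "y \<in> Hom C W ?F" "f \<cdot> y = (p \<cdot> k) \<cdot> x"
        using short_exact_lift[OF fg, of "(p \<cdot> k) \<cdot> x" W] x pk kH ijpq by auto
      have "f' \<cdot> y = x"
      proof (rule mono)
        show "(p \<cdot> k) \<cdot> (f' \<cdot> y) = (p \<cdot> k) \<cdot> x"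
          using y f' pk Comp_assoc_right[of y f' "p \<cdot> k"] by (metis Hom_iff)
        have "(q \<cdot> k) \<cdot> (f' \<cdot> y) = Zero C ?F X \<cdot> y"
          using y f' qk Comp_assoc_right[of y f' "q \<cdot> k"] by (metis Hom_iff)
        then show "(q \<cdot> k) \<cdot> (f' \<cdot> y) = (q \<cdot> k) \<cdot> x" using x y Ob by auto
      qed (use y f' x in auto)
      then show "\<exists>y\<in>Hom C W ?F. f' \<cdot> y = x" using y by blast
    qed
  qed
  show ?thesis
    by (rule that[OF ses f'(1) qk pk f'(2) sq univ])
qed

text \<open>Dually, the pushout is the cokernel of the morphism with components \<open>f\<close> and
  minus \<open>h\<close>, which is monic since its first component is. Uniqueness is exported as
  well: equality of morphisms out of a pushout is later checked on \<open>h'\<close> and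
  \<open>f'\<close>.\<close>

lemma pushout_short_exact:
  assumes fg: "short_exact C f g" and h: "h \<in> Hom C (Dom C f) X"
  obtains E' f' g' h' where "short_exact C f' g'" "f' \<in> Hom C X E'" "g' \<in> Hom C E' (Cod C g)"
    "h' \<in> Hom C (Dom C g) E'" "g' \<cdot> h' = g" "h' \<cdot> f = f' \<cdot> h"
    "\<And>W a b. a \<in> Hom C (Dom C g) W \<Longrightarrow> b \<in> Hom C X W \<Longrightarrow> a \<cdot> f = b \<cdot> h \<Longrightarrow>
       \<exists>y\<in>Hom C E' W. y \<cdot> h' = a \<and> y \<cdot> f' = b"
    "\<And>W y y'. y \<in> Hom C E' W \<Longrightarrow> y' \<in> Hom C E' W \<Longrightarrow> y \<cdot> h' = y' \<cdot> h' \<Longrightarrow> y \<cdot> f' = y' \<cdot> f' \<Longrightarrow> y = y'"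
proof -
  let ?F = "Dom C f" and ?E = "Dom C g" and ?Y = "Cod C g"
  note s = short_exactD[OF fg]
  have Ob: "X \<in> Ob C" "?E \<in> Ob C" "?Y \<in> Ob C" "?F \<in> Ob C" using h s by auto
  obtain B where B: "is_biproduct C ?E X B" using ex_biproduct Ob by blast
  obtain i j p q where bp: "biproduct_maps ?E X B i j p q" using is_biproductE[OF B] .
  note ijpq = biproduct_mapsD[OF bp]
  obtain n where n: "n \<in> Hom C ?F X" "h \<oplus> n = Zero C ?F X" using ex_neg[OF h] by blast
  define m where "m = i \<cdot> f \<oplus> j \<cdot> n"
  have m: "m \<in> Hom C ?F B" using n ijpq s by (auto simp: m_def)
  have pm: "p \<cdot> m = f"
    using n ijpq s Ob Comp_eq_right[OF ijpq(5), of f] Comp_eq_right[OF ijpq(7), of n] by (auto simp: m_def)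
  have meq: "x \<cdot> m = Zero C ?F W \<longleftrightarrow> (x \<cdot> i) \<cdot> f = (x \<cdot> j) \<cdot> h" if x: "x \<in> Hom C B W" for W x
  proof -
    have W: "W \<in> Ob C" using x Ar_Ob by auto
    have 1: "x \<cdot> m = (x \<cdot> j) \<cdot> n \<oplus> (x \<cdot> i) \<cdot> f" using x n ijpq s
      by (auto simp: m_def intro!: Add_commute)
    have "(x \<cdot> j) \<cdot> n \<oplus> (x \<cdot> j) \<cdot> h = (x \<cdot> j) \<cdot> (h \<oplus> n)"
      by (subst Comp_Add_right) (use x n ijpq s h in \<open>auto intro!: Add_commute\<close>)
    then have 2: "(x \<cdot> j) \<cdot> n \<oplus> (x \<cdot> j) \<cdot> h = Zero C ?F W"
      using x n ijpq s by auto
    have "(x \<cdot> j) \<cdot> n \<in> Hom C ?F W" "(x \<cdot> i) \<cdot> f \<in> Hom C ?F W" "(x \<cdot> j) \<cdot> h \<in> Hom C ?F W"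
      using x n ijpq s h by auto
    then show ?thesis unfolding 1 using 2 Add_left_cancel by metis
  qed
  have me: "monic C m"
  proof (rule monicI[OF m])
    fix W x assume x: "x \<in> Hom C W ?F" "m \<cdot> x = Zero C W B"
    have "f \<cdot> x = p \<cdot> (m \<cdot> x)" using pm x m ijpq Comp_assoc_right[of x m p] by auto
    then have "f \<cdot> x = Zero C W ?E" using x ijpq Ar_Ob(1)[of x] by auto
    then show "x = Zero C W ?F" using monicD0[OF s(3), of x W ?E ?F] x s by auto
  qed
  obtain k where k: "short_exact C m k" using ex_short_exact_monic[OF me] .
  note K = short_exactD[OF k]
  define E' where "E' = Cod C k"
  have kH: "k \<in> Hom C B E'" using K m by (auto simp: E'_def)
  have ki: "k \<cdot> i \<in> Hom C ?E E'" and kj: "k \<cdot> j \<in> Hom C X E'" using kH ijpq by auto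
  have sq: "(k \<cdot> i) \<cdot> f = (k \<cdot> j) \<cdot> h" using meq[OF kH] K m kH by auto
  have univ: "\<exists>y\<in>Hom C E' W. y \<cdot> (k \<cdot> i) = a \<and> y \<cdot> (k \<cdot> j) = b"
    if a: "a \<in> Hom C ?E W" and b: "b \<in> Hom C X W" and eq: "a \<cdot> f = b \<cdot> h" for W a b
  proof -
    obtain x where x: "x \<in> Hom C B W" "x \<cdot> i = a" "x \<cdot> j = b"
      using biproduct_copair[OF bp a b] .
    then have "x \<cdot> m = Zero C ?F W" using meq eq by auto
    then obtain y where y: "y \<in> Hom C E' W" "y \<cdot> k = x"
      using short_exact_desc[OF k, of x W] x m kH by (auto simp: E'_def)
    have "y \<in> Hom C E' W" "y \<cdot> (k \<cdot> i) = a" "y \<cdot> (k \<cdot> j) = b"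
      using x y kH ijpq Comp_assoc_right[of i k y] Comp_assoc_right[of j k y] by simp_all
    then show ?thesis by blast
  qed
  have epi: "y = y'" if "y \<in> Hom C E' W" "y' \<in> Hom C E' W" "y \<cdot> (k \<cdot> i) = y' \<cdot> (k \<cdot> i)"
    "y \<cdot> (k \<cdot> j) = y' \<cdot> (k \<cdot> j)" for W y y'
  proof -
    have "y \<cdot> k = y' \<cdot> k"
      by (rule biproduct_arrow_eqI[OF bp, of _ W]) (use that kH ijpq in auto)
    then show ?thesis using epicD[OF K(4) _ kH] that by blast
  qed
  have "\<exists>y\<in>Hom C E' ?Y. y \<cdot> (k \<cdot> i) = g \<and> y \<cdot> (k \<cdot> j) = Zero C X ?Y"
    by (rule univ) (use s h Ob in auto)
  then obtain g' where g': "g' \<in> Hom C E' ?Y" "g' \<cdot> (k \<cdot> i) = g" "g' \<cdot> (k \<cdot> j) = Zero C X ?Y"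
    by blast
  have ses: "short_exact C (k \<cdot> j) g'"
  proof (rule short_exactI')
    show "monic C (k \<cdot> j)"
    proof (rule monicI[OF kj])
      fix W t assume t: "t \<in> Hom C W X" "(k \<cdot> j) \<cdot> t = Zero C W E'"
      have WO: "W \<in> Ob C" using t Ar_Ob by auto
      have "k \<cdot> (j \<cdot> t) = Zero C W E'" using t kH ijpq by auto
      then obtain u where u: "u \<in> Hom C W ?F" "m \<cdot> u = j \<cdot> t"
        using short_exact_lift[OF k, of "j \<cdot> t" W] t ijpq m kH by (auto simp: E'_def)
      have "f \<cdot> u = p \<cdot> (j \<cdot> t)" using u pm ijpq m Comp_assoc_right[of u m p] by auto
      also have "\<dots> = Zero C W ?E" using t ijpq Ob Comp_assoc_right[of t j p] by auto
      finally have "u = Zero C W ?F" using monicD0[OF s(3), of u W ?E ?F] u s by auto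
      then have "j \<cdot> t = Zero C W B" using u m WO by auto
      then have "q \<cdot> (j \<cdot> t) = Zero C W X" using ijpq WO by auto
      then show "t = Zero C W X" using t ijpq Comp_assoc_right[of t j q] by auto
    qed
    show "is_cokernel C g' (k \<cdot> j)"
    proof (rule is_cokernelI[OF g'(1) kj g'(3)])
      show "epic C g'"
        by (rule epic_Comp_cancel[of g' "k \<cdot> i"]) (use g' s ki in auto)
      fix W x assume x: "x \<in> Hom C E' W" "x \<cdot> (k \<cdot> j) = Zero C X W"
      have WO: "W \<in> Ob C" using x Ar_Ob by auto
      have "(x \<cdot> (k \<cdot> i)) \<cdot> f = x \<cdot> ((k \<cdot> i) \<cdot> f)" using x ki s kH ijpq by auto
      also have "\<dots> = (x \<cdot> (k \<cdot> j)) \<cdot> h" unfolding sq using x(1) kj h kH ijpq by auto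
      also have "\<dots> = Zero C ?F W" unfolding x(2) using h WO by auto
      finally obtain y where y: "y \<in> Hom C ?Y W" "y \<cdot> g = x \<cdot> (k \<cdot> i)"
        using short_exact_desc[OF fg, of "x \<cdot> (k \<cdot> i)" W] x ki kH ijpq by auto
      have "y \<cdot> g' = x"
      proof (rule epi)
        show "(y \<cdot> g') \<cdot> (k \<cdot> i) = x \<cdot> (k \<cdot> i)"
          using y g' ki Comp_assoc_right[of "k \<cdot> i" g' y] by (metis Hom_iff)
        have "(y \<cdot> g') \<cdot> (k \<cdot> j) = y \<cdot> Zero C X ?Y"
          using y g' kj Comp_assoc_right[of "k \<cdot> j" g' y] by (metis Hom_iff)
        then show "(y \<cdot> g') \<cdot> (k \<cdot> j) = x \<cdot> (k \<cdot> j)" using x y Ob by auto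
      qed (use y g' x in auto)
      then show "\<exists>y\<in>Hom C ?Y W. y \<cdot> g' = x" using y by blast
    qed
  qed
  show ?thesis
    by (rule that[OF ses kj g'(1) ki g'(2) sq univ epi])
qed

text \<open>This stands in for choosing a preimage of an element: a morphism into the target of
  \<open>g\<close> lifts along \<open>g\<close> after composition with an epimorphism, and vanishing
  can be tested after that composition.\<close>

lemma pullback_epic:
  assumes "epic C g" "h \<in> Hom C X (Cod C g)"
  obtains E' g' h' where "g' \<in> Hom C E' X" "h' \<in> Hom C E' (Dom C g)" "epic C g'" "g \<cdot> h' = h \<cdot> g'"
proof -
  obtain f where "short_exact C f g" using ex_short_exact_epic[OF assms(1)] .
  from pullback_short_exact[OF this assms(2)] show ?thesis using that short_exactD(4) by metis
qed

end

section \<open>Vanishing of Ext\<close>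

context abelian_category
begin

lemma Ext_zero_connected:
  assumes "Ext_zero C n X Y" "es \<in> extensions C n X Y" "fs \<in> extensions C n X Y"
  shows "(es, fs) \<in> (extension_maps C n X Y \<union> (extension_maps C n X Y)\<inverse>)\<^sup>*"
    (is "_ \<in> ?R")
proof -
  obtain c where c: "extensions C n X Y // ?R = {c}"
    using assms(1) unfolding Ext_zero_def Ext_def is_singleton_def by blast
  have "?R `` {es} \<in> extensions C n X Y // ?R" "?R `` {fs} \<in> extensions C n X Y // ?R"
    using assms(2,3) by (auto intro: quotientI)
  then have "?R `` {es} = ?R `` {fs}" using c by simp
  then show ?thesis by blast
qed

text \<open>\<open>es\<close> ensures that there is a class at all: an empty quotient would not be a
  singleton.\<close>

lemma Ext_zeroI:
  assumes "es \<in> extensions C n X Y"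
    and "\<And>fs gs. fs \<in> extensions C n X Y \<Longrightarrow> gs \<in> extensions C n X Y \<Longrightarrow> (fs, gs) \<in> extension_maps C n X Y"
  shows "Ext_zero C n X Y"
proof -
  let ?R = "(extension_maps C n X Y \<union> (extension_maps C n X Y)\<inverse>)\<^sup>*"
  have sub: "fs \<in> extensions C n X Y \<Longrightarrow> ?R `` {fs} \<subseteq> extensions C n X Y" for fs
  proof
    fix gs assume fs: "fs \<in> extensions C n X Y" and "gs \<in> ?R `` {fs}"
    then have "(fs, gs) \<in> ?R" by simp
    then show "gs \<in> extensions C n X Y"
      by (induction rule: rtrancl_induct) (use fs in \<open>auto simp: extension_maps_def\<close>)
  qed
  have "?R `` {fs} = extensions C n X Y" if "fs \<in> extensions C n X Y" for fs
  proof
    show "extensions C n X Y \<subseteq> ?R `` {fs}" using assms(2)[OF that] by blast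
  qed (rule sub[OF that])
  then have "extensions C n X Y // ?R = {extensions C n X Y}"
    using assms(1) unfolding quotient_def by auto
  then show ?thesis unfolding Ext_zero_def Ext_def is_singleton_def by blast
qed

text \<open>The complement of the idempotent \<open>s \<cdot> g\<close> is killed by
  \<open>g\<close> and so equals \<open>f \<cdot> r\<close>; the converse is dual. Both forms are
  used: sections travel along morphisms of extensions, retractions against them.\<close>

lemma section_iff_retraction:
  assumes "short_exact C f g"
  shows "(\<exists>s\<in>Hom C (Cod C g) (Dom C g). g \<cdot> s = Id C (Cod C g)) \<longleftrightarrow>
         (\<exists>r\<in>Hom C (Dom C g) (Dom C f). r \<cdot> f = Id C (Dom C f))"
proof
  note k = short_exactD[OF assms]
  assume "\<exists>s\<in>Hom C (Cod C g) (Dom C g). g \<cdot> s = Id C (Cod C g)"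
  then obtain s where s: "s \<in> Hom C (Cod C g) (Dom C g)" "g \<cdot> s = Id C (Cod C g)" by blast
  have sg: "s \<cdot> g \<in> Hom C (Dom C g) (Dom C g)" using s k by auto
  obtain d where d: "d \<in> Hom C (Dom C g) (Dom C g)" "Id C (Dom C g) = s \<cdot> g \<oplus> d"
    using ex_diff[OF _ sg, of "Id C (Dom C g)"] k by auto
  have gd: "g \<cdot> d = Zero C (Dom C g) (Cod C g)"
  proof (rule Add_eq_self)
    have "g = g \<cdot> (s \<cdot> g \<oplus> d)" unfolding d(2)[symmetric] using k by auto
    also have "\<dots> = g \<oplus> g \<cdot> d" using s d(1) k Comp_eq_right[OF s(2), of g] by auto
    finally show "g \<oplus> g \<cdot> d = g" by (rule sym)
  qed (use k d(1) in auto)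
  obtain r where r: "r \<in> Hom C (Dom C g) (Dom C f)" "f \<cdot> r = d"
    using short_exact_lift[OF assms d(1) gd] .
  have "f \<cdot> (r \<cdot> f) = f"
  proof -
    have "f = (s \<cdot> g \<oplus> d) \<cdot> f" unfolding d(2)[symmetric] using k by auto
    also have "\<dots> = d \<cdot> f" using s d(1) k by auto
    also have "\<dots> = f \<cdot> (r \<cdot> f)" unfolding r(2)[symmetric] using r(1) k by auto
    finally show ?thesis by (rule sym)
  qed
  then have "f \<cdot> (r \<cdot> f) = f \<cdot> Id C (Dom C f)" using k by simp
  then have "r \<cdot> f = Id C (Dom C f)"
    by (rule monicD[OF k(3), of _ _ "Dom C f" "Dom C g" "Dom C f"]) (use r(1) k in auto)
  with r(1) show "\<exists>r\<in>Hom C (Dom C g) (Dom C f). r \<cdot> f = Id C (Dom C f)" by blast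
next
  note k = short_exactD[OF assms]
  assume "\<exists>r\<in>Hom C (Dom C g) (Dom C f). r \<cdot> f = Id C (Dom C f)"
  then obtain r where r: "r \<in> Hom C (Dom C g) (Dom C f)" "r \<cdot> f = Id C (Dom C f)" by blast
  have fr: "f \<cdot> r \<in> Hom C (Dom C g) (Dom C g)" using r k by auto
  obtain d where d: "d \<in> Hom C (Dom C g) (Dom C g)" "Id C (Dom C g) = f \<cdot> r \<oplus> d"
    using ex_diff[OF _ fr, of "Id C (Dom C g)"] k by auto
  have df: "d \<cdot> f = Zero C (Dom C f) (Dom C g)"
  proof (rule Add_eq_self)
    have "f = (f \<cdot> r \<oplus> d) \<cdot> f" unfolding d(2)[symmetric] using k by auto
    also have "\<dots> = f \<oplus> d \<cdot> f" using r d(1) k by auto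
    finally show "f \<oplus> d \<cdot> f = f" by (rule sym)
  qed (use k d(1) in auto)
  obtain s where s: "s \<in> Hom C (Cod C g) (Dom C g)" "s \<cdot> g = d"
    using short_exact_desc[OF assms d(1) df] .
  have "(g \<cdot> s) \<cdot> g = g"
  proof -
    have "g = g \<cdot> (f \<cdot> r \<oplus> d)" unfolding d(2)[symmetric] using k by auto
    also have "\<dots> = g \<cdot> d" using r d(1) k Comp_eq_right[OF k(8), of r] by auto
    also have "\<dots> = (g \<cdot> s) \<cdot> g" unfolding s(2)[symmetric] using s(1) k by auto
    finally show ?thesis by (rule sym)
  qed
  then have "(g \<cdot> s) \<cdot> g = Id C (Cod C g) \<cdot> g" using k by simp
  then have "g \<cdot> s = Id C (Cod C g)"
    by (rule epicD[OF k(4), of _ _ "Dom C g" "Cod C g" "Cod C g"]) (use s(1) k in auto)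
  with s(1) show "\<exists>s\<in>Hom C (Cod C g) (Dom C g). g \<cdot> s = Id C (Cod C g)" by blast
qed

section \<open>Extensions of length one and splitting\<close>

lemma extensions_1_iff:
  "es \<in> extensions C 1 X F \<longleftrightarrow>
   (\<exists>f g. es = [f, g] \<and> short_exact C f g \<and> Dom C f = F \<and> Cod C g = X)" (is "?l \<longleftrightarrow> ?r")
proof
  assume ?l
  then show ?r
    by (cases es; cases "tl es") (auto simp: extensions_def short_exact_def)
next
  assume ?r
  then obtain f g where "es = [f, g]" "short_exact C f g" "Dom C f = F" "Cod C g = X" by blast
  then show ?l using short_exactD(5,6)[of f g] by (auto simp: extensions_def short_exact_def)
qed

lemma extension_maps_1D:
  assumes "([f, g], [f', g']) \<in> extension_maps C 1 X F"
  obtains \<phi> where "\<phi> \<in> Hom C (Dom C g) (Dom C g')" "\<phi> \<cdot> f = f'" "g' \<cdot> \<phi> = g"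
    "short_exact C f g" "short_exact C f' g'" "Dom C f = F" "Dom C f' = F" "Cod C g = X" "Cod C g' = X"
proof -
  have ses: "short_exact C f g" "short_exact C f' g'" "Dom C f = F" "Dom C f' = F" "Cod C g = X" "Cod C g' = X"
    using assms extensions_1_iff[of "[f, g]"] extensions_1_iff[of "[f', g']"]
    by (auto simp: extension_maps_def)
  obtain \<phi> where \<phi>: "\<phi> 0 = Id C F" "\<phi> 2 = Id C X"
    "\<And>i. i \<le> 1 \<Longrightarrow> \<phi> i \<in> Hom C (Dom C ([f, g] ! i)) (Dom C ([f', g'] ! i)) \<and>
      \<phi> (i + 1) \<cdot> [f, g] ! i = [f', g'] ! i \<cdot> \<phi> i"
    using assms unfolding extension_maps_def by (auto simp: numeral_2_eq_2)
  have "\<phi> 1 \<in> Hom C (Dom C g) (Dom C g')" using \<phi>(3)[of 1] by simp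
  moreover have "\<phi> 1 \<cdot> f = f'"
    using \<phi>(1) \<phi>(3)[of 0] ses(4) short_exactD(5)[OF ses(2)] by simp
  moreover have "g' \<cdot> \<phi> 1 = g"
    using \<phi>(2) \<phi>(3)[of 1] ses(5) short_exactD(6)[OF ses(1)] by (simp add: numeral_2_eq_2)
  ultimately have "\<phi> 1 \<in> Hom C (Dom C g) (Dom C g')" "\<phi> 1 \<cdot> f = f'" "g' \<cdot> \<phi> 1 = g" .
  then show ?thesis using that ses by blast
qed

text \<open>Splitting is invariant under the morphisms that generate the equivalence, and the
  biproduct gives one split extension. Conversely, a retraction \<open>r\<close> of one extension
  and a section \<open>t\<close> of another combine to the morphism
  \<open>f' \<cdot> r \<oplus> t \<cdot> g\<close> between them, so a single step joins any
  two.\<close>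

lemma Ext_zero_1_iff:
  assumes "X \<in> Ob C" "F \<in> Ob C"
  shows "Ext_zero C 1 X F \<longleftrightarrow>
    (\<forall>f g. short_exact C f g \<and> Dom C f = F \<and> Cod C g = X \<longrightarrow> (\<exists>s\<in>Hom C X (Dom C g). g \<cdot> s = Id C X))"
proof -
  obtain B where B: "is_biproduct C F X B" using ex_biproduct assms by blast
  obtain i j p q where bp: "biproduct_maps F X B i j p q" using is_biproductE[OF B] .
  note ijpq = biproduct_mapsD[OF bp]
  have iq: "short_exact C i q" using biproduct_short_exact[OF bp] .
  then have iqx: "[i, q] \<in> extensions C 1 X F" using ijpq extensions_1_iff by auto
  define split where "split es \<longleftrightarrow> (\<exists>s\<in>Hom C X (Dom C (es ! 1)). es ! 1 \<cdot> s = Id C X)" for es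
  have step: "split es \<longleftrightarrow> split fs" if m: "(es, fs) \<in> extension_maps C 1 X F" for es fs
  proof -
    obtain f g f' g' where e: "es = [f, g]" "fs = [f', g']"
      using m extensions_1_iff[of es X F] extensions_1_iff[of fs X F]
      by (auto simp: extension_maps_def)
    obtain \<phi> where \<phi>: "\<phi> \<in> Hom C (Dom C g) (Dom C g')" "\<phi> \<cdot> f = f'" "g' \<cdot> \<phi> = g"
    and s: "short_exact C f g" "short_exact C f' g'" "Dom C f = F" "Dom C f' = F" "Cod C g = X" "Cod C g' = X"
      using extension_maps_1D m unfolding e by metis
    note k = short_exactD[OF s(1)] short_exactD[OF s(2)]
    show ?thesis
    proof
      assume "split es"
      then obtain t where t: "t \<in> Hom C X (Dom C g)" "g \<cdot> t = Id C X" by (auto simp: split_def e)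
      then have "\<phi> \<cdot> t \<in> Hom C X (Dom C g')" "g' \<cdot> (\<phi> \<cdot> t) = Id C X"
        using \<phi> k Comp_eq_right[OF \<phi>(3), of t] by auto
      then show "split fs" unfolding split_def e by auto
    next
      assume "split fs"
      then have "\<exists>r\<in>Hom C (Dom C g') (Dom C f'). r \<cdot> f' = Id C (Dom C f')"
        using section_iff_retraction[OF s(2)] s unfolding split_def e by auto
      then obtain r where r: "r \<in> Hom C (Dom C g') (Dom C f')" "r \<cdot> f' = Id C (Dom C f')" by blast
      have "r \<cdot> \<phi> \<in> Hom C (Dom C g) (Dom C f)" "(r \<cdot> \<phi>) \<cdot> f = Id C (Dom C f)"
        using r \<phi> k s by auto
      then show "split es"
        using section_iff_retraction[OF s(1)] s unfolding split_def e by auto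
    qed
  qed
  show ?thesis (is "_ \<longleftrightarrow> ?S")
  proof
    assume E: "Ext_zero C 1 X F"
    show ?S
    proof (intro allI impI)
      fix f g assume fg: "short_exact C f g \<and> Dom C f = F \<and> Cod C g = X"
      then have "[f, g] \<in> extensions C 1 X F" using extensions_1_iff by auto
      from Ext_zero_connected[OF E iqx this] have "split [i, q] \<longrightarrow> split [f, g]"
        by (induction rule: rtrancl_induct) (use step in auto)
      moreover have "split [i, q]" using ijpq unfolding split_def by auto
      ultimately show "\<exists>s\<in>Hom C X (Dom C g). g \<cdot> s = Id C X" unfolding split_def by simp
    qed
  next
    assume S: ?S
    show "Ext_zero C 1 X F"
    proof (rule Ext_zeroI[OF iqx])
      fix es fs assume m: "es \<in> extensions C 1 X F" "fs \<in> extensions C 1 X F"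
      then obtain f g f' g' where e: "es = [f, g]" "fs = [f', g']" and s: "short_exact C f g"
        "short_exact C f' g'" "Dom C f = F" "Dom C f' = F" "Cod C g = X" "Cod C g' = X"
        using extensions_1_iff by auto
      note k = short_exactD[OF s(1)] short_exactD[OF s(2)]
      obtain r where r: "r \<in> Hom C (Dom C g) F" "r \<cdot> f = Id C F"
        using S section_iff_retraction[OF s(1)] s by auto
      obtain t where t: "t \<in> Hom C X (Dom C g')" "g' \<cdot> t = Id C X" using S s by blast
      define \<phi> where "\<phi> = f' \<cdot> r \<oplus> t \<cdot> g"
      have \<phi>: "\<phi> \<in> Hom C (Dom C g) (Dom C g')" using r t s k by (auto simp: \<phi>_def)
      have 1: "\<phi> \<cdot> f = f'" using r t s k assms by (auto simp: \<phi>_def)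
      have 2: "g' \<cdot> \<phi> = g" using r t s k assms Comp_eq_right[OF t(2), of g] Comp_eq_right[OF k(16), of r]
        by (auto simp: \<phi>_def)
      show "(es, fs) \<in> extension_maps C 1 X F"
        unfolding extension_maps_def
      proof (intro CollectI case_prodI conjI m exI[of _ "\<lambda>i. if i = 0 then Id C F else if i = 1 then \<phi> else Id C X"])
        show "\<forall>i\<le>1. (if i = 0 then Id C F else if i = 1 then \<phi> else Id C X) \<in> Hom C (Dom C (es ! i)) (Dom C (fs ! i)) \<and>
          (if i + 1 = 0 then Id C F else if i + 1 = 1 then \<phi> else Id C X) \<cdot> es ! i =
          fs ! i \<cdot> (if i = 0 then Id C F else if i = 1 then \<phi> else Id C X)"
          using s k \<phi> 1 2 assms by (auto simp: e le_Suc_eq)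
      qed auto
    qed
  qed
qed

lemma Ext_zero_section:
  assumes "Ext_zero C 1 X F" "short_exact C f g" "Dom C f = F" "Cod C g = X"
  shows "\<exists>s\<in>Hom C X (Dom C g). g \<cdot> s = Id C X"
proof -
  have "X \<in> Ob C" "F \<in> Ob C" using assms Ar_Ob short_exactD(5,6)[OF assms(2)] by auto
  then show ?thesis using assms Ext_zero_1_iff by blast
qed

text \<open>A section of the extension pulled back along \<open>h\<close>, followed by the morphism
  to the original extension, is the lift.\<close>

lemma Ext_zero_lift:
  assumes "Ext_zero C 1 X F" "short_exact C f g" "Dom C f = F" "h \<in> Hom C X (Cod C g)"
  obtains y where "y \<in> Hom C X (Dom C g)" "g \<cdot> y = h"
proof -
  have Ob: "X \<in> Ob C" "F \<in> Ob C" using assms Ar_Ob short_exactD(5)[OF assms(2)] by auto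
  obtain E' f' g' h' where s: "short_exact C f' g'" "f' \<in> Hom C (Dom C f) E'" "g' \<in> Hom C E' X"
    "h' \<in> Hom C E' (Dom C g)" "g \<cdot> h' = h \<cdot> g'"
    using pullback_short_exact[OF assms(2,4)] by metis
  obtain t where t: "t \<in> Hom C X E'" "g' \<cdot> t = Id C X"
    using Ext_zero_section[OF assms(1) s(1)] assms(3) s by auto
  have "h' \<cdot> t \<in> Hom C X (Dom C g)" "g \<cdot> (h' \<cdot> t) = h"
    using t s assms(4) Comp_eq_right[OF s(5), of t] short_exactD(6)[OF assms(2)] by auto
  then show ?thesis using that by blast
qed

text \<open>Push out along \<open>h\<close> instead: a retraction of the resulting extension yields
  the extended morphism.\<close>

lemma Ext_zero_extend:
  assumes "Ext_zero C 1 X F" "short_exact C f g" "Cod C g = X" "h \<in> Hom C (Dom C f) F"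
  obtains y where "y \<in> Hom C (Dom C g) F" "y \<cdot> f = h"
proof -
  have Ob: "X \<in> Ob C" "F \<in> Ob C" using assms Ar_Ob short_exactD(6)[OF assms(2)] by auto
  obtain E' f' g' h' where s: "short_exact C f' g'" "f' \<in> Hom C F E'" "g' \<in> Hom C E' (Cod C g)"
    "h' \<in> Hom C (Dom C g) E'" "h' \<cdot> f = f' \<cdot> h"
    using pushout_short_exact[OF assms(2,4)] by metis
  have "\<exists>t\<in>Hom C (Cod C g') (Dom C g'). g' \<cdot> t = Id C (Cod C g')"
    using Ext_zero_section[OF assms(1) s(1)] assms(3) s by auto
  then obtain r where r: "r \<in> Hom C E' F" "r \<cdot> f' = Id C F"
    using section_iff_retraction[OF s(1)] s by auto
  have "(r \<cdot> h') \<cdot> f = r \<cdot> (f' \<cdot> h)" using s r short_exactD(5,7)[OF assms(2)] by auto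
  also have "\<dots> = h" using s r assms(4) Comp_eq_right[OF r(2), of h] by auto
  finally show ?thesis using that[of "r \<cdot> h'"] r s by auto
qed

text \<open>
  Exactness of \<open>Ext\<^sup>1(X, E) \<rightarrow> Ext\<^sup>1(X, Q) \<rightarrow> Ext\<^sup>2(X, K)\<close>: the extension \<open>(g, h)\<close> of \<open>X\<close> by \<open>Q\<close> becomes
  trivial in \<open>Ext\<^sup>2\<close> only if it is the pushout of an extension \<open>(u, h \<cdot> v)\<close> of \<open>X\<close> by \<open>E\<close>. The
  first description is preserved along morphisms of extensions, the second one against them.
\<close>

definition pushout_form :: "'b list \<Rightarrow> bool" where
  "pushout_form es \<longleftrightarrow> (\<exists>M. \<exists>u\<in>Hom C (Dom C (es ! 1)) M. \<exists>v\<in>Hom C M (Dom C (es ! 2)).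
     v \<cdot> u = es ! 1 \<and> short_exact C u (es ! 2 \<cdot> v))"

definition pullback_form :: "'b list \<Rightarrow> bool" where
  "pullback_form es \<longleftrightarrow> (\<exists>M. \<exists>u\<in>Hom C (Dom C (es ! 1)) M. \<exists>v\<in>Hom C M (Dom C (es ! 2)).
     v \<cdot> u = es ! 1 \<and> short_exact C (u \<cdot> es ! 0) v)"

section \<open>Comparison of the two forms of an extension of length two\<close>

lemma extensions_2D:
  assumes "es \<in> extensions C 2 X K"
  obtains f g h where "es = [f, g, h]" "f \<in> Hom C K (Dom C g)" "g \<in> Hom C (Dom C g) (Dom C h)"
    "h \<in> Hom C (Dom C h) X" "is_kernel C f g" "epic C h" "exact C g h"
proof -
  obtain f g h where es: "es = [f, g, h]"
    using assms by (cases es; cases "tl es"; cases "tl (tl es)") (auto simp: extensions_def)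
  have ex: "\<And>i. i < 2 \<Longrightarrow> exact C (es ! i) (es ! (i + 1))" using assms by (simp add: extensions_def)
  have a: "f \<in> Ar C" "g \<in> Ar C" "h \<in> Ar C" "Dom C f = K" "Cod C h = X" "monic C f" "epic C h"
    "exact C f g" "exact C g h"
    using assms ex[of 0] ex[of 1] by (auto simp: extensions_def es numeral_2_eq_2)
  have k: "is_kernel C f g" using exact_monic_is_kernel a by blast
  have "Cod C g = Dom C h"
  proof -
    obtain k e where "is_kernel C k h" "epic C e" "Cod C e = Dom C k" "g = k \<cdot> e"
      using a(9) unfolding exact_def by blast
    then show ?thesis using is_kernelD(1,3)[of k h] by (auto simp: epic_def)
  qed
  then show ?thesis using that[OF es] a k is_kernelD(3)[OF k] by auto
qed

text \<open>The same \<open>M\<close> serves both forms: it contains \<open>Dom C g\<close> with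
  quotient \<open>X\<close>, and \<open>K\<close> with quotient \<open>Dom C h\<close>. Exactness of
  either sequence forces exactness of the other by a diagram chase.\<close>

lemma pushout_form_iff_pullback_form:
  assumes "es \<in> extensions C 2 X K"
  shows "pushout_form es \<longleftrightarrow> pullback_form es"
proof -
  obtain f g h where es: "es = [f, g, h]" and H: "f \<in> Hom C K (Dom C g)" "g \<in> Hom C (Dom C g) (Dom C h)"
    "h \<in> Hom C (Dom C h) X" and fg: "is_kernel C f g" and h: "epic C h" and "exact C g h"
    using extensions_2D[OF assms] .
  then obtain k e where k: "is_kernel C k h" and e: "epic C e" "Cod C e = Dom C k" and gke: "g = k \<cdot> e"
    unfolding exact_def by blast
  note kD = is_kernelD[OF k] and fD = is_kernelD[OF fg]
  have eA: "e \<in> Ar C" using e by (simp add: epic_def)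
  have Ob: "K \<in> Ob C" "Dom C g \<in> Ob C" "Dom C h \<in> Ob C" "X \<in> Ob C" using H Ar_Ob by auto
  have eH: "e \<in> Hom C (Dom C g) (Dom C k)" using eA e gke kD by auto
  have "h \<cdot> g = Zero C (Dom C k) (Cod C h) \<cdot> e"
    unfolding gke using Comp_eq_right[OF kD(4), of e] kD(1-3) e eA by simp
  then have hg: "h \<cdot> g = Zero C (Dom C g) X" using eH H Ob by simp
  show ?thesis
  proof
    assume "pushout_form es"
    then obtain M u v where u: "u \<in> Hom C (Dom C g) M" and v: "v \<in> Hom C M (Dom C h)"
      and vu: "v \<cdot> u = g" and s: "short_exact C u (h \<cdot> v)"
      unfolding pushout_form_def es by (simp del: Hom_iff) blast
    note sD = short_exactD[OF s]
    have "short_exact C (u \<cdot> f) v"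
    proof (rule short_exactI)
      show "is_kernel C (u \<cdot> f) v"
      proof (rule is_kernelI)
        show "monic C (u \<cdot> f)" using monic_Comp[OF fD(5) sD(3)] H u by auto
        show "v \<cdot> (u \<cdot> f) = Zero C K (Dom C h)"
          using Comp_eq_right[OF vu, of f] fD H u v by auto
        fix W x assume x: "x \<in> Hom C W M" "v \<cdot> x = Zero C W (Dom C h)"
        have WO: "W \<in> Ob C" using x Ar_Ob by auto
        have "(h \<cdot> v) \<cdot> x = Zero C W X" using x H v WO by auto
        then obtain y where y: "y \<in> Hom C W (Dom C g)" "u \<cdot> y = x"
          using short_exact_lift[OF s, of x W] x u v H by auto
        have "g \<cdot> y = Zero C W (Dom C h)"
          using Comp_eq_right[OF vu, of y] y x u v by auto
        then obtain z where z: "z \<in> Hom C W K" "f \<cdot> z = y"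
          using is_kernel_lift[OF fg, of K "Dom C g" "Dom C h" y W] H y by auto
        have "(u \<cdot> f) \<cdot> z = x" using z y u H by auto
        then show "\<exists>z\<in>Hom C W K. (u \<cdot> f) \<cdot> z = x" using z by blast
      qed (use u v H in auto)
      show "epic C v"
      proof (rule epicI[OF v])
        fix W t assume t: "t \<in> Hom C (Dom C h) W" "t \<cdot> v = Zero C M W"
        have WO: "W \<in> Ob C" using t Ar_Ob by auto
        have "(t \<cdot> k) \<cdot> e = t \<cdot> (v \<cdot> u)" unfolding vu gke using t kD eH H by auto
        also have "\<dots> = Zero C (Dom C g) W" using Comp_eq_right[OF t(2), of u] u v t WO by auto
        finally have "t \<cdot> k = Zero C (Dom C k) W"
          by (intro epicD0[OF e(1) _ eH]) (use t kD H in auto)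
        then obtain t' where t': "t' \<in> Hom C X W" "t' \<cdot> h = t"
          using is_cokernel_desc[OF epic_is_cokernel_of_kernel[OF h k], of "Dom C h" X "Dom C k" t W] t H kD by auto
        have "t' \<cdot> (h \<cdot> v) = Zero C M W" using t Comp_eq_right[OF t'(2), of v] t' H v by auto
        then have "t' = Zero C X W"
          by (intro epicD0[OF sD(4), of t' M W X]) (use t' v H in auto)
        then show "t = Zero C (Dom C h) W" using t'(2)[symmetric] H WO by auto
      qed
    qed
    then show "pullback_form es"
      using u v vu unfolding pullback_form_def es by (simp del: Hom_iff) blast
  next
    assume "pullback_form es"
    then obtain M u v where u: "u \<in> Hom C (Dom C g) M" and v: "v \<in> Hom C M (Dom C h)"
      and vu: "v \<cdot> u = g" and s: "short_exact C (u \<cdot> f) v"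
      unfolding pullback_form_def es by (simp del: Hom_iff) blast
    note sD = short_exactD[OF s]
    have um: "monic C u"
    proof (rule monicI[OF u])
      fix W x assume x: "x \<in> Hom C W (Dom C g)" "u \<cdot> x = Zero C W M"
      have WO: "W \<in> Ob C" using x Ar_Ob by auto
      have "g \<cdot> x = Zero C W (Dom C h)"
        using Comp_eq_right[OF vu, of x] x u v WO by auto
      then obtain z where z: "z \<in> Hom C W K" "f \<cdot> z = x"
        using is_kernel_lift[OF fg, of K "Dom C g" "Dom C h" x W] H x by auto
      have "(u \<cdot> f) \<cdot> z = Zero C W M" using z x u H by auto
      then have "z = Zero C W K"
        by (intro monicD0[OF sD(3), of z W M K]) (use z u H in auto)
      then show "x = Zero C W (Dom C g)" using z(2)[symmetric] H WO by auto
    qed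
    \<comment> \<open>Factoring through \<open>u\<close> is rephrased as vanishing of the composite
      with the cokernel \<open>c\<close>, since vanishing can be tested after an
      epimorphism.\<close>
    obtain c where c: "short_exact C u c" using ex_short_exact_monic[OF um] .
    note cD = short_exactD[OF c]
    have "short_exact C u (h \<cdot> v)"
    proof (rule short_exactI)
      show "epic C (h \<cdot> v)" using epic_Comp[OF sD(4) h v] H by auto
      show "is_kernel C u (h \<cdot> v)"
      proof (rule is_kernelI)
        show "monic C u" by (rule um)
        show "(h \<cdot> v) \<cdot> u = Zero C (Dom C g) X" using vu hg u v H by auto
        fix W x assume x: "x \<in> Hom C W M" "(h \<cdot> v) \<cdot> x = Zero C W X"
        have WO: "W \<in> Ob C" using x Ar_Ob by auto
        have "h \<cdot> (v \<cdot> x) = Zero C W X" using x H v by auto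
        then obtain z where z: "z \<in> Hom C W (Dom C k)" "k \<cdot> z = v \<cdot> x"
          using is_kernel_lift[OF k, of "Dom C k" "Dom C h" X "v \<cdot> x" W] kD H x v by auto
        \<comment> \<open>\<open>z\<close> need not lift along \<open>e\<close>, but it does after
          pulling back, as \<open>y\<close>. Then \<open>x \<cdot> e'\<close> and
          \<open>u \<cdot> y\<close> agree under \<open>v\<close>, so their difference comes from
          \<open>K\<close>, and \<open>x \<cdot> e'\<close> factors through
          \<open>u\<close>.\<close>
        obtain W' e' y where e': "e' \<in> Hom C W' W" "y \<in> Hom C W' (Dom C g)" "epic C e'" "e \<cdot> y = z \<cdot> e'"
          using pullback_epic[OF e(1), of z W] z eH by auto
        have "v \<cdot> (x \<cdot> e') = k \<cdot> (z \<cdot> e')"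
          using Comp_eq_right[OF z(2), of e'] z x e' v kD by auto
        also have "\<dots> = (k \<cdot> e) \<cdot> y"
          unfolding e'(4)[symmetric] using e'(1,2) eH kD(1) by simp
        also have "\<dots> = v \<cdot> (u \<cdot> y)"
          unfolding gke[symmetric] vu[symmetric] using e'(1,2) u v by simp
        finally have eq: "v \<cdot> (x \<cdot> e') = v \<cdot> (u \<cdot> y)" .
        obtain d where d: "d \<in> Hom C W' M" "x \<cdot> e' = u \<cdot> y \<oplus> d"
          using ex_diff[of "x \<cdot> e'" W' M "u \<cdot> y"] x e' u by auto
        have "v \<cdot> d = Zero C W' (Dom C h)"
        proof (rule Add_eq_self)
          show "v \<cdot> (u \<cdot> y) \<oplus> v \<cdot> d = v \<cdot> (u \<cdot> y)"
            using eq unfolding d(2) using d(1) u v e'(1,2) by simp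
        qed (use d(1) u v e' in auto)
        then obtain b where b: "b \<in> Hom C W' K" "(u \<cdot> f) \<cdot> b = d"
          using short_exact_lift[OF s, of d W'] d u v H by auto
        have xe: "x \<cdot> e' = u \<cdot> (y \<oplus> f \<cdot> b)"
          unfolding d(2) b(2)[symmetric] using b(1) u e' H by auto
        have "(c \<cdot> x) \<cdot> e' = c \<cdot> (x \<cdot> e')" using x e' cD u by auto
        also have "\<dots> = Zero C W' (Cod C c)"
          unfolding xe using Comp_eq_right[OF cD(8), of "y \<oplus> f \<cdot> b"] b e' u cD H by auto
        finally have "c \<cdot> x = Zero C W (Cod C c)"
          by (intro epicD0[OF e'(3) _ e'(1)]) (use x cD u in auto)
        then obtain w where "w \<in> Hom C W (Dom C g)" "u \<cdot> w = x"
          using short_exact_lift[OF c, of x W] x cD u by auto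
        then show "\<exists>w\<in>Hom C W (Dom C g). u \<cdot> w = x" by blast
      qed (use u v H in auto)
    qed
    then show "pushout_form es"
      using u v vu unfolding pushout_form_def es by (simp del: Hom_iff) blast
  qed
qed

lemma extension_maps_2D:
  assumes "([f, g, h], [f', g', h']) \<in> extension_maps C 2 X K"
  obtains \<phi> \<psi> where "\<phi> \<in> Hom C (Dom C g) (Dom C g')" "\<psi> \<in> Hom C (Dom C h) (Dom C h')"
    "\<phi> \<cdot> f = f'" "\<psi> \<cdot> g = g' \<cdot> \<phi>" "h' \<cdot> \<psi> = h"
proof -
  have x: "[f, g, h] \<in> extensions C 2 X K" "[f', g', h'] \<in> extensions C 2 X K"
    using assms by (auto simp: extension_maps_def)
  obtain \<phi> where \<phi>: "\<phi> 0 = Id C K" "\<phi> 3 = Id C X"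
    "\<And>i. i \<le> 2 \<Longrightarrow> \<phi> i \<in> Hom C (Dom C ([f, g, h] ! i)) (Dom C ([f', g', h'] ! i)) \<and>
      \<phi> (i + 1) \<cdot> [f, g, h] ! i = [f', g', h'] ! i \<cdot> \<phi> i"
    using assms unfolding extension_maps_def by (auto simp: numeral_3_eq_3 numeral_2_eq_2)
  have *: "f' \<in> Ar C" "Dom C f' = K" "h \<in> Ar C" "Cod C h = X"
    using x by (auto simp: extensions_def numeral_2_eq_2)
  have "\<phi> 1 \<in> Hom C (Dom C g) (Dom C g')" "\<phi> 2 \<in> Hom C (Dom C h) (Dom C h')"
    "\<phi> 1 \<cdot> f = f'" "\<phi> 2 \<cdot> g = g' \<cdot> \<phi> 1" "h' \<cdot> \<phi> 2 = h"
    using \<phi>(1,2) \<phi>(3)[of 0] \<phi>(3)[of 1] \<phi>(3)[of 2] *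
    by (auto simp: numeral_2_eq_2 numeral_3_eq_3)
  then show ?thesis by (rule that)
qed

text \<open>\<open>M\<close> is pushed out along \<open>\<phi>\<close>. The new \<open>v'\<close> is
  glued from \<open>\<psi> \<cdot> v\<close> and \<open>g'\<close>, and the uniqueness part of the
  pushout property identifies \<open>h' \<cdot> v'\<close> with the cokernel map
  \<open>w\<close>.\<close>

lemma pushout_form_forward:
  assumes m: "(es, fs) \<in> extension_maps C 2 X K" and "pushout_form es"
  shows "pushout_form fs"
proof -
  have x: "es \<in> extensions C 2 X K" "fs \<in> extensions C 2 X K"
    using m by (auto simp: extension_maps_def)
  obtain f g h where es: "es = [f, g, h]" and H: "f \<in> Hom C K (Dom C g)" "g \<in> Hom C (Dom C g) (Dom C h)"
    "h \<in> Hom C (Dom C h) X" using extensions_2D[OF x(1)] by metis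
  obtain f' g' h' where fs: "fs = [f', g', h']" and H': "f' \<in> Hom C K (Dom C g')"
    "g' \<in> Hom C (Dom C g') (Dom C h')" "h' \<in> Hom C (Dom C h') X" "exact C g' h'"
    using extensions_2D[OF x(2)] by metis
  have h'g': "h' \<cdot> g' = Zero C (Dom C g') X"
  proof -
    obtain k e where k: "is_kernel C k h'" "epic C e" "Cod C e = Dom C k" "g' = k \<cdot> e"
      using H'(4) unfolding exact_def by blast
    note kD = is_kernelD[OF k(1)]
    have e: "e \<in> Ar C" using k(2) by (simp add: epic_def)
    have "h' \<cdot> g' = Zero C (Dom C k) (Cod C h') \<cdot> e"
      unfolding k(4) using Comp_eq_right[OF kD(4), of e] kD(1-3) e k(3) by simp
    also have "\<dots> = Zero C (Dom C e) X" using e k(3) H' Ar_Ob(2)[of h'] by simp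
    also have "Dom C e = Dom C g'" unfolding k(4) using e k(3) kD by simp
    finally show ?thesis .
  qed
  obtain \<phi> \<psi> where \<phi>: "\<phi> \<in> Hom C (Dom C g) (Dom C g')" "\<psi> \<in> Hom C (Dom C h) (Dom C h')"
    "\<phi> \<cdot> f = f'" "\<psi> \<cdot> g = g' \<cdot> \<phi>" "h' \<cdot> \<psi> = h"
    using extension_maps_2D m unfolding es fs by metis
  obtain M u v where u: "u \<in> Hom C (Dom C g) M" and v: "v \<in> Hom C M (Dom C h)"
    and vu: "v \<cdot> u = g" and s: "short_exact C u (h \<cdot> v)"
    using assms(2) unfolding pushout_form_def es by (simp del: Hom_iff) blast
  have \<phi>u: "\<phi> \<in> Hom C (Dom C u) (Dom C g')" using u \<phi> by auto
  have U: "Dom C (h \<cdot> v) = M" "Cod C (h \<cdot> v) = X" using v H by auto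
  show ?thesis
  proof (rule pushout_short_exact[OF s \<phi>u, unfolded U])
    fix M' u' w \<chi>
    assume s': "short_exact C u' w" "u' \<in> Hom C (Dom C g') M'" "w \<in> Hom C M' X" "\<chi> \<in> Hom C M M'"
        "w \<cdot> \<chi> = h \<cdot> v" "\<chi> \<cdot> u = u' \<cdot> \<phi>"
      and univ: "\<And>W a b. a \<in> Hom C M W \<Longrightarrow> b \<in> Hom C (Dom C g') W \<Longrightarrow> a \<cdot> u = b \<cdot> \<phi> \<Longrightarrow>
         \<exists>y\<in>Hom C M' W. y \<cdot> \<chi> = a \<and> y \<cdot> u' = b"
      and epi: "\<And>W y y'. y \<in> Hom C M' W \<Longrightarrow> y' \<in> Hom C M' W \<Longrightarrow> y \<cdot> \<chi> = y' \<cdot> \<chi> \<Longrightarrow> y \<cdot> u' = y' \<cdot> u' \<Longrightarrow> y = y'"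
    have "(\<psi> \<cdot> v) \<cdot> u = \<psi> \<cdot> (v \<cdot> u)" using \<phi>(2) v u by simp
    then have "(\<psi> \<cdot> v) \<cdot> u = g' \<cdot> \<phi>" unfolding vu \<phi>(4) .
    moreover have "\<psi> \<cdot> v \<in> Hom C M (Dom C h')" using \<phi>(2) v by simp
    ultimately obtain v' where v': "v' \<in> Hom C M' (Dom C h')" "v' \<cdot> \<chi> = \<psi> \<cdot> v" "v' \<cdot> u' = g'"
      using univ H'(2) by blast
    have "h' \<cdot> v' = w"
    proof (rule epi)
      show "(h' \<cdot> v') \<cdot> \<chi> = w \<cdot> \<chi>" unfolding s'(5)
        using v' s' \<phi> H' v Comp_eq_right[OF \<phi>(5), of v] by auto
      have "w \<cdot> u' = Zero C (Dom C g') X" using short_exactD(8)[OF s'(1)] s' by auto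
      then show "(h' \<cdot> v') \<cdot> u' = w \<cdot> u'" using v' s' h'g' H' by auto
    qed (use v' H' s' in auto)
    then show ?thesis using s' v' unfolding pushout_form_def fs by (simp del: Hom_iff) blast
  qed
qed

text \<open>Dually, \<open>M\<close> is pulled back along \<open>\<psi>\<close>, and
  \<open>u'\<close> is glued from \<open>u \<cdot> \<phi>\<close> and \<open>g\<close>.\<close>

lemma pullback_form_backward:
  assumes m: "(es, fs) \<in> extension_maps C 2 X K" and "pullback_form fs"
  shows "pullback_form es"
proof -
  have x: "es \<in> extensions C 2 X K" "fs \<in> extensions C 2 X K"
    using m by (auto simp: extension_maps_def)
  obtain f g h where es: "es = [f, g, h]" and H: "f \<in> Hom C K (Dom C g)" "g \<in> Hom C (Dom C g) (Dom C h)"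
    "h \<in> Hom C (Dom C h) X" "is_kernel C f g" using extensions_2D[OF x(1)] by metis
  obtain f' g' h' where fs: "fs = [f', g', h']" and H': "f' \<in> Hom C K (Dom C g')"
    "g' \<in> Hom C (Dom C g') (Dom C h')" "h' \<in> Hom C (Dom C h') X"
    using extensions_2D[OF x(2)] by metis
  obtain \<phi> \<psi> where \<phi>: "\<phi> \<in> Hom C (Dom C g) (Dom C g')" "\<psi> \<in> Hom C (Dom C h) (Dom C h')"
    "\<phi> \<cdot> f = f'" "\<psi> \<cdot> g = g' \<cdot> \<phi>" "h' \<cdot> \<psi> = h"
    using extension_maps_2D m unfolding es fs by metis
  obtain M u v where u: "u \<in> Hom C (Dom C g') M" and v: "v \<in> Hom C M (Dom C h')"
    and vu: "v \<cdot> u = g'" and s: "short_exact C (u \<cdot> f') v"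
    using assms(2) unfolding pullback_form_def fs by (simp del: Hom_iff) blast
  have \<psi>v: "\<psi> \<in> Hom C (Dom C h) (Cod C v)" using v \<phi> by auto
  have U: "Dom C (u \<cdot> f') = K" "Dom C v = M" using u v H' by auto
  show ?thesis
  proof (rule pullback_short_exact[OF s \<psi>v, unfolded U])
    fix M' m' v' \<chi>
    assume s': "short_exact C m' v'" "m' \<in> Hom C K M'" "v' \<in> Hom C M' (Dom C h)" "\<chi> \<in> Hom C M' M"
        "\<chi> \<cdot> m' = u \<cdot> f'" "v \<cdot> \<chi> = \<psi> \<cdot> v'"
      and univ: "\<And>W a b. a \<in> Hom C W M \<Longrightarrow> b \<in> Hom C W (Dom C h) \<Longrightarrow> v \<cdot> a = \<psi> \<cdot> b \<Longrightarrow>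
         \<exists>y\<in>Hom C W M'. \<chi> \<cdot> y = a \<and> v' \<cdot> y = b"
    have "v \<cdot> (u \<cdot> \<phi>) = (v \<cdot> u) \<cdot> \<phi>" using \<phi>(1) v u by simp
    then have "v \<cdot> (u \<cdot> \<phi>) = \<psi> \<cdot> g" unfolding vu \<phi>(4) .
    moreover have "u \<cdot> \<phi> \<in> Hom C (Dom C g) M" using \<phi>(1) u by simp
    ultimately obtain u' where u': "u' \<in> Hom C (Dom C g) M'" "\<chi> \<cdot> u' = u \<cdot> \<phi>" "v' \<cdot> u' = g"
      using univ H(2) by blast
    \<comment> \<open>\<open>u' \<cdot> f\<close> is killed by \<open>v'\<close>, so it is
      \<open>m' \<cdot> z\<close> for an endomorphism \<open>z\<close> of \<open>K\<close>;
      composing with the monomorphism \<open>u \<cdot> f'\<close> shows that \<open>z\<close> is the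
      identity.\<close>
    have "u' \<cdot> f = m'"
    proof -
      have "v' \<cdot> (u' \<cdot> f) = Zero C K (Dom C h)"
        using Comp_eq_right[OF u'(3), of f] is_kernelD[OF H(4)] H u' s' by auto
      then obtain z where z: "z \<in> Hom C K K" "m' \<cdot> z = u' \<cdot> f"
        using short_exact_lift[OF s'(1), of "u' \<cdot> f" K] u' H s' by auto
      have "(u \<cdot> f') \<cdot> z = \<chi> \<cdot> (m' \<cdot> z)" unfolding s'(5)[symmetric] using z(1) s'(2-4) by auto
      also have "\<dots> = u \<cdot> (\<phi> \<cdot> f)" unfolding z(2)
        using Comp_eq_right[OF u'(2), of f] H s' u' u \<phi> by auto
      also have "\<dots> = (u \<cdot> f') \<cdot> Id C K" unfolding \<phi>(3) using u H' by auto
      finally have "(u \<cdot> f') \<cdot> z = (u \<cdot> f') \<cdot> Id C K" .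
      then have "z = Id C K"
        by (rule monicD[OF short_exactD(3)[OF s], of z "Id C K" K M K]) (use z(1) u H' Ar_Ob(1)[of f] H(1) in auto)
      then show ?thesis using z(2) s'(2) by simp
    qed
    then show ?thesis using s' u' unfolding pullback_form_def es by (simp del: Hom_iff) blast
  qed
qed

text \<open>The class of zero is represented by \<open>[Id C K, Zero C K X, Id C X]\<close>, whose
  middle morphism factors through a zero object. It is of pushout form with the biproduct as
  \<open>M\<close>, and the form is transported along the chain that joins it to
  \<open>es\<close>.\<close>

lemma pushout_form_if_Ext_zero_2:
  assumes E: "Ext_zero C 2 X K" and es: "es \<in> extensions C 2 X K" and Ob: "X \<in> Ob C" "K \<in> Ob C"
  shows "pushout_form es"
proof -
  obtain B where B: "is_biproduct C K X B" using ex_biproduct Ob by blast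
  obtain i j p q where bp: "biproduct_maps K X B i j p q" using is_biproductE[OF B] .
  note ijpq = biproduct_mapsD[OF bp]
  have iq: "short_exact C i q" using biproduct_short_exact[OF bp] .
  let ?t = "[Id C K, Zero C K X, Id C X]"
  obtain Z where Z: "zero_object C Z" using ex_zero_object by blast
  then have ZO: "Z \<in> Ob C" by (simp add: zero_object_def)
  have Zto: "a = b" if "a \<in> Hom C W Z" "b \<in> Hom C W Z" for W a b
    using Z that Ar_Ob(1)[of a] unfolding zero_object_def by auto
  have Zfrom: "a = b" if "a \<in> Hom C Z W" "b \<in> Hom C Z W" for W a b
    using Z that Ar_Ob(2)[of a] unfolding zero_object_def by auto
  have 1: "exact C (Id C K) (Zero C K X)"
  proof -
    have "is_kernel C (Id C K) (Zero C K X)"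
      by (rule is_kernelI[of _ K K _ X]) (use Ob monic_Id in auto)
    then show ?thesis
      unfolding exact_def using Ob epic_Id by (intro exI[of _ "Id C K"]) auto
  qed
  have 2: "exact C (Zero C K X) (Id C X)"
  proof -
    have "is_kernel C (Zero C Z X) (Id C X)"
    proof (rule is_kernelI)
      show "monic C (Zero C Z X)" by (rule monicI[of _ Z X]) (use Zto ZO Ob Ar_Ob in auto)
      fix W g assume g: "g \<in> Hom C W X" "Id C X \<cdot> g = Zero C W X"
      have "W \<in> Ob C" using g(1) Ar_Ob(1)[of g] by auto
      moreover have "g = Zero C W X" using g by simp
      ultimately show "\<exists>h\<in>Hom C W Z. Zero C Z X \<cdot> h = g"
        using Ob ZO by (intro bexI[of _ "Zero C W Z"]) simp_all
    qed (use Ob ZO in auto)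
    moreover have "epic C (Zero C K Z)" by (rule epicI[of _ K Z]) (use Zfrom ZO Ob Ar_Ob in auto)
    ultimately show ?thesis
      unfolding exact_def using Ob ZO by (intro exI[of _ "Zero C Z X"] exI[of _ "Zero C K Z"]) auto
  qed
  have t: "?t \<in> extensions C 2 X K"
    using 1 2 Ob monic_Id epic_Id by (auto simp: extensions_def less_Suc_eq numeral_2_eq_2)
  have pt: "pushout_form ?t"
    unfolding pushout_form_def
    by (intro exI[of _ B] bexI[of _ i] bexI[of _ q]) (use ijpq iq Ob in auto)
  from Ext_zero_connected[OF E t es] show ?thesis
  proof (induction rule: rtrancl_induct)
    case (step y z)
    have x: "y \<in> extensions C 2 X K" "z \<in> extensions C 2 X K"
      using step(2) by (auto simp: extension_maps_def)
    show ?case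
      using step pushout_form_forward[of y z] pullback_form_backward[of z y]
        pushout_form_iff_pullback_form[OF x(1)] pushout_form_iff_pullback_form[OF x(2)] by auto
  qed (rule pt)
qed

text \<open>An extension of \<open>S\<close> by the quotient, spliced with \<open>k\<close> and
  \<open>q\<close>, is the extension \<open>[k, f \<cdot> q, g]\<close> of length two. Its pushout
  form contains an extension of \<open>S\<close> by \<open>Dom C q\<close>, which splits;
  \<open>v\<close> carries the section to one of \<open>g\<close>.\<close>

lemma Ext_zero_quotient:
  assumes E: "Ext_zero C 2 S (Dom C k)" and B: "Ext_zero C 1 S (Dom C q)" and kq: "short_exact C k q"
    and SO: "S \<in> Ob C"
  shows "Ext_zero C 1 S (Cod C q)"
proof -
  note K = short_exactD[OF kq]
  have Ob: "Cod C q \<in> Ob C" "Dom C k \<in> Ob C" "Dom C q \<in> Ob C" using K by auto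
  show ?thesis
  proof (subst Ext_zero_1_iff[OF SO Ob(1)], intro allI impI)
    fix f g assume fg: "short_exact C f g \<and> Dom C f = Cod C q \<and> Cod C g = S"
    then have s: "short_exact C f g" and fg': "Dom C f = Cod C q" "Cod C g = S" by auto
    note F = short_exactD[OF s]
    let ?es = "[k, f \<cdot> q, g]"
    have "is_kernel C k (f \<cdot> q)"
    proof (rule is_kernelI)
      show "(f \<cdot> q) \<cdot> k = Zero C (Dom C k) (Dom C g)" using K F fg' by auto
      fix W x assume x: "x \<in> Hom C W (Dom C q)" "(f \<cdot> q) \<cdot> x = Zero C W (Dom C g)"
      have "q \<cdot> x = Zero C W (Cod C q)"
        by (rule monicD0[OF F(3), of "q \<cdot> x" W "Dom C g" "Cod C q"]) (use x K F fg' in auto)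
      then obtain y where "y \<in> Hom C W (Dom C k)" "k \<cdot> y = x"
        using short_exact_lift[OF kq x(1)] by blast
      then show "\<exists>y\<in>Hom C W (Dom C k). k \<cdot> y = x" by blast
    qed (use K F fg' in auto)
    then have 1: "exact C k (f \<cdot> q)"
      unfolding exact_def using epic_Id Ob K by (intro exI[of _ k] exI[of _ "Id C (Dom C k)"]) auto
    have 2: "exact C (f \<cdot> q) g"
      unfolding exact_def using F K fg' by (intro exI[of _ f] exI[of _ q]) auto
    have es: "?es \<in> extensions C 2 S (Dom C k)"
      using 1 2 K F fg' by (auto simp: extensions_def less_Suc_eq numeral_2_eq_2)
    obtain M u v where u: "u \<in> Hom C (Dom C q) M" and v: "v \<in> Hom C M (Dom C g)"
      and s2: "short_exact C u (g \<cdot> v)"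
      using pushout_form_if_Ext_zero_2[OF E es SO Ob(2)] K F fg' unfolding pushout_form_def by auto
    obtain t where t: "t \<in> Hom C S M" "(g \<cdot> v) \<cdot> t = Id C S"
      using Ext_zero_lift[OF B s2, of "Id C S"] u v F fg' SO by auto
    show "\<exists>s\<in>Hom C S (Dom C g). g \<cdot> s = Id C S"
      using t v F fg' by (intro bexI[of _ "v \<cdot> t"]) auto
  qed
qed

end

section \<open>Small sets\<close>

context grothendieck_category
begin

lemma Cinfinite_\<kappa>: "Cinfinite \<kappa>"
  using cinfinite_mono[OF ordLess_imp_ordLeq[OF uncountable_\<kappa>] natLeq_cinfinite] Card_order_\<kappa>
  by simp

lemma small_subset: "small \<kappa> A \<Longrightarrow> B \<subseteq> A \<Longrightarrow> small \<kappa> B"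
  unfolding small_def using card_of_mono1 ordLeq_ordLess_trans by blast

lemma small_image: "small \<kappa> A \<Longrightarrow> small \<kappa> (f ` A)"
  unfolding small_def using card_of_image ordLeq_ordLess_trans by blast

lemma small_UN: "small \<kappa> I \<Longrightarrow> (\<And>i. i \<in> I \<Longrightarrow> small \<kappa> (A i)) \<Longrightarrow> small \<kappa> (\<Union>i\<in>I. A i)"
  unfolding small_def
  using card_of_UNION_ordLess_infinite_Field_regularCard[OF regular_\<kappa> Cinfinite_\<kappa>] by blast

lemma small_Sigma:
  assumes "small \<kappa> I" "\<And>i. i \<in> I \<Longrightarrow> small \<kappa> (A i)"
  shows "small \<kappa> (Sigma I A)"
proof -
  have "Sigma I A = (\<Union>i\<in>I. Pair i ` A i)" by auto
  moreover have "small \<kappa> (\<Union>i\<in>I. Pair i ` A i)"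
    by (intro small_UN small_image assms)
  ultimately show ?thesis by simp
qed

lemma small_nat: "small \<kappa> (A :: nat set)"
proof -
  have "|UNIV :: nat set| <o \<kappa>" using ordIso_ordLess_trans[OF card_of_nat uncountable_\<kappa>] .
  then show ?thesis using small_subset[of UNIV A] unfolding small_def by blast
qed

lemma small_finite: "finite A \<Longrightarrow> small \<kappa> A"
  unfolding small_def using finite_iff_ordLess_natLeq uncountable_\<kappa> ordLess_transitive by blast

lemma small_inj_on:
  assumes "inj_on f A" "small \<kappa> (f ` A)"
  shows "small \<kappa> A"
  using small_image[OF assms(2), of "inv_into A f"] assms(1) by simp

lemma small_funpow:
  fixes f :: "'x set \<Rightarrow> 'x set"
  assumes "small \<kappa> A" "\<And>B. small \<kappa> B \<Longrightarrow> small \<kappa> (f B)"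
  shows "small \<kappa> (\<Union>n. (f ^^ n) A)"
proof (rule small_UN[OF small_nat])
  show "small \<kappa> ((f ^^ n) A)" for n by (induction n) (simp_all add: assms)
qed

text \<open>Finite subsets are reached from the empty set by inserting one element at a time, so
  countably many small stages exhaust them.\<close>

lemma small_finite_subsets:
  assumes "small \<kappa> I"
  shows "small \<kappa> {F. F \<subseteq> I \<and> finite F}"
proof -
  let ?f = "\<lambda>W. (\<lambda>(i, F). insert i F) ` (I \<times> W)"
  have U: "small \<kappa> (\<Union>n. (?f ^^ n) {{}})"
    by (intro small_funpow small_image small_Sigma assms) (auto intro: small_finite)
  have "\<exists>n. F \<in> (?f ^^ n) {{}}" if "finite F" "F \<subseteq> I" for F
    using that
  proof (induction rule: finite_induct)
    case empty
    have "{} \<in> (?f ^^ 0) {{}}" by simp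
    then show ?case by blast
  next
    case (insert i F)
    then obtain n where "F \<in> (?f ^^ n) {{}}" by auto
    then have "insert i F \<in> (?f ^^ Suc n) {{}}" using insert by force
    then show ?case by blast
  qed
  then have "{F. F \<subseteq> I \<and> finite F} \<subseteq> (\<Union>n. (?f ^^ n) {{}})" by blast
  then show ?thesis by (rule small_subset[OF U])
qed

text \<open>\<open>e h x\<close> plays the role of the value of \<open>h\<close> at
  \<open>x\<close>: the values on the finite set \<open>F\<close> embed \<open>H\<close> into a
  finite product of small sets. In the application \<open>e\<close> is composition of
  morphisms.\<close>

lemma small_if_finitely_separated:
  assumes "finite F" "\<And>x. x \<in> F \<Longrightarrow> small \<kappa> ((\<lambda>h. e h x) ` H)"
    and "\<And>h h'. h \<in> H \<Longrightarrow> h' \<in> H \<Longrightarrow> (\<forall>x\<in>F. e h x = e h' x) \<Longrightarrow> h = h'"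
  shows "small \<kappa> H"
proof -
  have "small \<kappa> ((\<lambda>h. restrict (e h) F) ` H)"
    using assms(1,2)
  proof (induction rule: finite_induct)
    case empty
    have "(\<lambda>h. restrict (e h) {}) ` H \<subseteq> {\<lambda>_. undefined}" by auto
    then show ?case by (rule small_subset[OF small_finite, rotated]) simp
  next
    case (insert x F)
    have "(\<lambda>h. restrict (e h) (insert x F)) ` H \<subseteq>
      (\<lambda>(y, g). g(x := y)) ` ((\<lambda>h. e h x) ` H \<times> (\<lambda>h. restrict (e h) F) ` H)"
    proof
      fix g assume "g \<in> (\<lambda>h. restrict (e h) (insert x F)) ` H"
      then obtain h where h: "h \<in> H" "g = restrict (e h) (insert x F)" by blast
      have "g = (\<lambda>(y, g). g(x := y)) (e h x, restrict (e h) F)"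
        using h(2) by (auto simp: fun_eq_iff)
      then show "g \<in> (\<lambda>(y, g). g(x := y)) ` ((\<lambda>h. e h x) ` H \<times> (\<lambda>h. restrict (e h) F) ` H)"
        using h(1) by blast
    qed
    moreover have "small \<kappa> ((\<lambda>(y, g). g(x := y)) ` ((\<lambda>h. e h x) ` H \<times> (\<lambda>h. restrict (e h) F) ` H))"
      by (rule small_image[OF small_Sigma]) (use insert.IH insert.prems in \<open>simp_all del: restrict_apply\<close>)
    ultimately show ?case by (rule small_subset[rotated])
  qed
  moreover have "inj_on (\<lambda>h. restrict (e h) F) H"
    using assms(3) by (intro inj_onI) (metis restrict_apply')
  ultimately show ?thesis using small_inj_on by blast
qed

text \<open>Coproducts and finite presentation are postulated only for index sets in the type of
  \<open>\<kappa>\<close>. Small sets of any other type, such as sets of morphisms or of pairs, are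
  moved there by an injection.\<close>

lemma ex_small_index:
  assumes "small \<kappa> I"
  obtains e :: "_ \<Rightarrow> 'u" where "inj_on e I" "small \<kappa> (e ` I)"
proof -
  have "|I| \<le>o |Field \<kappa>|"
    using ordLeq_ordIso_trans[OF ordLess_imp_ordLeq ordIso_symmetric[OF card_of_Field_ordIso[OF Card_order_\<kappa>]]]
      assms unfolding small_def .
  then have "\<exists>e. inj_on e I \<and> e ` I \<subseteq> Field \<kappa>" by (rule card_of_ordLeq[THEN iffD2])
  then obtain e :: "_ \<Rightarrow> 'u" where "inj_on e I" by blast
  then show ?thesis using that small_image[OF assms] by blast
qed

section \<open>Coproducts and direct limits over arbitrary small index sets\<close>

lemma is_coproductD:
  assumes "is_coproduct C I X S \<iota>"
  shows "S \<in> Ob C" "i \<in> I \<Longrightarrow> X i \<in> Ob C" "i \<in> I \<Longrightarrow> \<iota> i \<in> Hom C (X i) S"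
    "Y \<in> Ob C \<Longrightarrow> \<forall>i\<in>I. f i \<in> Hom C (X i) Y \<Longrightarrow> \<exists>!h. h \<in> Hom C S Y \<and> (\<forall>i\<in>I. h \<cdot> \<iota> i = f i)"
  using assms by (simp_all add: is_coproduct_def)

lemma ex_coproduct_any:
  assumes "small \<kappa> I" "\<And>i. i \<in> I \<Longrightarrow> X i \<in> Ob C"
  shows "\<exists>S \<iota>. is_coproduct C I X S \<iota>"
proof -
  obtain e :: "_ \<Rightarrow> 'u" where e: "inj_on e I" "small \<kappa> (e ` I)" using ex_small_index[OF assms(1)] .
  obtain S \<iota> where S: "is_coproduct C (e ` I) (X \<circ> inv_into I e) S \<iota>"
    using ex_coproduct[OF e(2), of "X \<circ> inv_into I e"] assms e by auto
  have "is_coproduct C I X S (\<iota> \<circ> e)"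
    unfolding is_coproduct_def
  proof (intro conjI ballI allI impI)
    fix i assume "i \<in> I"
    then show "X i \<in> Ob C" "(\<iota> \<circ> e) i \<in> Hom C (X i) S"
      using S assms e unfolding is_coproduct_def by (auto simp del: Hom_iff)
  next
    fix Y f assume Y: "Y \<in> Ob C" "\<forall>i\<in>I. f i \<in> Hom C (X i) Y"
    then have "\<forall>j\<in>e ` I. (f \<circ> inv_into I e) j \<in> Hom C ((X \<circ> inv_into I e) j) Y"
      using e(1) by (auto simp del: Hom_iff)
    then have "\<exists>!h. h \<in> Hom C S Y \<and> (\<forall>j\<in>e ` I. h \<cdot> \<iota> j = (f \<circ> inv_into I e) j)"
      by (rule is_coproductD(4)[OF S Y(1)])
    then show "\<exists>!h. h \<in> Hom C S Y \<and> (\<forall>i\<in>I. h \<cdot> (\<iota> \<circ> e) i = f i)"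
      using e(1) by (simp del: Hom_iff)
  qed (use S in \<open>auto simp: is_coproduct_def\<close>)
  then show ?thesis by blast
qed

text \<open>Transport of structure along \<open>e\<close>. It is needed because
  \<open>finitely_presented\<close> speaks of limits over sets in the type of
  \<open>\<kappa>\<close>, while the limits formed below run over natural numbers and over finite
  subfamilies.\<close>

lemma direct_limit_reindex:
  assumes L: "is_direct_limit C I r D d L l" and e: "inj_on e I"
  defines "g \<equiv> inv_into I e"
  shows "is_direct_limit C (e ` I) (map_prod e e ` r) (D \<circ> g) (\<lambda>i j. d (g i) (g j)) L (l \<circ> g)"
proof -
  have ds: "direct_system C I r D d" using L by (simp add: is_direct_limit_def)
  then have dir: "directed_set I r" by (simp add: direct_system_def)
  then have sub: "r \<subseteq> I \<times> I" and refl: "refl_on I r" and tr: "trans r" and anti: "antisym r"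
    by (auto simp: directed_set_def order_on_defs)
  have g: "g (e i) = i" if "i \<in> I" for i using e that by (simp add: g_def)
  have r: "(i', j') \<in> map_prod e e ` r \<longleftrightarrow> (\<exists>i j. (i, j) \<in> r \<and> i' = e i \<and> j' = e j)" for i' j'
    by auto
  have rI: "(i, j) \<in> r \<Longrightarrow> i \<in> I \<and> j \<in> I" for i j using sub by auto
  have "directed_set (e ` I) (map_prod e e ` r)"
    unfolding directed_set_def order_on_defs
  proof (intro conjI)
    show "map_prod e e ` r \<subseteq> e ` I \<times> e ` I" using sub by auto
    show "refl_on (e ` I) (map_prod e e ` r)" using refl by (auto simp: refl_on_def)
    show "trans (map_prod e e ` r)"
    proof (rule transI)
      fix x y z assume "(x, y) \<in> map_prod e e ` r" "(y, z) \<in> map_prod e e ` r"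
      then obtain i j j' k where *: "(i, j) \<in> r" "(j', k) \<in> r" "x = e i" "y = e j" "y = e j'" "z = e k"
        by auto
      then have "j = j'" using e rI by (auto dest: inj_onD)
      then show "(x, z) \<in> map_prod e e ` r" using * tr by (auto dest: transD)
    qed
    show "antisym (map_prod e e ` r)"
    proof (rule antisymI)
      fix x y assume "(x, y) \<in> map_prod e e ` r" "(y, x) \<in> map_prod e e ` r"
      then obtain i j i' j' where *: "(i, j) \<in> r" "(j', i') \<in> r" "x = e i" "y = e j" "x = e i'" "y = e j'"
        by auto
      then have "j = j'" "i = i'" using e rI by (auto dest: inj_onD)
      then show "x = y" using * anti by (auto dest: antisymD)
    qed
    show "e ` I \<noteq> {}" using dir by (auto simp: directed_set_def)
    show "\<forall>i\<in>e ` I. \<forall>j\<in>e ` I. \<exists>k\<in>e ` I. (i, k) \<in> map_prod e e ` r \<and> (j, k) \<in> map_prod e e ` r"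
    proof (intro ballI)
      fix i' j' assume "i' \<in> e ` I" "j' \<in> e ` I"
      then obtain i j where ij: "i \<in> I" "j \<in> I" "i' = e i" "j' = e j" by blast
      then obtain k where "k \<in> I" "(i, k) \<in> r" "(j, k) \<in> r"
        using dir unfolding directed_set_def by blast
      then show "\<exists>k\<in>e ` I. (i', k) \<in> map_prod e e ` r \<and> (j', k) \<in> map_prod e e ` r"
        using ij by (intro bexI[of _ "e k"]) auto
    qed
  qed
  moreover have "\<forall>i\<in>e ` I. (D \<circ> g) i \<in> Ob C \<and> d (g i) (g i) = Id C ((D \<circ> g) i)"
    using ds by (auto simp: direct_system_def g)
  moreover have "\<forall>i j. (i, j) \<in> map_prod e e ` r \<longrightarrow> d (g i) (g j) \<in> Hom C ((D \<circ> g) i) ((D \<circ> g) j)"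
    using ds g rI unfolding direct_system_def r by (auto simp del: Hom_iff)
  moreover have "\<forall>i j k. (i, j) \<in> map_prod e e ` r \<and> (j, k) \<in> map_prod e e ` r \<longrightarrow>
      d (g j) (g k) \<cdot> d (g i) (g j) = d (g i) (g k)"
    using ds g rI e unfolding direct_system_def r by (auto simp del: Hom_iff dest!: inj_onD)
  ultimately have ds': "direct_system C (e ` I) (map_prod e e ` r) (D \<circ> g) (\<lambda>i j. d (g i) (g j))"
    unfolding direct_system_def by blast
  have cc: "cocone C (e ` I) (map_prod e e ` r) (D \<circ> g) (\<lambda>i j. d (g i) (g j)) L' l' \<longleftrightarrow>
    cocone C I r D d L' (l' \<circ> e)" for L' l'
  proof -
    have "(\<forall>i j. (i, j) \<in> map_prod e e ` r \<longrightarrow> l' j \<cdot> d (g i) (g j) = l' i) \<longleftrightarrow>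
      (\<forall>i j. (i, j) \<in> r \<longrightarrow> l' (e j) \<cdot> d i j = l' (e i))"
      unfolding r using g rI by metis
    then show ?thesis unfolding cocone_def by (simp add: g del: Hom_iff)
  qed
  have "cocone C I r D d L (l \<circ> g \<circ> e) = cocone C I r D d L l"
    using rI unfolding cocone_def by (auto simp: g simp del: Hom_iff)
  then have "cocone C (e ` I) (map_prod e e ` r) (D \<circ> g) (\<lambda>i j. d (g i) (g j)) L (l \<circ> g)"
    using cc[of L "l \<circ> g"] L by (simp add: is_direct_limit_def)
  moreover have "\<exists>!h. h \<in> Hom C L L' \<and> (\<forall>i\<in>e ` I. h \<cdot> (l \<circ> g) i = l' i)"
    if "cocone C (e ` I) (map_prod e e ` r) (D \<circ> g) (\<lambda>i j. d (g i) (g j)) L' l'" for L' l'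
  proof -
    have "\<exists>!h. h \<in> Hom C L L' \<and> (\<forall>i\<in>I. h \<cdot> l i = (l' \<circ> e) i)"
      using L that cc unfolding is_direct_limit_def by blast
    then show ?thesis by (simp add: g del: Hom_iff)
  qed
  ultimately show ?thesis using ds' unfolding is_direct_limit_def by blast
qed

lemma finitely_presentedD:
  fixes I :: "'u set"
  assumes "finitely_presented C \<kappa> S" "small \<kappa> I" "is_direct_limit C I r D d L l"
  shows "f \<in> Hom C S L \<Longrightarrow> \<exists>i\<in>I. \<exists>g\<in>Hom C S (D i). f = l i \<cdot> g"
    and "i \<in> I \<Longrightarrow> j \<in> I \<Longrightarrow> f' \<in> Hom C S (D i) \<Longrightarrow> g \<in> Hom C S (D j) \<Longrightarrow> l i \<cdot> f' = l j \<cdot> g \<Longrightarrow>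
      \<exists>k\<in>I. (i, k) \<in> r \<and> (j, k) \<in> r \<and> d i k \<cdot> f' = d j k \<cdot> g"
  using assms(1)[unfolded finitely_presented_def, THEN conjunct2, THEN spec, THEN spec, THEN spec,
      THEN spec, THEN spec, THEN spec, THEN mp, OF conjI[OF assms(2,3)]]
  by (blast intro: bexI)+

lemma finitely_presented_factor:
  assumes "finitely_presented C \<kappa> S" "small \<kappa> I" "is_direct_limit C I r D d L l" "f \<in> Hom C S L"
  shows "\<exists>i\<in>I. \<exists>g\<in>Hom C S (D i). f = l i \<cdot> g"
proof -
  obtain e :: "_ \<Rightarrow> 'u" where e: "inj_on e I" "small \<kappa> (e ` I)" using ex_small_index[OF assms(2)] .
  have "\<exists>i\<in>e ` I. \<exists>g\<in>Hom C S ((D \<circ> inv_into I e) i). f = (l \<circ> inv_into I e) i \<cdot> g"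
    using finitely_presentedD(1)[OF assms(1) e(2) direct_limit_reindex[OF assms(3) e(1)] assms(4)] .
  then show ?thesis using e(1) by (auto simp del: Hom_iff)
qed

lemma finitely_presented_eq:
  assumes "finitely_presented C \<kappa> S" "small \<kappa> I" "is_direct_limit C I r D d L l"
    and "i \<in> I" "f \<in> Hom C S (D i)" "g \<in> Hom C S (D i)" "l i \<cdot> f = l i \<cdot> g"
  shows "\<exists>k\<in>I. (i, k) \<in> r \<and> d i k \<cdot> f = d i k \<cdot> g"
proof -
  obtain e :: "_ \<Rightarrow> 'u" where e: "inj_on e I" "small \<kappa> (e ` I)" using ex_small_index[OF assms(2)] .
  have sub: "r \<subseteq> I \<times> I"
    using assms(3) by (simp add: is_direct_limit_def direct_system_def directed_set_def order_on_defs)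
  let ?g = "inv_into I e"
  have i: "e i \<in> e ` I" "f \<in> Hom C S ((D \<circ> ?g) (e i))" "g \<in> Hom C S ((D \<circ> ?g) (e i))"
    "(l \<circ> ?g) (e i) \<cdot> f = (l \<circ> ?g) (e i) \<cdot> g"
    using assms e by auto
  have "\<exists>k\<in>e ` I. (e i, k) \<in> map_prod e e ` r \<and> (e i, k) \<in> map_prod e e ` r \<and>
      d (?g (e i)) (?g k) \<cdot> f = d (?g (e i)) (?g k) \<cdot> g"
    by (rule finitely_presentedD(2)[OF assms(1) e(2) direct_limit_reindex[OF assms(3) e(1)] i(1,1-4)])
  then obtain k where "k \<in> e ` I" "(e i, k) \<in> map_prod e e ` r" "d (?g (e i)) (?g k) \<cdot> f = d (?g (e i)) (?g k) \<cdot> g"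
    by (elim bexE conjE) (rule that)
  moreover from this obtain k' where "k = e k'" "(i, k') \<in> r" "k' \<in> I"
    using e(1) sub assms(4) by (auto dest!: inj_onD[OF e(1)])
  ultimately show ?thesis using e(1) assms(4) by auto
qed

text \<open>The quotient of \<open>Y\<close> by the sum of the images of the \<open>f i\<close>,
  described without a coproduct of their domains. Uniqueness of \<open>u\<close> is left to
  \<open>epic C c\<close>.\<close>

definition joint_cokernel :: "'i set \<Rightarrow> ('i \<Rightarrow> 'm) \<Rightarrow> 'o \<Rightarrow> 'm \<Rightarrow> bool" where
  "joint_cokernel F f Y c \<longleftrightarrow> c \<in> Ar C \<and> Dom C c = Y \<and> epic C c \<and>
    (\<forall>i\<in>F. c \<cdot> f i = Zero C (Dom C (f i)) (Cod C c)) \<and>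
    (\<forall>W. \<forall>t\<in>Hom C Y W. (\<forall>i\<in>F. t \<cdot> f i = Zero C (Dom C (f i)) W) \<longrightarrow> (\<exists>u\<in>Hom C (Cod C c) W. u \<cdot> c = t))"

lemma joint_cokernelD:
  assumes "joint_cokernel F f Y c"
  shows "c \<in> Ar C" "Dom C c = Y" "epic C c"
    "i \<in> F \<Longrightarrow> c \<cdot> f i = Zero C (Dom C (f i)) (Cod C c)"
    "t \<in> Hom C Y W \<Longrightarrow> \<forall>i\<in>F. t \<cdot> f i = Zero C (Dom C (f i)) W \<Longrightarrow> \<exists>u\<in>Hom C (Cod C c) W. u \<cdot> c = t"
  using assms unfolding joint_cokernel_def by blast+

text \<open>One morphism is killed at a time: \<open>c\<close> for \<open>F\<close> is followed by
  the cokernel of \<open>c \<cdot> f i\<close>.\<close>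

lemma ex_joint_cokernel:
  assumes "finite F" "Y \<in> Ob C" "\<And>i. i \<in> F \<Longrightarrow> f i \<in> Ar C \<and> Cod C (f i) = Y"
  shows "\<exists>c. joint_cokernel F f Y c"
  using assms(1,3)
proof (induction rule: finite_induct)
  case empty
  show ?case unfolding joint_cokernel_def
    by (intro exI[of _ "Id C Y"]) (use assms(2) epic_Id in auto)
next
  case (insert i F)
  then obtain c where jc: "joint_cokernel F f Y c" by auto
  note c = joint_cokernelD[OF jc]
  have f: "\<And>j. j \<in> insert i F \<Longrightarrow> f j \<in> Ar C \<and> Cod C (f j) = Y" using insert by blast
  have cf: "c \<cdot> f i \<in> Hom C (Dom C (f i)) (Cod C c)" using c f by auto
  obtain q where q: "is_cokernel C q (c \<cdot> f i)" using ex_cokernel cf by auto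
  note Q = is_cokernelD[OF q]
  have qH: "q \<in> Hom C (Cod C c) (Cod C q)" using Q cf by auto
  have cY: "c \<in> Hom C Y (Cod C c)" using c by auto
  show ?case
    unfolding joint_cokernel_def
  proof (intro exI[of _ "q \<cdot> c"] conjI ballI allI impI)
    show "q \<cdot> c \<in> Ar C" "Dom C (q \<cdot> c) = Y" using qH cY by auto
    show "epic C (q \<cdot> c)" using epic_Comp[OF c(3) Q(5) cY qH] .
  next
    fix j assume j: "j \<in> insert i F"
    have "q \<cdot> (c \<cdot> f j) = Zero C (Dom C (f j)) (Cod C q)"
    proof (cases "j = i")
      case True
      then show ?thesis using Q(4) cf by simp
    next
      case False
      then have "c \<cdot> f j = Zero C (Dom C (f j)) (Cod C c)" using c(4) j by blast
      then show ?thesis using qH f[OF j] by simp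
    qed
    then show "(q \<cdot> c) \<cdot> f j = Zero C (Dom C (f j)) (Cod C (q \<cdot> c))" using qH cY f[OF j] by simp
  next
    fix W t assume t: "t \<in> Hom C Y W" "\<forall>j\<in>insert i F. t \<cdot> f j = Zero C (Dom C (f j)) W"
    then obtain u where u: "u \<in> Hom C (Cod C c) W" "u \<cdot> c = t" using c(5)[of t W] by blast
    have "u \<cdot> (c \<cdot> f i) = (u \<cdot> c) \<cdot> f i" using u(1) cY f[of i] by simp
    then have "u \<cdot> (c \<cdot> f i) = Zero C (Dom C (f i)) W" unfolding u(2) using t(2) by simp
    then obtain v where v: "v \<in> Hom C (Cod C q) W" "v \<cdot> q = u"
      using is_cokernel_desc[OF q qH cf u(1)] by blast
    have "v \<cdot> (q \<cdot> c) = t" unfolding u(2)[symmetric] v(2)[symmetric] using v(1) qH cY by simp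
    then show "\<exists>u\<in>Hom C (Cod C (q \<cdot> c)) W. u \<cdot> (q \<cdot> c) = t" using v qH cY by auto
  qed
qed

lemma zero_object_arrow:
  assumes "zero_object C Z"
  shows "f \<in> Hom C X Z \<Longrightarrow> f = Zero C X Z" "f \<in> Hom C Z X \<Longrightarrow> f = Zero C Z X"
proof -
  have Z: "Z \<in> Ob C" using assms by (simp add: zero_object_def)
  assume f: "f \<in> Hom C X Z"
  then have X: "X \<in> Ob C" using Ar_Ob(1)[of f] by auto
  then have "\<exists>!f. f \<in> Hom C X Z" using assms unfolding zero_object_def by blast
  then show "f = Zero C X Z" using f X Z Zero_typing by (metis Hom_iff)
next
  have Z: "Z \<in> Ob C" using assms by (simp add: zero_object_def)
  assume f: "f \<in> Hom C Z X"
  then have X: "X \<in> Ob C" using Ar_Ob(2)[of f] by auto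
  then have "\<exists>!f. f \<in> Hom C Z X" using assms unfolding zero_object_def by blast
  then show "f = Zero C Z X" using f X Z Zero_typing by (metis Hom_iff)
qed

text \<open>
  The cokernels of the finite subfamilies of a jointly epic family form a direct system with limit
  zero, so some of them already kills \<open>x\<close>.
\<close>

lemma finitely_presented_finite_subfamily:
  assumes S: "finitely_presented C \<kappa> S" and x: "x \<in> Hom C S Y" and I: "small \<kappa> I"
    and f: "\<And>i. i \<in> I \<Longrightarrow> f i \<in> Ar C \<and> Cod C (f i) = Y"
    and epi: "\<And>W t. t \<in> Hom C Y W \<Longrightarrow> \<forall>i\<in>I. t \<cdot> f i = Zero C (Dom C (f i)) W \<Longrightarrow> t = Zero C Y W"
  obtains F where "F \<subseteq> I" "finite F"
    "\<And>W t. t \<in> Hom C Y W \<Longrightarrow> \<forall>i\<in>F. t \<cdot> f i = Zero C (Dom C (f i)) W \<Longrightarrow> t \<cdot> x = Zero C S W"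
proof -
  let ?\<Lambda> = "{F. F \<subseteq> I \<and> finite F}"
  let ?r = "{(F, F'). F \<subseteq> F' \<and> F' \<subseteq> I \<and> finite F'}"
  have Y: "Y \<in> Ob C" "S \<in> Ob C" using x Ar_Ob by auto
  have "\<forall>F\<in>?\<Lambda>. \<exists>c. joint_cokernel F f Y c"
    by (intro ballI ex_joint_cokernel[OF _ Y(1)]) (use f in auto)
  from bchoice[OF this] obtain c where jc: "\<And>F. F \<in> ?\<Lambda> \<Longrightarrow> joint_cokernel F f Y (c F)" by blast
  have c: "\<And>F. F \<in> ?\<Lambda> \<Longrightarrow> c F \<in> Ar C \<and> Dom C (c F) = Y"
    "\<And>F. F \<in> ?\<Lambda> \<Longrightarrow> epic C (c F)"
    using joint_cokernelD(1-3)[OF jc] by blast+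
  note c = c joint_cokernelD(4,5)[OF jc]
  let ?D = "\<lambda>F. Cod C (c F)"
  have cH: "c F \<in> Hom C Y (?D F)" if "F \<in> ?\<Lambda>" for F using c(1)[OF that] by simp
  have DO: "?D F \<in> Ob C" if "F \<in> ?\<Lambda>" for F using c(1)[OF that] by simp
  have cuniq: "u = v" if "F \<in> ?\<Lambda>" "u \<in> Hom C (?D F) W" "v \<in> Hom C (?D F) W" "u \<cdot> c F = v \<cdot> c F" for F W u v
    using epicD[OF c(2)[OF that(1)] that(4) cH[OF that(1)] that(2,3)] .
  have "\<exists>u\<in>Hom C (?D F) (?D F'). u \<cdot> c F = c F'" if "(F, F') \<in> ?r" for F F'
    by (rule c(4)) (use that cH[of F'] c(3)[of F'] in \<open>auto dest: finite_subset\<close>)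
  then have ex_d: "\<exists>u. u \<in> Hom C (?D F) (?D F') \<and> u \<cdot> c F = c F'" if "(F, F') \<in> ?r" for F F'
    using that by blast
  define d where "d F F' = (SOME u. u \<in> Hom C (?D F) (?D F') \<and> u \<cdot> c F = c F')" for F F'
  have d: "d F F' \<in> Hom C (?D F) (?D F') \<and> d F F' \<cdot> c F = c F'" if "(F, F') \<in> ?r" for F F'
    using someI_ex[OF ex_d[OF that]] unfolding d_def .
  obtain Z where Z: "zero_object C Z" using ex_zero_object by blast
  then have ZO: "Z \<in> Ob C" by (simp add: zero_object_def)
  let ?l = "\<lambda>F. Zero C (?D F) Z"
  have ri: "F \<in> ?\<Lambda>" "F' \<in> ?\<Lambda>" if "(F, F') \<in> ?r" for F F'
    using that by (auto dest: finite_subset)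
  have sys: "direct_system C ?\<Lambda> ?r ?D d"
    unfolding direct_system_def
  proof (intro conjI ballI allI impI)
    show "directed_set ?\<Lambda> ?r"
      unfolding directed_set_def order_on_defs
    proof (intro conjI)
      show "refl_on ?\<Lambda> ?r" by (auto simp: refl_on_def)
      show "trans ?r" "antisym ?r" by (auto intro!: transI antisymI)
      show "?r \<subseteq> ?\<Lambda> \<times> ?\<Lambda>" by (auto dest: finite_subset)
      show "?\<Lambda> \<noteq> {}" by auto
      show "\<forall>i\<in>?\<Lambda>. \<forall>j\<in>?\<Lambda>. \<exists>k\<in>?\<Lambda>. (i, k) \<in> ?r \<and> (j, k) \<in> ?r"
      proof (intro ballI)
        fix i j assume "i \<in> ?\<Lambda>" "j \<in> ?\<Lambda>"
        then show "\<exists>k\<in>?\<Lambda>. (i, k) \<in> ?r \<and> (j, k) \<in> ?r" by (intro bexI[of _ "i \<union> j"]) auto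
      qed
    qed
    fix F assume F: "F \<in> ?\<Lambda>"
    show "?D F \<in> Ob C" using DO[OF F] .
    show "d F F = Id C (?D F)"
      by (rule cuniq[OF F]) (use d[of F F] F cH[OF F] DO[OF F] in auto)
  next
    fix F F' assume "(F, F') \<in> ?r"
    then show "d F F' \<in> Hom C (?D F) (?D F')" using d by blast
  next
    fix F F' F'' assume *: "(F, F') \<in> ?r \<and> (F', F'') \<in> ?r"
    then have **: "(F, F'') \<in> ?r" by auto
    note D = d[of F F'] d[of F' F''] d[OF **]
    show "d F' F'' \<cdot> d F F' = d F F''"
      by (rule cuniq[of F]) (use * ** D ri[OF **] cH[of F] in auto)
  qed
  have l: "cocone C ?\<Lambda> ?r ?D d Z ?l"
    unfolding cocone_def
  proof (intro conjI ballI allI impI)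
    fix F F' assume F: "(F, F') \<in> ?r"
    show "?l F' \<cdot> d F F' = ?l F" using d[OF F] ZO ri[OF F] DO by auto
  qed (use ZO DO in auto)
  have lim: "is_direct_limit C ?\<Lambda> ?r ?D d Z ?l"
    unfolding is_direct_limit_def
  proof (intro conjI allI impI)
    fix L' l' assume cc: "cocone C ?\<Lambda> ?r ?D d L' l'"
    have LO: "L' \<in> Ob C" and l': "\<And>F. F \<in> ?\<Lambda> \<Longrightarrow> l' F \<in> Hom C (?D F) L'"
      "\<And>F F'. (F, F') \<in> ?r \<Longrightarrow> l' F' \<cdot> d F F' = l' F"
      using cc unfolding cocone_def by (auto simp del: Hom_iff)
    have e: "{} \<in> ?\<Lambda>" by simp
    \<comment> \<open>All legs of a cocone induce the same morphism on \<open>Y\<close>. The leg at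
      \<open>{i}\<close> shows that it kills \<open>f i\<close>; so it vanishes by joint epicness,
      and the limit is zero.\<close>
    have t: "l' F \<cdot> c F = l' {} \<cdot> c {}" if F: "F \<in> ?\<Lambda>" for F
    proof -
      have r: "({}, F) \<in> ?r" using F by auto
      have "l' {} \<cdot> c {} = l' F \<cdot> (d {} F \<cdot> c {})"
        unfolding l'(2)[OF r, symmetric] using l'(1)[OF F] d[OF r] cH[OF e] by simp
      then show ?thesis using d[OF r] by simp
    qed
    have "l' {} \<cdot> c {} = Zero C Y L'"
    proof (rule epi)
      show "l' {} \<cdot> c {} \<in> Hom C Y L'" using l'(1)[OF e] cH[OF e] by simp
      show "\<forall>i\<in>I. (l' {} \<cdot> c {}) \<cdot> f i = Zero C (Dom C (f i)) L'"
      proof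
        fix i assume i: "i \<in> I"
        then have i': "{i} \<in> ?\<Lambda>" by simp
        have "(l' {} \<cdot> c {}) \<cdot> f i = l' {i} \<cdot> (c {i} \<cdot> f i)"
          unfolding t[OF i', symmetric] using l'(1)[OF i'] cH[OF i'] f[OF i] by simp
        then show "(l' {} \<cdot> c {}) \<cdot> f i = Zero C (Dom C (f i)) L'"
          using c(3)[OF i', of i] l'(1)[OF i'] f[OF i] by simp
      qed
    qed
    then have l0: "l' F = Zero C (?D F) L'" if "F \<in> ?\<Lambda>" for F
      using epicD0[OF c(2)[OF that] _ cH[OF that] l'(1)[OF that]] t[OF that] by simp
    show "\<exists>!h. h \<in> Hom C Z L' \<and> (\<forall>F\<in>?\<Lambda>. h \<cdot> ?l F = l' F)"
    proof (rule ex1I[of _ "Zero C Z L'"])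
      show "Zero C Z L' \<in> Hom C Z L' \<and> (\<forall>F\<in>?\<Lambda>. Zero C Z L' \<cdot> ?l F = l' F)"
      proof (intro conjI ballI)
        show "Zero C Z L' \<in> Hom C Z L'" using ZO LO by simp
        fix F assume F: "F \<in> ?\<Lambda>"
        show "Zero C Z L' \<cdot> ?l F = l' F" unfolding l0[OF F] using DO[OF F] ZO LO by simp
      qed
    qed (use zero_object_arrow[OF Z] in blast)
  qed (use sys l in auto)
  have e: "{} \<in> ?\<Lambda>" by simp
  \<comment> \<open>\<open>c {}\<close> need not be an identity, so \<open>x\<close> enters the
    system as \<open>c {} \<cdot> x\<close>. In the limit it agrees with zero, hence already at some
    finite stage.\<close>
  have "\<exists>k\<in>?\<Lambda>. ({}, k) \<in> ?r \<and> d {} k \<cdot> (c {} \<cdot> x) = d {} k \<cdot> Zero C S (?D {})"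
    by (rule finitely_presented_eq[OF S small_finite_subsets[OF I] lim e])
      (use x cH[OF e] ZO DO[OF e] Y in auto)
  then obtain F where F: "F \<in> ?\<Lambda>" "({}, F) \<in> ?r" "d {} F \<cdot> (c {} \<cdot> x) = d {} F \<cdot> Zero C S (?D {})"
    by blast
  have "d {} F \<cdot> (c {} \<cdot> x) = c F \<cdot> x"
    using Comp_eq_right[of "d {} F" "c {}" "c F" x] d[OF F(2)] cH[OF e] x by auto
  moreover have "d {} F \<cdot> Zero C S (?D {}) = Zero C S (?D F)" using d[OF F(2)] Y by simp
  ultimately have cx: "c F \<cdot> x = Zero C S (?D F)" using F(3) by simp
  show ?thesis
  proof (rule that)
    show "F \<subseteq> I" "finite F" using F by auto
    fix W t assume t: "t \<in> Hom C Y W" "\<forall>i\<in>F. t \<cdot> f i = Zero C (Dom C (f i)) W"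
    obtain u where u: "u \<in> Hom C (?D F) W" "u \<cdot> c F = t" using c(4)[OF F(1) t] by blast
    have "t \<cdot> x = u \<cdot> (c F \<cdot> x)" unfolding u(2)[symmetric] using u(1) cH[OF F(1)] x by simp
    then show "t \<cdot> x = Zero C S W" unfolding cx using u(1) Y by simp
  qed
qed

end

section \<open>Coproducts and finitely presented objects\<close>

context grothendieck_category
begin

lemma coproduct_eqI:
  assumes "is_coproduct C I X B \<iota>" "h \<in> Hom C B Y" "h' \<in> Hom C B Y" "\<And>i. i \<in> I \<Longrightarrow> h \<cdot> \<iota> i = h' \<cdot> \<iota> i"
  shows "h = h'"
proof -
  have "Y \<in> Ob C" using assms(2) Ar_Ob(2)[of h] by auto
  moreover have "\<forall>i\<in>I. h \<cdot> \<iota> i \<in> Hom C (X i) Y"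
    using is_coproductD(3)[OF assms(1)] assms(2) by auto
  ultimately have "\<exists>!u. u \<in> Hom C B Y \<and> (\<forall>i\<in>I. u \<cdot> \<iota> i = h \<cdot> \<iota> i)"
    by (rule is_coproductD(4)[OF assms(1)])
  then show ?thesis using assms(2-4) by metis
qed

lemma coproduct_desc:
  assumes "is_coproduct C I X B \<iota>" "Y \<in> Ob C" "\<And>i. i \<in> I \<Longrightarrow> f i \<in> Hom C (X i) Y"
  obtains h where "h \<in> Hom C B Y" "\<And>i. i \<in> I \<Longrightarrow> h \<cdot> \<iota> i = f i"
  using is_coproductD(4)[OF assms(1,2), of f] assms(3) by blast

definition coproduct_projections :: "'i set \<Rightarrow> ('i \<Rightarrow> 'o) \<Rightarrow> 'o \<Rightarrow> ('i \<Rightarrow> 'm) \<Rightarrow> ('i \<Rightarrow> 'm) \<Rightarrow> bool" where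
  "coproduct_projections I X B \<iota> \<pi> \<longleftrightarrow> (\<forall>i\<in>I. \<pi> i \<in> Hom C B (X i) \<and>
     (\<forall>j\<in>I. \<pi> i \<cdot> \<iota> j = (if j = i then Id C (X i) else Zero C (X j) (X i))))"

lemma ex_coproduct_projections:
  assumes "is_coproduct C I X B \<iota>"
  shows "\<exists>\<pi>. coproduct_projections I X B \<iota> \<pi>"
proof -
  have "\<exists>p. p \<in> Hom C B (X i) \<and> (\<forall>j\<in>I. p \<cdot> \<iota> j = (if j = i then Id C (X i) else Zero C (X j) (X i)))"
    if "i \<in> I" for i
    by (rule coproduct_desc[OF assms, of "X i" "\<lambda>j. if j = i then Id C (X i) else Zero C (X j) (X i)"])
      (use is_coproductD(2)[OF assms] that in auto)
  then show ?thesis unfolding coproduct_projections_def by (intro bchoice) blast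
qed

text \<open>
  A morphism from a finitely presented object to a coproduct is a finite sum of its components.
\<close>

lemma coproduct_finitely_presented_induct:
  assumes B: "is_coproduct C I X B \<iota>" and \<pi>: "coproduct_projections I X B \<iota> \<pi>"
    and I: "small \<kappa> I" and S: "finitely_presented C \<kappa> S" and x: "x \<in> Hom C S B"
    and zero: "Q (Zero C S B)"
    and add: "\<And>y z. y \<in> Hom C S B \<Longrightarrow> z \<in> Hom C S B \<Longrightarrow> Q y \<Longrightarrow> Q z \<Longrightarrow> Q (y \<oplus> z)"
    and comp: "\<And>i. i \<in> I \<Longrightarrow> Q (\<iota> i \<cdot> (\<pi> i \<cdot> x))"
  shows "Q x"
proof -
  note BD = is_coproductD[OF B]
  have \<pi>H: "\<pi> i \<in> Hom C B (X i)" if "i \<in> I" for i using \<pi> that unfolding coproduct_projections_def by blast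
  have \<pi>\<iota>: "\<pi> i \<cdot> \<iota> j = (if j = i then Id C (X i) else Zero C (X j) (X i))" if "i \<in> I" "j \<in> I" for i j
    using \<pi> that unfolding coproduct_projections_def by blast
  \<comment> \<open>\<open>e\<close> is the idempotent that keeps the summands in \<open>F\<close>
    and kills the others, built as a sum of the \<open>\<iota> i \<cdot> \<pi> i\<close>; along the
    way \<open>Q\<close> is preserved by \<open>add\<close> and \<open>comp\<close>.\<close>
  have partial: "\<exists>e\<in>Hom C B B. (\<forall>i\<in>I. e \<cdot> \<iota> i = (if i \<in> F then \<iota> i else Zero C (X i) B)) \<and> Q (e \<cdot> x)"
    if "finite F" "F \<subseteq> I" for F
    using that
  proof (induction rule: finite_induct)
    case empty
    show ?case
      by (intro bexI[of _ "Zero C B B"]) (use BD(1,3) zero x in auto)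
  next
    case (insert i F)
    then obtain e where e: "e \<in> Hom C B B" "\<And>j. j \<in> I \<Longrightarrow> e \<cdot> \<iota> j = (if j \<in> F then \<iota> j else Zero C (X j) B)"
      "Q (e \<cdot> x)" by auto
    have i: "i \<in> I" using insert by blast
    have ip: "\<iota> i \<cdot> \<pi> i \<in> Hom C B B" using \<pi>H[OF i] BD(3)[OF i] by auto
    have "(e \<oplus> \<iota> i \<cdot> \<pi> i) \<cdot> \<iota> j = (if j \<in> insert i F then \<iota> j else Zero C (X j) B)" if j: "j \<in> I" for j
    proof -
      have "(e \<oplus> \<iota> i \<cdot> \<pi> i) \<cdot> \<iota> j = e \<cdot> \<iota> j \<oplus> \<iota> i \<cdot> (\<pi> i \<cdot> \<iota> j)"
        using e(1) ip \<pi>H[OF i] BD(3)[OF i] BD(3)[OF j] by auto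
      then show ?thesis
        unfolding e(2)[OF j] \<pi>\<iota>[OF i j] using insert(2) BD(3)[OF i] BD(2,3)[OF j] BD(1) BD(2)[OF i] by auto
    qed
    moreover have "Q ((e \<oplus> \<iota> i \<cdot> \<pi> i) \<cdot> x)"
    proof -
      have "(e \<oplus> \<iota> i \<cdot> \<pi> i) \<cdot> x = e \<cdot> x \<oplus> \<iota> i \<cdot> (\<pi> i \<cdot> x)"
        using e(1) ip \<pi>H[OF i] BD(3)[OF i] x by auto
      moreover have "e \<cdot> x \<in> Hom C S B" "\<iota> i \<cdot> (\<pi> i \<cdot> x) \<in> Hom C S B"
        using e(1) \<pi>H[OF i] BD(3)[OF i] x by auto
      ultimately show ?thesis using add e(3) comp[OF i] by simp
    qed
    moreover have "e \<oplus> \<iota> i \<cdot> \<pi> i \<in> Hom C B B" using e(1) ip by auto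
    ultimately show ?case by blast
  qed
  obtain F where F: "F \<subseteq> I" "finite F"
    "\<And>W t. t \<in> Hom C B W \<Longrightarrow> \<forall>i\<in>F. t \<cdot> \<iota> i = Zero C (Dom C (\<iota> i)) W \<Longrightarrow> t \<cdot> x = Zero C S W"
  proof (rule finitely_presented_finite_subfamily[OF S x I, of \<iota>])
    show "\<iota> i \<in> Ar C \<and> Cod C (\<iota> i) = B" if "i \<in> I" for i using BD(3)[OF that] by auto
    fix W t assume t: "t \<in> Hom C B W" "\<forall>i\<in>I. t \<cdot> \<iota> i = Zero C (Dom C (\<iota> i)) W"
    then have "W \<in> Ob C" using Ar_Ob(2)[of t] by auto
    then show "t = Zero C B W"
      by (intro coproduct_eqI[OF B t(1)]) (use t(2) BD(1,3) in auto)
  qed blast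
  obtain e where e: "e \<in> Hom C B B" "\<And>j. j \<in> I \<Longrightarrow> e \<cdot> \<iota> j = (if j \<in> F then \<iota> j else Zero C (X j) B)"
    "Q (e \<cdot> x)" using partial[OF F(2,1)] by auto
  \<comment> \<open>\<open>d\<close> is the complement of \<open>e\<close>. It kills all
    \<open>\<iota> i\<close> with \<open>i\<close> in \<open>F\<close>, and \<open>F\<close> was
    chosen so that such a morphism kills \<open>x\<close>; hence
    \<open>x = e \<cdot> x\<close>.\<close>
  obtain d where d: "d \<in> Hom C B B" "Id C B = e \<oplus> d"
    using ex_diff[of "Id C B" B B e] e(1) BD(1) by auto
  have "d \<cdot> x = Zero C S B"
  proof (rule F(3)[OF d(1)], intro ballI)
    fix i assume i: "i \<in> F"
    then have iI: "i \<in> I" using F(1) by blast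
    have "\<iota> i = (e \<oplus> d) \<cdot> \<iota> i" unfolding d(2)[symmetric] using BD(3)[OF iI] by auto
    also have "\<dots> = \<iota> i \<oplus> d \<cdot> \<iota> i" using e(1) e(2)[OF iI] i d(1) BD(3)[OF iI] by auto
    finally have "\<iota> i \<oplus> d \<cdot> \<iota> i = \<iota> i" by (rule sym)
    then have "d \<cdot> \<iota> i = Zero C (X i) B"
      by (rule Add_eq_self) (use d(1) BD(3)[OF iI] in auto)
    then show "d \<cdot> \<iota> i = Zero C (Dom C (\<iota> i)) B" using BD(3)[OF iI] by auto
  qed
  moreover have "x = (e \<oplus> d) \<cdot> x" unfolding d(2)[symmetric] using x by auto
  moreover have "(e \<oplus> d) \<cdot> x = e \<cdot> x \<oplus> d \<cdot> x" using e(1) d(1) x by auto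
  moreover have "e \<cdot> x \<oplus> Zero C S B = e \<cdot> x" using e(1) x by auto
  ultimately show ?thesis using e(3) by metis
qed

lemma separating_zero:
  assumes "separating C \<G>" "t \<in> Hom C Y W" "\<And>G h. G \<in> \<G> \<Longrightarrow> h \<in> Hom C G Y \<Longrightarrow> t \<cdot> h = Zero C G W"
  shows "t = Zero C Y W"
proof (rule ccontr)
  assume ne: "t \<noteq> Zero C Y W"
  have O: "Y \<in> Ob C" "W \<in> Ob C" using assms(2) Ar_Ob[of t] by auto
  then obtain G h where h: "G \<in> \<G>" "h \<in> Hom C G Y" "t \<cdot> h \<noteq> Zero C Y W \<cdot> h"
    using assms(1) ne assms(2) Zero_typing[OF O] unfolding separating_def by (metis Hom_iff)
  then show False using assms(3)[OF h(1,2)] O by auto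
qed

lemma separating_monicI:
  assumes "separating C \<G>" "k \<in> Hom C X Y"
    and "\<And>G h. G \<in> \<G> \<Longrightarrow> h \<in> Hom C G X \<Longrightarrow> k \<cdot> h = Zero C G Y \<Longrightarrow> h = Zero C G X"
  shows "monic C k"
proof (rule monicI[OF assms(2)])
  fix W g assume g: "g \<in> Hom C W X" "k \<cdot> g = Zero C W Y"
  show "g = Zero C W X"
  proof (rule separating_zero[OF assms(1) g(1)])
    fix G h assume h: "G \<in> \<G>" "h \<in> Hom C G W"
    have "Y \<in> Ob C" using assms(2) Ar_Ob(2)[of k] by auto
    then have "k \<cdot> (g \<cdot> h) = Zero C G Y"
      using Comp_eq_right[OF g(2), of h] g(1) h(2) assms(2) by auto
    then show "g \<cdot> h = Zero C G X" using assms(3)[OF h(1), of "g \<cdot> h"] g(1) h(2) by auto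
  qed
qed

text \<open>The morphisms from the generator \<open>G\<close> to \<open>S\<close> are jointly epic,
  so finitely many of them are. A morphism out of \<open>S\<close> is then determined by finitely
  many composites in the small set \<open>Hom C G X\<close>.\<close>

lemma small_Hom:
  assumes S: "finitely_presented C \<kappa> S" and X: "X \<in> Ob C"
  shows "small \<kappa> (Hom C S X)"
proof -
  obtain G where G: "separating C {G}" "\<And>X. X \<in> Ob C \<Longrightarrow> small \<kappa> (Hom C G X)"
    using ex_generator by blast
  have SO: "S \<in> Ob C" using S by (simp add: finitely_presented_def)
  have Id: "Id C S \<in> Hom C S S" using SO by simp
  obtain F where F: "F \<subseteq> Hom C G S" "finite F"
    "\<And>W t. t \<in> Hom C S W \<Longrightarrow> \<forall>i\<in>F. t \<cdot> i = Zero C (Dom C i) W \<Longrightarrow> t \<cdot> Id C S = Zero C S W"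
  proof (rule finitely_presented_finite_subfamily[OF S Id G(2)[OF SO], of "\<lambda>h. h"])
    show "i \<in> Ar C \<and> Cod C i = S" if "i \<in> Hom C G S" for i using that by auto
    fix W t assume t: "t \<in> Hom C S W" "\<forall>i\<in>Hom C G S. t \<cdot> i = Zero C (Dom C i) W"
    then show "t = Zero C S W" by (intro separating_zero[OF G(1) t(1)]) auto
  qed blast
  show ?thesis
  proof (rule small_if_finitely_separated[OF F(2), of "\<lambda>h f. h \<cdot> f"])
    fix f assume "f \<in> F"
    then have "(\<lambda>h. h \<cdot> f) ` Hom C S X \<subseteq> Hom C G X" using F(1) by auto
    then show "small \<kappa> ((\<lambda>h. h \<cdot> f) ` Hom C S X)" by (rule small_subset[OF G(2)[OF X]])
  next
    fix h h' assume h: "h \<in> Hom C S X" "h' \<in> Hom C S X" "\<forall>f\<in>F. h \<cdot> f = h' \<cdot> f"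
    obtain d where d: "d \<in> Hom C S X" "h = h' \<oplus> d" using ex_diff h(1,2) by blast
    have "d \<cdot> Id C S = Zero C S X"
    proof (rule F(3)[OF d(1)], intro ballI)
      fix f assume f: "f \<in> F"
      then have fH: "f \<in> Hom C G S" using F(1) by blast
      have "h' \<cdot> f \<oplus> d \<cdot> f = (h' \<oplus> d) \<cdot> f" using h(2) d(1) fH by auto
      also have "\<dots> = h' \<cdot> f" unfolding d(2)[symmetric] using h(3) f by blast
      finally have "d \<cdot> f = Zero C G X"
        by (rule Add_eq_self) (use h(2) d(1) fH in auto)
      then show "d \<cdot> f = Zero C (Dom C f) X" using fH by auto
    qed
    then have "d = Zero C S X" using d(1) by auto
    then show "h = h'" using d(2) h(2) by auto
  qed
qed

lemma zero_object_biproduct: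
  assumes "zero_object C Z" "X \<in> Ob C"
  shows "is_biproduct C Z X X" "is_biproduct C X Z X"
proof -
  have Z: "Z \<in> Ob C" using assms by (simp add: zero_object_def)
  have IZ: "Id C Z = Zero C Z Z" using zero_object_arrow(1)[OF assms(1), of "Id C Z" Z] Z by simp
  have 0: "Zero C Z X \<in> Hom C Z X" "Zero C X Z \<in> Hom C X Z" "Id C X \<in> Hom C X X"
    using Z assms(2) by auto
  show "is_biproduct C Z X X"
    unfolding is_biproduct_def using Z assms(2) 0 IZ
    by (intro conjI bexI[of _ "Zero C Z X"] bexI[of _ "Id C X"] bexI[of _ "Zero C X Z"]
        bexI[where x = "Id C X" and A = "Hom C X X"]) simp_all
  show "is_biproduct C X Z X"
    unfolding is_biproduct_def
    apply (intro conjI Z assms(2) bexI[OF _ 0(3)] bexI[OF _ 0(1)] bexI[OF _ 0(2)])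
    using Z assms(2) IZ by simp_all
qed

end

section \<open>Objects orthogonal to a resolving class\<close>

locale resolving_class = grothendieck_category +
  fixes \<S> :: "'a set"
  assumes finitely_presented: "S \<in> \<S> \<Longrightarrow> finitely_presented C \<kappa> S"
    and resolving: "resolving C \<kappa> \<S>"
    and proj_dim: "S \<in> \<S> \<Longrightarrow> proj_dim_le C S 1"
begin

lemma S_Ob: "S \<in> \<S> \<Longrightarrow> S \<in> Ob C"
  using resolving by (auto simp: resolving_def)

lemma S_extension: "short_exact C f g \<Longrightarrow> Dom C f \<in> \<S> \<Longrightarrow> Cod C g \<in> \<S> \<Longrightarrow> Dom C g \<in> \<S>"
  using resolving unfolding resolving_def by blast

lemma S_kernel: "short_exact C f g \<Longrightarrow> Dom C g \<in> \<S> \<Longrightarrow> Cod C g \<in> \<S> \<Longrightarrow> Dom C f \<in> \<S>"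
  using resolving unfolding resolving_def by blast

lemma S_biproduct:
  assumes "A \<in> \<S>" "B \<in> \<S>" "is_biproduct C A B P"
  shows "P \<in> \<S>"
proof -
  obtain i j p q where bp: "biproduct_maps A B P i j p q" using is_biproductE[OF assms(3)] .
  show ?thesis
    using S_extension[OF biproduct_short_exact[OF bp]] biproduct_mapsD(1,4)[OF bp] assms by auto
qed

lemma S_zero_object:
  assumes "zero_object C Z" "S \<in> \<S>"
  shows "Z \<in> \<S>"
proof -
  have "direct_summand C Z S"
    using zero_object_biproduct(1)[OF assms(1) S_Ob[OF assms(2)]] unfolding direct_summand_def by blast
  then show ?thesis using resolving assms(2) unfolding resolving_def by blast
qed

section \<open>Finite sums of generators and covers by them\<close>

definition gens :: "'a set" where
  "gens = (SOME \<G>. \<G> \<subseteq> \<S> \<and> small \<kappa> \<G> \<and> separating C \<G>)"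

lemma gens: "gens \<subseteq> \<S>" "small \<kappa> gens" "separating C gens"
proof -
  have "\<exists>\<G>. \<G> \<subseteq> \<S> \<and> small \<kappa> \<G> \<and> separating C \<G>"
    using resolving unfolding resolving_def contains_generators_def by blast
  from someI_ex[OF this] show "gens \<subseteq> \<S>" "small \<kappa> gens" "separating C gens"
    unfolding gens_def by blast+
qed

text \<open>One biproduct is chosen at each step; admitting all of them would add every isomorphic
  copy and might destroy smallness. The iteration starts from a zero object, the sum of the empty
  family.\<close>

definition finite_sums :: "'a set" where
  "finite_sums = (\<Union>n. ((\<lambda>W. (\<lambda>(A, B). SOME P. is_biproduct C A B P) ` (gens \<times> W)) ^^ n)
     {SOME Z. zero_object C Z})"

lemma small_finite_sums: "small \<kappa> finite_sums"
  unfolding finite_sums_def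
proof (rule small_funpow)
  show "small \<kappa> {SOME Z. zero_object C Z}" by (simp add: small_finite)
  show "small \<kappa> ((\<lambda>(A, B). SOME P. is_biproduct C A B P) ` (gens \<times> W))" if "small \<kappa> W" for W
    by (rule small_image[OF small_Sigma[OF gens(2) that]])
qed

lemma finite_sums_zero: "\<exists>Z\<in>finite_sums. zero_object C Z"
proof -
  have "(SOME Z. zero_object C Z) \<in> finite_sums"
    unfolding finite_sums_def by (rule UN_I[of 0]) simp_all
  then show ?thesis using someI_ex[OF ex_zero_object] by blast
qed

lemma finite_sums_biproduct:
  assumes "A \<in> gens" "B \<in> finite_sums"
  shows "\<exists>P\<in>finite_sums. is_biproduct C A B P"
proof -
  let ?f = "\<lambda>W. (\<lambda>(A, B). SOME P. is_biproduct C A B P) ` (gens \<times> W)" and ?Z = "{SOME Z. zero_object C Z}"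
  have O: "X \<in> Ob C" if "X \<in> (?f ^^ n) ?Z" for n X
    using that
  proof (induction n arbitrary: X)
    case 0
    then show ?case using someI_ex[OF ex_zero_object] by (simp add: zero_object_def)
  next
    case (Suc n)
    then obtain A B where AB: "A \<in> gens" "B \<in> (?f ^^ n) ?Z" "X = (SOME P. is_biproduct C A B P)" by auto
    have "A \<in> Ob C" "B \<in> Ob C" using AB Suc.IH gens(1) S_Ob by auto
    from someI_ex[OF ex_biproduct[OF this]] have "is_biproduct C A B X" unfolding AB(3) .
    then show ?case by (rule is_biproductE)
  qed
  obtain n where n: "B \<in> (?f ^^ n) ?Z" using assms(2) unfolding finite_sums_def by blast
  have "(SOME P. is_biproduct C A B P) \<in> (?f ^^ Suc n) ?Z" using n assms(1) by force
  then have "(SOME P. is_biproduct C A B P) \<in> finite_sums" unfolding finite_sums_def by blast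
  moreover have "is_biproduct C A B (SOME P. is_biproduct C A B P)"
    using O[OF n] assms(1) gens(1) S_Ob by (intro someI_ex[OF ex_biproduct]) auto
  ultimately show ?thesis by blast
qed

text \<open>A member of \<open>\<S>\<close> is required because the zero object enters
  \<open>\<S>\<close> as a direct summand of it. An empty \<open>\<S>\<close> can occur, namely when
  all objects are zero.\<close>

lemma finite_sums_S:
  assumes "S \<in> \<S>"
  shows "finite_sums \<subseteq> \<S>"
proof -
  let ?f = "\<lambda>W. (\<lambda>(A, B). SOME P. is_biproduct C A B P) ` (gens \<times> W)" and ?Z = "{SOME Z. zero_object C Z}"
  have "X \<in> \<S>" if "X \<in> (?f ^^ n) ?Z" for n X
    using that
  proof (induction n arbitrary: X)
    case 0
    then show ?case using someI_ex[OF ex_zero_object] S_zero_object[OF _ assms] by simp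
  next
    case (Suc n)
    then obtain A B where AB: "A \<in> gens" "B \<in> (?f ^^ n) ?Z" "X = (SOME P. is_biproduct C A B P)" by auto
    have AB': "A \<in> \<S>" "B \<in> \<S>" using AB Suc.IH gens(1) by auto
    then have "is_biproduct C A B X"
      unfolding AB(3) by (intro someI_ex[OF ex_biproduct] S_Ob)
    then show ?case using S_biproduct AB' by blast
  qed
  then show ?thesis unfolding finite_sums_def by blast
qed

lemma finite_family_factors:
  assumes "finite F" "E \<in> Ob C" "\<And>h. h \<in> F \<Longrightarrow> h \<in> Ar C \<and> Dom C h \<in> gens \<and> Cod C h = E"
  shows "\<exists>P\<in>finite_sums. \<exists>p\<in>Hom C P E. \<forall>h\<in>F. \<exists>s\<in>Hom C (Dom C h) P. p \<cdot> s = h"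
  using assms(1,3)
proof (induction rule: finite_induct)
  case empty
  obtain Z where Z: "Z \<in> finite_sums" "zero_object C Z" using finite_sums_zero by blast
  then have "Zero C Z E \<in> Hom C Z E" using assms(2) by (simp add: zero_object_def)
  then show ?case using Z(1) by blast
next
  case (insert h F)
  then obtain P p where P: "P \<in> finite_sums" "p \<in> Hom C P E" "\<And>h. h \<in> F \<Longrightarrow> \<exists>s\<in>Hom C (Dom C h) P. p \<cdot> s = h"
    by auto
  have h: "h \<in> Hom C (Dom C h) E" "Dom C h \<in> gens" using insert.prems by auto
  obtain P' where P': "P' \<in> finite_sums" "is_biproduct C (Dom C h) P P'"
    using finite_sums_biproduct[OF h(2) P(1)] by blast
  obtain i j p' q where bp: "biproduct_maps (Dom C h) P P' i j p' q" using is_biproductE[OF P'(2)] .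
  note ijpq = biproduct_mapsD[OF bp]
  obtain r where r: "r \<in> Hom C P' E" "r \<cdot> i = h" "r \<cdot> j = p"
    using biproduct_copair[OF bp h(1) P(2)] .
  have "\<exists>s\<in>Hom C (Dom C h') P'. r \<cdot> s = h'" if h': "h' \<in> insert h F" for h'
  proof (cases "h' = h")
    case True
    then show ?thesis using ijpq(1) r(2) by blast
  next
    case False
    then obtain s where s: "s \<in> Hom C (Dom C h') P" "p \<cdot> s = h'" using P(3) h' by blast
    have "r \<cdot> (j \<cdot> s) = h'" using Comp_eq_right[OF r(3), of s] s r(1) ijpq(2) by auto
    moreover have "j \<cdot> s \<in> Hom C (Dom C h') P'" using s(1) ijpq(2) by auto
    ultimately show ?thesis by blast
  qed
  then show ?case using P'(1) r(1) by blast
qed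

text \<open>The composites of \<open>g\<close> with all morphisms from generators into
  \<open>E\<close> are jointly epic onto \<open>S\<close>; finite presentation of \<open>S\<close>
  leaves finitely many, which combine to \<open>p\<close>. As \<open>E\<close> is arbitrary,
  \<open>p\<close> itself need not be epic.\<close>

lemma epic_cover:
  assumes g: "g \<in> Hom C E S" "epic C g" and S: "finitely_presented C \<kappa> S"
  obtains P p where "P \<in> finite_sums" "p \<in> Hom C P E" "epic C (g \<cdot> p)"
proof -
  have O: "E \<in> Ob C" "S \<in> Ob C" using g Ar_Ob[of g] by auto
  let ?I = "\<Union>G\<in>gens. Hom C G E"
  have I: "small \<kappa> ?I"
  proof (rule small_UN[OF gens(2)])
    show "small \<kappa> (Hom C G E)" if "G \<in> gens" for G
      using that gens(1) by (intro small_Hom[OF finitely_presented O(1)]) blast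
  qed
  have Id: "Id C S \<in> Hom C S S" using O by simp
  obtain F where F: "F \<subseteq> ?I" "finite F"
    "\<And>W t. t \<in> Hom C S W \<Longrightarrow> \<forall>h\<in>F. t \<cdot> (g \<cdot> h) = Zero C (Dom C (g \<cdot> h)) W \<Longrightarrow> t \<cdot> Id C S = Zero C S W"
  proof (rule finitely_presented_finite_subfamily[OF S Id I, of "\<lambda>h. g \<cdot> h"])
    show "g \<cdot> i \<in> Ar C \<and> Cod C (g \<cdot> i) = S" if "i \<in> ?I" for i using that g(1) by auto
    fix W t assume t: "t \<in> Hom C S W" "\<forall>h\<in>?I. t \<cdot> (g \<cdot> h) = Zero C (Dom C (g \<cdot> h)) W"
    have "t \<cdot> g = Zero C E W"
    proof (rule separating_zero[OF gens(3)])
      show "t \<cdot> g \<in> Hom C E W" using t(1) g(1) by auto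
      fix G h assume h: "G \<in> gens" "h \<in> Hom C G E"
      then have "t \<cdot> (g \<cdot> h) = Zero C (Dom C (g \<cdot> h)) W" using t(2) by blast
      then show "(t \<cdot> g) \<cdot> h = Zero C G W" using h(2) t(1) g(1) by auto
    qed
    then show "t = Zero C S W" using epicD0[OF g(2) _ g(1) t(1)] by blast
  qed blast
  have "\<exists>P\<in>finite_sums. \<exists>p\<in>Hom C P E. \<forall>h\<in>F. \<exists>s\<in>Hom C (Dom C h) P. p \<cdot> s = h"
    by (rule finite_family_factors[OF F(2) O(1)]) (use F(1) in auto)
  then obtain P p where P: "P \<in> finite_sums" "p \<in> Hom C P E" "\<And>h. h \<in> F \<Longrightarrow> \<exists>s\<in>Hom C (Dom C h) P. p \<cdot> s = h"
    by blast
  have gp: "g \<cdot> p \<in> Hom C P S" using g(1) P(2) by auto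
  have "epic C (g \<cdot> p)"
  proof (rule epicI[OF gp])
    fix W t assume t: "t \<in> Hom C S W" "t \<cdot> (g \<cdot> p) = Zero C P W"
    have W: "W \<in> Ob C" using t(1) Ar_Ob(2)[of t] by auto
    have "t \<cdot> Id C S = Zero C S W"
    proof (rule F(3)[OF t(1)], intro ballI)
      fix h assume h: "h \<in> F"
      then obtain s where s: "s \<in> Hom C (Dom C h) P" "p \<cdot> s = h" using P(3) by blast
      have hH: "h \<in> Ar C" "Cod C h = E" using h F(1) by auto
      have "t \<cdot> (g \<cdot> h) = (t \<cdot> (g \<cdot> p)) \<cdot> s"
        unfolding s(2)[symmetric] using t(1) g(1) P(2) s(1) by auto
      also have "\<dots> = Zero C (Dom C h) W" unfolding t(2) using s(1) W by auto
      also have "Dom C h = Dom C (g \<cdot> h)" using hH g(1) by auto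
      finally show "t \<cdot> (g \<cdot> h) = Zero C (Dom C (g \<cdot> h)) W" .
    qed
    then show "t = Zero C S W" using t(1) by auto
  qed
  then show ?thesis using that P(1,2) by blast
qed

text \<open>
  Orthogonality to \<open>\<S>\<close> is injectivity with respect to the inclusions of kernels of epimorphisms
  within \<open>\<S>\<close>. It suffices to use those that are images of morphisms between the objects of
  \<open>finite_sums\<close>, of which there is a small set.
\<close>

definition presents :: "'b \<Rightarrow> 'b \<Rightarrow> bool" where
  "presents a k \<longleftrightarrow> (\<exists>c. is_cokernel C c a \<and> is_kernel C k c \<and> Dom C k \<in> \<S> \<and> Cod C k \<in> \<S> \<and> Cod C c \<in> \<S>)"

text \<open>A single \<open>k\<close> is selected for each \<open>a\<close>, since the isomorphic
  copies of a kernel may form a large set.\<close>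

definition test_monos :: "'b set" where
  "test_monos = (\<lambda>a. SOME k. presents a k) ` {a \<in> \<Union>P\<in>finite_sums. \<Union>Q\<in>finite_sums. Hom C P Q. \<exists>k. presents a k}"

lemma small_test_monos: "small \<kappa> test_monos"
\<comment> \<open>For empty \<open>\<S>\<close> nothing is presented; otherwise the finite sums lie
  in \<open>\<S>\<close>, are finitely presented and so have small sets of morphisms.\<close>
proof (cases "\<S> = {}")
  case True
  then have "test_monos = {}" unfolding test_monos_def presents_def by blast
  then show ?thesis by (simp add: small_finite)
next
  case False
  then have "finite_sums \<subseteq> \<S>" using finite_sums_S by blast
  then have "small \<kappa> (\<Union>P\<in>finite_sums. \<Union>Q\<in>finite_sums. Hom C P Q)"
    using finitely_presented S_Ob by (intro small_UN small_finite_sums small_Hom) auto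
  then show ?thesis unfolding test_monos_def by (intro small_image) (auto intro: small_subset)
qed

lemma test_monosE:
  assumes "k \<in> test_monos"
  obtains c where "short_exact C k c" "Dom C k \<in> \<S>" "Cod C k \<in> \<S>" "Cod C c \<in> \<S>" "k \<in> Ar C"
proof -
  obtain a where a: "\<exists>k. presents a k" "k = (SOME k. presents a k)" using assms unfolding test_monos_def by blast
  have "presents a k" unfolding a(2) by (rule someI_ex[OF a(1)])
  then obtain c where c: "is_cokernel C c a" "is_kernel C k c" "Dom C k \<in> \<S>" "Cod C k \<in> \<S>" "Cod C c \<in> \<S>"
    unfolding presents_def by blast
  then show ?thesis using that[OF short_exactI[OF c(2) is_cokernelD(5)[OF c(1)]]] is_kernelD(1)[OF c(2)] by blast
qed

definition test_injective :: "'a \<Rightarrow> bool" where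
  "test_injective F \<longleftrightarrow> F \<in> Ob C \<and> (\<forall>k\<in>test_monos. \<forall>a\<in>Hom C (Dom C k) F. \<exists>b\<in>Hom C (Cod C k) F. b \<cdot> k = a)"

text \<open>An extension of \<open>S\<close> by \<open>F\<close> is the pushout of some
  \<open>K \<rightarrow> P \<rightarrow> S\<close>, with \<open>P\<close> a finite sum of
  generators, along the induced \<open>y\<close>; so it splits once \<open>y\<close> extends to
  \<open>P\<close>. The work lies in replacing \<open>k\<close> by the selected test monomorphism
  with the same image.\<close>

lemma perp_if_test_injective:
  assumes F: "test_injective F"
  shows "F \<in> perp1 C \<S>"
proof -
  have FO: "F \<in> Ob C" using F by (simp add: test_injective_def)
  have "Ext_zero C 1 S F" if S: "S \<in> \<S>" for S
  proof (subst Ext_zero_1_iff[OF S_Ob[OF S] FO], intro allI impI)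
    fix f g assume fg: "short_exact C f g \<and> Dom C f = F \<and> Cod C g = S"
    then have s: "short_exact C f g" "Dom C f = F" "Cod C g = S" by auto
    note sD = short_exactD[OF s(1)]
    have g: "g \<in> Hom C (Dom C g) S" and f: "f \<in> Hom C F (Dom C g)" using sD s by auto
    obtain P p where P: "P \<in> finite_sums" and p: "p \<in> Hom C P (Dom C g)" and gp: "epic C (g \<cdot> p)"
      using epic_cover[OF g sD(4) finitely_presented[OF S]] .
    have gpH: "g \<cdot> p \<in> Hom C P S" using g p by auto
    have PS: "P \<in> \<S>" using finite_sums_S[OF S] P by blast
    obtain k where k: "short_exact C k (g \<cdot> p)" using ex_short_exact_epic[OF gp] .
    note kD = short_exactD[OF k]
    define K where "K = Dom C k"
    have kH: "k \<in> Hom C K P" using kD gpH by (auto simp: K_def)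
    have KS: "K \<in> \<S>" unfolding K_def by (rule S_kernel[OF k]) (use gpH PS S in auto)
    have KO: "K \<in> Ob C" "Id C K \<in> Hom C K K" using S_Ob[OF KS] by auto
    \<comment> \<open>A second cover, now of the kernel \<open>K\<close>, exhibits \<open>k\<close>
      as the image of a morphism \<open>a\<close> between finite sums, as \<open>test_monos\<close>
      demands.\<close>
    obtain P' p' where P': "P' \<in> finite_sums" "p' \<in> Hom C P' K" "epic C (Id C K \<cdot> p')"
      using epic_cover[OF KO(2) epic_Id[OF KO(1)] finitely_presented[OF KS]] .
    have p'e: "epic C p'" using P'(2,3) by auto
    define a where "a = k \<cdot> p'"
    have aH: "a \<in> Hom C P' P" using kH P'(2) by (auto simp: a_def)
    have "is_cokernel C (g \<cdot> p) a"
    proof (rule is_cokernelI[OF gpH aH])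
      show "(g \<cdot> p) \<cdot> a = Zero C P' S"
        unfolding a_def using Comp_eq_right[OF kD(8), of p'] kH gpH P'(2) S_Ob[OF S] g p by auto
      show "epic C (g \<cdot> p)" by (rule gp)
      fix W t assume t: "t \<in> Hom C P W" "t \<cdot> a = Zero C P' W"
      have "(t \<cdot> k) \<cdot> p' = Zero C P' W" using t kH P'(2) unfolding a_def by auto
      then have "t \<cdot> k = Zero C K W"
        by (rule epicD0[OF p'e _ P'(2)]) (use t(1) kH in auto)
      then show "\<exists>h\<in>Hom C S W. h \<cdot> (g \<cdot> p) = t"
        using short_exact_desc[OF k, of t W] t(1) kH gpH by (metis Hom_iff)
    qed
    note cok = this
    have "presents a k"
      unfolding presents_def using cok kD(1) KS PS S kH gpH K_def by auto
    then have ex: "\<exists>k. presents a k" by blast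
    define k' where "k' = (SOME k. presents a k)"
    have k'M: "k' \<in> test_monos" unfolding test_monos_def k'_def using ex P P'(1) aH by blast
    have "presents a k'" unfolding k'_def by (rule someI_ex[OF ex])
    then obtain c where c: "is_cokernel C c a" "is_kernel C k' c" unfolding presents_def by blast
    note cD = is_cokernelD[OF c(1)] and k'D = is_kernelD[OF c(2)]
    have cH: "c \<in> Hom C P (Cod C c)" and k'H: "k' \<in> Hom C (Dom C k') P" using cD k'D aH by auto
    have CO: "Cod C c \<in> Ob C" "Dom C k' \<in> Ob C" using cD k'D by auto
    \<comment> \<open>\<open>k\<close> and \<open>k'\<close> are both kernels of cokernels of
      \<open>a\<close>, so they factor through each other by \<open>w\<close> and
      \<open>v\<close>.\<close>
    have "c \<cdot> k = Zero C K (Cod C c)"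
    proof (rule epicD0[OF p'e _ P'(2)])
      show "(c \<cdot> k) \<cdot> p' = Zero C P' (Cod C c)" using cD(4) aH cH kH P'(2) unfolding a_def by auto
    qed (use cH kH in auto)
    then obtain w where w: "w \<in> Hom C K (Dom C k')" "k' \<cdot> w = k"
      using is_kernel_lift[OF c(2) k'H cH kH] by blast
    obtain u where u: "u \<in> Hom C (Cod C c) S" "u \<cdot> c = g \<cdot> p"
      using is_cokernel_desc[OF c(1) cH aH gpH] is_cokernelD(4)[OF cok] aH gpH by auto
    have "(g \<cdot> p) \<cdot> k' = u \<cdot> (c \<cdot> k')" unfolding u(2)[symmetric] using u(1) cH k'H by auto
    also have "\<dots> = Zero C (Dom C k') S" using k'D(4) u(1) CO by auto
    finally obtain v where v: "v \<in> Hom C (Dom C k') K" "k \<cdot> v = k'"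
      using short_exact_lift[OF k, of k' "Dom C k'"] k'H gpH K_def by auto
    have "k \<cdot> (v \<cdot> w) = k \<cdot> Id C K" using Comp_eq_right[OF v(2), of w] v(1) w kH by auto
    then have vw: "v \<cdot> w = Id C K"
      by (rule monicD[OF kD(3) _ kH]) (use v(1) w(1) KO in auto)
    have "g \<cdot> (p \<cdot> k) = Zero C K S" using kD(8) kH g p by auto
    then obtain y where y: "y \<in> Hom C K F" "f \<cdot> y = p \<cdot> k"
      using short_exact_lift[OF s(1), of "p \<cdot> k" K] p kH s(2,3) by auto
    have "y \<cdot> v \<in> Hom C (Dom C k') F" using y(1) v(1) by auto
    then obtain b where b: "b \<in> Hom C (Cod C k') F" "b \<cdot> k' = y \<cdot> v"
      using F k'M unfolding test_injective_def by blast
    have bH: "b \<in> Hom C P F" using b(1) k'H by auto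
    have bk: "b \<cdot> k = y"
    proof -
      have "b \<cdot> k = (b \<cdot> k') \<cdot> w" unfolding w(2)[symmetric] using bH k'H w(1) by auto
      also have "\<dots> = y \<cdot> (v \<cdot> w)" unfolding b(2) using y(1) v(1) w(1) by auto
      also have "\<dots> = y" unfolding vw using y(1) by auto
      finally show ?thesis .
    qed
    have fb: "f \<cdot> b \<in> Hom C P (Dom C g)" using f bH by auto
    \<comment> \<open>\<open>p\<close> and \<open>f \<cdot> b\<close> agree on \<open>K\<close>, so
      their difference descends along \<open>g \<cdot> p\<close> to a morphism \<open>t\<close>;
      since \<open>g \<cdot> f\<close> is zero, \<open>t\<close> is a section of
      \<open>g\<close>.\<close>
    obtain d where d: "d \<in> Hom C P (Dom C g)" "p = f \<cdot> b \<oplus> d" using ex_diff[OF p fb] .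
    have "d \<cdot> k = Zero C K (Dom C g)"
    proof (rule Add_eq_self)
      have "p \<cdot> k \<oplus> d \<cdot> k = f \<cdot> (b \<cdot> k) \<oplus> d \<cdot> k" unfolding bk y(2) ..
      also have "\<dots> = (f \<cdot> b \<oplus> d) \<cdot> k" using f bH d(1) kH by auto
      finally show "p \<cdot> k \<oplus> d \<cdot> k = p \<cdot> k" unfolding d(2)[symmetric] .
    qed (use p d(1) kH in auto)
    then obtain t where t: "t \<in> Hom C S (Dom C g)" "t \<cdot> (g \<cdot> p) = d"
      using short_exact_desc[OF k, of d "Dom C g"] d(1) gpH K_def by auto
    have "(g \<cdot> t) \<cdot> (g \<cdot> p) = g \<cdot> d" unfolding t(2)[symmetric] using g t(1) p by auto
    also have "\<dots> = g \<cdot> (f \<cdot> b \<oplus> d)"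
      using Comp_eq_right[OF sD(8), of b] g f bH d(1) s by auto
    also have "\<dots> = Id C S \<cdot> (g \<cdot> p)" unfolding d(2)[symmetric] using gpH by auto
    finally have "g \<cdot> t = Id C S"
      by (rule epicD[OF gp _ gpH]) (use g t(1) S_Ob[OF S] in auto)
    then show "\<exists>s\<in>Hom C S (Dom C g). g \<cdot> s = Id C S" using t(1) by blast
  qed
  then show ?thesis unfolding perp1_def using FO by blast
qed

lemma test_injective_if_perp:
  assumes "F \<in> perp1 C \<S>"
  shows "test_injective F"
  unfolding test_injective_def
proof (intro conjI ballI)
  show "F \<in> Ob C" using assms by (simp add: perp1_def)
  fix k a assume k: "k \<in> test_monos" and a: "a \<in> Hom C (Dom C k) F"
  obtain c where c: "short_exact C k c" "Cod C c \<in> \<S>" using test_monosE[OF k] .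
  have "Ext_zero C 1 (Cod C c) F" using assms c(2) unfolding perp1_def by blast
  from Ext_zero_extend[OF this c(1) refl a] show "\<exists>b\<in>Hom C (Cod C k) F. b \<cdot> k = a"
    using short_exactD(7)[OF c(1)] by metis
qed

lemma perp_iff: "F \<in> perp1 C \<S> \<longleftrightarrow> test_injective F"
  using perp_if_test_injective test_injective_if_perp by blast

section \<open>Closure properties of the orthogonal class\<close>

lemma perp_retract:
  assumes "B \<in> perp1 C \<S>" "i \<in> Hom C A B" "p \<in> Hom C B A" "p \<cdot> i = Id C A"
  shows "A \<in> perp1 C \<S>"
  unfolding perp_iff test_injective_def
proof (intro conjI ballI)
  show "A \<in> Ob C" using assms(2) Ar_Ob(1)[of i] by auto
  fix k a assume k: "k \<in> test_monos" and a: "a \<in> Hom C (Dom C k) A"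
  have kA: "k \<in> Ar C" using test_monosE[OF k] by blast
  have "i \<cdot> a \<in> Hom C (Dom C k) B" using a assms(2) by auto
  then obtain b where b: "b \<in> Hom C (Cod C k) B" "b \<cdot> k = i \<cdot> a"
    using assms(1) k unfolding perp_iff test_injective_def by blast
  have "(p \<cdot> b) \<cdot> k = p \<cdot> (i \<cdot> a)" unfolding b(2)[symmetric] using b(1) assms(3) kA by auto
  also have "\<dots> = a" using Comp_eq_right[OF assms(4), of a] a assms(2,3) by auto
  finally show "\<exists>b\<in>Hom C (Cod C k) A. b \<cdot> k = a"
    using b(1) assms(3) by (intro bexI[of _ "p \<cdot> b"]) auto
qed

text \<open>The source of \<open>k\<close> is finitely presented, so \<open>a\<close> is a finite
  sum of its components; these are extended one by one, and the extensions add up.\<close>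

lemma perp_coproduct:
  assumes B: "is_coproduct C I X B \<iota>" and I: "small \<kappa> I" and X: "\<And>i. i \<in> I \<Longrightarrow> X i \<in> perp1 C \<S>"
  shows "B \<in> perp1 C \<S>"
  unfolding perp_iff test_injective_def
proof (intro conjI ballI)
  note BD = is_coproductD[OF B]
  show BO: "B \<in> Ob C" by (rule BD(1))
  fix k a assume k: "k \<in> test_monos" and a: "a \<in> Hom C (Dom C k) B"
  have kA: "k \<in> Ar C" and kS: "Dom C k \<in> \<S>" using test_monosE[OF k] by blast+
  obtain \<pi> where \<pi>: "coproduct_projections I X B \<iota> \<pi>" using ex_coproduct_projections[OF B] by blast
  show "\<exists>b\<in>Hom C (Cod C k) B. b \<cdot> k = a"
  proof (rule coproduct_finitely_presented_induct[OF B \<pi> I finitely_presented[OF kS] a])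
    show "\<exists>b\<in>Hom C (Cod C k) B. b \<cdot> k = Zero C (Dom C k) B"
      by (rule bexI[of _ "Zero C (Cod C k) B"]) (use kA BO in auto)
  next
    fix y z assume "\<exists>b\<in>Hom C (Cod C k) B. b \<cdot> k = y" "\<exists>b\<in>Hom C (Cod C k) B. b \<cdot> k = z"
    then obtain b b' where "b \<in> Hom C (Cod C k) B" "b \<cdot> k = y" "b' \<in> Hom C (Cod C k) B" "b' \<cdot> k = z"
      by blast
    then show "\<exists>b\<in>Hom C (Cod C k) B. b \<cdot> k = y \<oplus> z"
      by (intro bexI[of _ "b \<oplus> b'"]) (use kA in auto)
  next
    fix i assume i: "i \<in> I"
    have \<pi>i: "\<pi> i \<in> Hom C B (X i)" using \<pi> i unfolding coproduct_projections_def by blast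
    then have "\<pi> i \<cdot> a \<in> Hom C (Dom C k) (X i)" using a by auto
    then obtain b where b: "b \<in> Hom C (Cod C k) (X i)" "b \<cdot> k = \<pi> i \<cdot> a"
      using X[OF i] k unfolding perp_iff test_injective_def by blast
    then show "\<exists>b\<in>Hom C (Cod C k) B. b \<cdot> k = \<iota> i \<cdot> (\<pi> i \<cdot> a)"
      by (intro bexI[of _ "\<iota> i \<cdot> b"]) (use kA BD(3)[OF i] in auto)
  qed
qed

text \<open>Here the bound on the projective dimension enters: it removes the obstruction in degree
  two, with coefficients in the kernel of \<open>q\<close>, to passing from \<open>Dom C q\<close>
  to its quotient.\<close>

lemma perp_quotient:
  assumes "epic C q" "Dom C q \<in> perp1 C \<S>"
  shows "Cod C q \<in> perp1 C \<S>"
proof -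
  obtain k where k: "short_exact C k q" using ex_short_exact_epic[OF assms(1)] .
  note kD = short_exactD[OF k]
  have "Ext_zero C 1 S (Cod C q)" if S: "S \<in> \<S>" for S
  proof (rule Ext_zero_quotient[OF _ _ k S_Ob[OF S]])
    show "Ext_zero C 2 S (Dom C k)"
      using proj_dim[OF S] kD(5) unfolding proj_dim_le_def by (auto simp: numeral_2_eq_2)
    show "Ext_zero C 1 S (Dom C q)" using assms(2) S unfolding perp1_def by blast
  qed
  then show ?thesis unfolding perp1_def using kD(6) by auto
qed

lemma Gen_class_subset_perp:
  assumes "T \<in> perp1 C \<S>"
  shows "Gen_class C \<kappa> T \<subseteq> perp1 C \<S>"
proof
  fix Y assume "Y \<in> Gen_class C \<kappa> T"
  then obtain A f where A: "A \<in> Add_class C \<kappa> T" and f: "f \<in> Hom C A Y" "epic C f"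
    unfolding Gen_class_def by blast
  obtain I :: "'c set" and B \<iota> A' where B: "small \<kappa> I" "is_coproduct C I (\<lambda>_. T) B \<iota>" "is_biproduct C A A' B"
    using A unfolding Add_class_def direct_summand_def by blast
  have BP: "B \<in> perp1 C \<S>" using perp_coproduct[OF B(2,1)] assms by blast
  obtain i j p q where bp: "biproduct_maps A A' B i j p q" using is_biproductE[OF B(3)] .
  have "A \<in> perp1 C \<S>" using perp_retract[OF BP] biproduct_mapsD(1,3,5)[OF bp] by blast
  then show "Y \<in> perp1 C \<S>" using perp_quotient[OF f(2)] f(1) by auto
qed

end

section \<open>Sequential limits\<close>

context grothendieck_category
begin

text \<open>Start and length as arguments make the recursion primitive; the transition from stage
  \<open>m\<close> to stage \<open>n\<close> is \<open>seq_map X j m (n - m)\<close>.\<close>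

primrec seq_map :: "(nat \<Rightarrow> 'o) \<Rightarrow> (nat \<Rightarrow> 'm) \<Rightarrow> nat \<Rightarrow> nat \<Rightarrow> 'm" where
  "seq_map X j m 0 = Id C (X m)"
| "seq_map X j m (Suc r) = j (m + r) \<cdot> seq_map X j m r"

context
  fixes X :: "nat \<Rightarrow> 'o" and j :: "nat \<Rightarrow> 'm"
  assumes j: "\<And>n. j n \<in> Hom C (X n) (X (Suc n))"
begin

lemma seq_map_Hom: "seq_map X j m r \<in> Hom C (X m) (X (m + r))"
proof (induction r)
  case 0
  have "X m \<in> Ob C" using j[of m] Ar_Ob(1)[of "j m"] by auto
  then show ?case by simp
next
  case (Suc r)
  then show ?case using j[of "m + r"] by simp
qed

lemma seq_map_Comp: "seq_map X j (m + r) s \<cdot> seq_map X j m r = seq_map X j m (r + s)"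
proof (induction s)
  case 0
  show ?case using seq_map_Hom[of m r] by simp
next
  case (Suc s)
  then show ?case
    using seq_map_Hom[of m r] seq_map_Hom[of "m + r" s] j[of "m + r + s"]
    by (simp add: add.assoc)
qed

lemma monic_seq_map:
  assumes "\<And>n. monic C (j n)"
  shows "monic C (seq_map X j m r)"
proof (induction r)
  case 0
  show ?case using j[of m] Ar_Ob(1)[of "j m"] monic_Id by auto
next
  case (Suc r)
  then show ?case
    using monic_Comp[OF Suc assms] seq_map_Hom[of m r] j[of "m + r"] by simp
qed

text \<open>Compatibility with single steps propagates by induction on the number of steps, so the
  universal property of the limit can be used without composites of the \<open>j n\<close>.\<close>

lemma seq_cocone_iff:
  "cocone C UNIV {(m, n). m \<le> n} X (\<lambda>m n. seq_map X j m (n - m)) L l \<longleftrightarrow>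
    L \<in> Ob C \<and> (\<forall>n. l n \<in> Hom C (X n) L) \<and> (\<forall>n. l (Suc n) \<cdot> j n = l n)"
proof
  assume cc: "cocone C UNIV {(m, n). m \<le> n} X (\<lambda>m n. seq_map X j m (n - m)) L l"
  have "l (Suc n) \<cdot> j n = l n" for n
  proof -
    have "\<forall>m k. m \<le> k \<longrightarrow> l k \<cdot> seq_map X j m (k - m) = l m" using cc unfolding cocone_def by auto
    then have "l (Suc n) \<cdot> seq_map X j n (Suc n - n) = l n" by (meson le_SucI order_refl)
    moreover have "seq_map X j n (Suc n - n) = j n"
      using j[of n] by simp
    ultimately show ?thesis by metis
  qed
  then show "L \<in> Ob C \<and> (\<forall>n. l n \<in> Hom C (X n) L) \<and> (\<forall>n. l (Suc n) \<cdot> j n = l n)"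
    using cc unfolding cocone_def by blast
next
  assume l: "L \<in> Ob C \<and> (\<forall>n. l n \<in> Hom C (X n) L) \<and> (\<forall>n. l (Suc n) \<cdot> j n = l n)"
  have lH: "l n \<in> Hom C (X n) L" and lj: "l (Suc n) \<cdot> j n = l n" for n using l by blast+
  have "l (m + r) \<cdot> seq_map X j m r = l m" for m r
  proof (induction r)
    case 0
    show ?case using lH[of m] by simp
  next
    case (Suc r)
    then show ?case
      using Comp_eq_right[OF lj[of "m + r"], of "seq_map X j m r"] seq_map_Hom[of m r]
        j[of "m + r"] lH[of "Suc (m + r)"] by simp
  qed
  from this[of _ "_ - _"] have "l n \<cdot> seq_map X j m (n - m) = l m" if "m \<le> n" for m n
    using that by (metis le_add_diff_inverse)
  then show "cocone C UNIV {(m, n). m \<le> n} X (\<lambda>m n. seq_map X j m (n - m)) L l"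
    using l unfolding cocone_def by blast
qed

text \<open>The limit is the coequalizer of the identity and the shift of the coproduct.\<close>

lemma ex_seq_limit:
  "\<exists>L l. is_direct_limit C UNIV {(m, n). m \<le> n} X (\<lambda>m n. seq_map X j m (n - m)) L l"
proof -
  have XO: "X n \<in> Ob C" for n using j[of n] Ar_Ob(1)[of "j n"] by auto
  obtain B \<iota> where B: "is_coproduct C UNIV X B \<iota>"
    using ex_coproduct_any[OF small_nat, of UNIV X] XO by blast
  note BD = is_coproductD[OF B]
  have \<iota>H: "\<iota> n \<in> Hom C (X n) B" for n by (rule BD(3)) simp
  have "\<iota> (Suc n) \<cdot> j n \<in> Hom C (X n) B" for n using \<iota>H[of "Suc n"] j[of n] by auto
  then obtain \<sigma> where \<sigma>: "\<sigma> \<in> Hom C B B" "\<And>n. \<sigma> \<cdot> \<iota> n = \<iota> (Suc n) \<cdot> j n"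
    using coproduct_desc[OF B BD(1), of "\<lambda>n. \<iota> (Suc n) \<cdot> j n"] by auto
  \<comment> \<open>\<open>D\<close> is the difference of the identity and the shift
    \<open>\<sigma>\<close>, so its cokernel is their coequalizer.\<close>
  obtain D where D: "D \<in> Hom C B B" "Id C B = \<sigma> \<oplus> D"
    using ex_diff[of "Id C B" B B \<sigma>] \<sigma>(1) BD(1) by auto
  obtain q where q: "is_cokernel C q D" using ex_cokernel D(1) by auto
  note Q = is_cokernelD[OF q]
  define L where "L = Cod C q"
  have qH: "q \<in> Hom C B L" using Q D(1) by (auto simp: L_def)
  have LO: "L \<in> Ob C" using qH Ar_Ob(2)[of q] by auto
  have q\<sigma>: "q \<cdot> \<sigma> = q"
  proof -
    have "q = q \<cdot> (\<sigma> \<oplus> D)" unfolding D(2)[symmetric] using qH by auto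
    also have "\<dots> = q \<cdot> \<sigma> \<oplus> q \<cdot> D" using qH \<sigma>(1) D(1) by auto
    also have "\<dots> = q \<cdot> \<sigma>" using Q(4) qH \<sigma>(1) D(1) by auto
    finally show ?thesis by (rule sym)
  qed
  define l where "l n = q \<cdot> \<iota> n" for n
  have lH: "l n \<in> Hom C (X n) L" for n using qH \<iota>H[of n] by (auto simp: l_def)
  have lj: "l (Suc n) \<cdot> j n = l n" for n
  proof -
    have "l (Suc n) \<cdot> j n = q \<cdot> (\<sigma> \<cdot> \<iota> n)"
      unfolding \<sigma>(2) l_def using qH \<iota>H[of "Suc n"] j[of n] by auto
    also have "\<dots> = l n" unfolding l_def using Comp_eq_right[OF q\<sigma>, of "\<iota> n"] qH \<sigma>(1) \<iota>H[of n] by auto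
    finally show ?thesis .
  qed
  have cc: "cocone C UNIV {(m, n). m \<le> n} X (\<lambda>m n. seq_map X j m (n - m)) L l"
    using seq_cocone_iff LO lH lj by blast
  have ds: "direct_system C UNIV {(m, n). m \<le> n} X (\<lambda>m n. seq_map X j m (n - m))"
    unfolding direct_system_def
  proof (intro conjI ballI allI impI)
    show "directed_set (UNIV :: nat set) {(m, n). m \<le> n}"
      unfolding directed_set_def order_on_defs
    proof (intro conjI ballI)
      show "\<exists>k\<in>UNIV. (m, k) \<in> {(m, n). m \<le> n} \<and> (n, k) \<in> {(m, n). m \<le> n}" for m n :: nat
        by (intro bexI[of _ "max m n"]) auto
    qed (auto simp: refl_on_def intro: transI antisymI)
    show "X n \<in> Ob C" for n by (rule XO)
    show "seq_map X j n (n - n) = Id C (X n)" for n by simp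
    show "seq_map X j m (n - m) \<in> Hom C (X m) (X n)" if "(m, n) \<in> {(m, n). m \<le> n}" for m n
      using seq_map_Hom[of m "n - m"] that by simp
    fix m n k :: nat assume "(m, n) \<in> {(m, n). m \<le> n} \<and> (n, k) \<in> {(m, n). m \<le> n}"
    then show "seq_map X j n (k - n) \<cdot> seq_map X j m (n - m) = seq_map X j m (k - m)"
      using seq_map_Comp[of m "n - m" "k - n"] by simp
  qed
  have "is_direct_limit C UNIV {(m, n). m \<le> n} X (\<lambda>m n. seq_map X j m (n - m)) L l"
    unfolding is_direct_limit_def
  proof (intro conjI ds cc allI impI)
    fix L' l' assume "cocone C UNIV {(m, n). m \<le> n} X (\<lambda>m n. seq_map X j m (n - m)) L' l'"
    then have L': "L' \<in> Ob C" "\<And>n. l' n \<in> Hom C (X n) L'" "\<And>n. l' (Suc n) \<cdot> j n = l' n"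
      unfolding seq_cocone_iff by blast+
    obtain t where t: "t \<in> Hom C B L'" "\<And>n. t \<cdot> \<iota> n = l' n"
    proof (rule coproduct_desc[OF B L'(1)])
      show "l' n \<in> Hom C (X n) L'" for n by (rule L'(2))
    qed blast
    have t\<sigma>: "t \<cdot> \<sigma> = t"
    proof (rule coproduct_eqI[OF B _ t(1)])
      show "t \<cdot> \<sigma> \<in> Hom C B L'" using t(1) \<sigma>(1) by auto
      fix n
      have "(t \<cdot> \<sigma>) \<cdot> \<iota> n = t \<cdot> (\<iota> (Suc n) \<cdot> j n)"
        unfolding \<sigma>(2)[symmetric] using t(1) \<sigma>(1) \<iota>H[of n] by auto
      also have "\<dots> = t \<cdot> \<iota> n"
        using Comp_eq_right[OF t(2)[of "Suc n"], of "j n"] L'(3)[of n] t(2)[of n] \<iota>H[of "Suc n"] j[of n] t(1) by auto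
      finally show "(t \<cdot> \<sigma>) \<cdot> \<iota> n = t \<cdot> \<iota> n" .
    qed
    have "t \<cdot> D = Zero C B L'"
    proof (rule Add_eq_self)
      have "t \<oplus> t \<cdot> D = t \<cdot> (\<sigma> \<oplus> D)" using t\<sigma> t(1) \<sigma>(1) D(1) by auto
      then show "t \<oplus> t \<cdot> D = t" unfolding D(2)[symmetric] using t(1) by auto
    qed (use t(1) D(1) in auto)
    then obtain h where h: "h \<in> Hom C L L'" "h \<cdot> q = t"
      using is_cokernel_desc[OF q qH D(1) t(1)] by blast
    have hl: "h \<cdot> l n = l' n" for n
      unfolding l_def t(2)[symmetric] h(2)[symmetric] using h(1) qH \<iota>H[of n] by auto
    show "\<exists>!h. h \<in> Hom C L L' \<and> (\<forall>n\<in>UNIV. h \<cdot> l n = l' n)"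
    proof (rule ex1I[of _ h])
      show "h \<in> Hom C L L' \<and> (\<forall>n\<in>UNIV. h \<cdot> l n = l' n)" using h(1) hl by blast
      fix h' assume h': "h' \<in> Hom C L L' \<and> (\<forall>n\<in>UNIV. h' \<cdot> l n = l' n)"
      have "h' \<cdot> q = h \<cdot> q"
      proof (rule coproduct_eqI[OF B])
        show "h' \<cdot> q \<in> Hom C B L'" "h \<cdot> q \<in> Hom C B L'" using h' h(1) qH by auto
        fix n
        have "(h' \<cdot> q) \<cdot> \<iota> n = h' \<cdot> l n" "(h \<cdot> q) \<cdot> \<iota> n = h \<cdot> l n"
          unfolding l_def using h' h(1) qH \<iota>H[of n] by auto
        then show "(h' \<cdot> q) \<cdot> \<iota> n = (h \<cdot> q) \<cdot> \<iota> n" using h' hl by simp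
      qed
      then show "h' = h" using epicD[OF Q(5) _ qH] h' h(1) by blast
    qed
  qed
  then show ?thesis by blast
qed

end

end

section \<open>The small object argument\<close>

context resolving_class
begin

definition fibration :: "'b \<Rightarrow> bool" where
  "fibration g \<longleftrightarrow> g \<in> Ar C \<and> (\<forall>k\<in>test_monos. \<forall>a\<in>Hom C (Dom C k) (Dom C g). \<forall>b\<in>Hom C (Cod C k) (Cod C g).
     g \<cdot> a = b \<cdot> k \<longrightarrow> (\<exists>y\<in>Hom C (Cod C k) (Dom C g). y \<cdot> k = a \<and> g \<cdot> y = b))"

text \<open>For a monomorphism this replaces the statement that the cokernel has vanishing
  \<open>Ext\<close> into the orthogonal class, which would have to be carried through a
  filtration.\<close>

definition cofibration :: "'b \<Rightarrow> bool" where
  "cofibration j \<longleftrightarrow> j \<in> Ar C \<and> (\<forall>g. fibration g \<longrightarrow> (\<forall>a\<in>Hom C (Dom C j) (Dom C g). \<forall>b\<in>Hom C (Cod C j) (Cod C g).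
     g \<cdot> a = b \<cdot> j \<longrightarrow> (\<exists>y\<in>Hom C (Cod C j) (Dom C g). y \<cdot> j = a \<and> g \<cdot> y = b)))"

lemma fibrationD:
  assumes "fibration g" "k \<in> test_monos" "a \<in> Hom C (Dom C k) (Dom C g)" "b \<in> Hom C (Cod C k) (Cod C g)"
    "g \<cdot> a = b \<cdot> k"
  obtains y where "y \<in> Hom C (Cod C k) (Dom C g)" "y \<cdot> k = a" "g \<cdot> y = b"
  using assms unfolding fibration_def by blast

lemma cofibrationD:
  assumes "cofibration j" "fibration g" "a \<in> Hom C (Dom C j) (Dom C g)" "b \<in> Hom C (Cod C j) (Cod C g)"
    "g \<cdot> a = b \<cdot> j"
  obtains y where "y \<in> Hom C (Cod C j) (Dom C g)" "y \<cdot> j = a" "g \<cdot> y = b"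
  using assms unfolding cofibration_def by blast

text \<open>\<open>Cod C k\<close> lies in \<open>\<S>\<close>, so \<open>b\<close> lifts to some
  \<open>s\<close>. Then \<open>s \<cdot> k\<close> differs from \<open>a\<close> by a morphism into
  the kernel of \<open>g\<close>; that error extends along \<open>k\<close>, and the extension
  corrects \<open>s\<close>.\<close>

lemma fibrationI:
  assumes s: "short_exact C f g" and F: "Dom C f \<in> perp1 C \<S>"
  shows "fibration g"
  unfolding fibration_def
proof (intro conjI ballI impI)
  note sD = short_exactD[OF s]
  show "g \<in> Ar C" by (rule sD(6))
  fix k a b assume k: "k \<in> test_monos" and a: "a \<in> Hom C (Dom C k) (Dom C g)"
    and b: "b \<in> Hom C (Cod C k) (Cod C g)" and eq: "g \<cdot> a = b \<cdot> k"
  have kA: "k \<in> Ar C" and kS: "Cod C k \<in> \<S>" using test_monosE[OF k] by blast+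
  have "Ext_zero C 1 (Cod C k) (Dom C f)" using F kS unfolding perp1_def by blast
  then obtain s where s': "s \<in> Hom C (Cod C k) (Dom C g)" "g \<cdot> s = b"
    using Ext_zero_lift[OF _ s refl b] by blast
  have sk: "s \<cdot> k \<in> Hom C (Dom C k) (Dom C g)" using s'(1) kA by auto
  obtain d where d: "d \<in> Hom C (Dom C k) (Dom C g)" "a = s \<cdot> k \<oplus> d" using ex_diff[OF a sk] .
  have gsk: "g \<cdot> (s \<cdot> k) = b \<cdot> k" using Comp_eq_right[OF s'(2), of k] s'(1) kA sD(6) by auto
  have "g \<cdot> d = Zero C (Dom C k) (Cod C g)"
  proof (rule Add_eq_self)
    have "b \<cdot> k \<oplus> g \<cdot> d = g \<cdot> (s \<cdot> k \<oplus> d)" unfolding gsk[symmetric] using s'(1) kA sD(6) d(1) by auto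
    then show "b \<cdot> k \<oplus> g \<cdot> d = b \<cdot> k" unfolding d(2)[symmetric] eq .
  qed (use b kA d(1) sD(6) in auto)
  then obtain x where x: "x \<in> Hom C (Dom C k) (Dom C f)" "f \<cdot> x = d"
    using short_exact_lift[OF s d(1)] by blast
  obtain y where y: "y \<in> Hom C (Cod C k) (Dom C f)" "y \<cdot> k = x"
    using F k x(1) unfolding perp_iff test_injective_def by blast
  have fy: "f \<cdot> y \<in> Hom C (Cod C k) (Dom C g)" using y(1) sD(5,7) by auto
  have "(s \<oplus> f \<cdot> y) \<cdot> k = s \<cdot> k \<oplus> f \<cdot> (y \<cdot> k)" using s'(1) fy y(1) sD(5,7) kA by auto
  then have 1: "(s \<oplus> f \<cdot> y) \<cdot> k = a" unfolding y(2) x(2) d(2)[symmetric] .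
  have "g \<cdot> (s \<oplus> f \<cdot> y) = b \<oplus> g \<cdot> (f \<cdot> y)" using s' fy sD(6) by auto
  also have "g \<cdot> (f \<cdot> y) = Zero C (Cod C k) (Cod C g)"
    using Comp_eq_right[OF sD(8), of y] y(1) sD(5,6,7) by auto
  also have "b \<oplus> Zero C (Cod C k) (Cod C g) = b" using b by auto
  finally show "\<exists>y\<in>Hom C (Cod C k) (Dom C g). y \<cdot> k = a \<and> g \<cdot> y = b"
    using 1 s'(1) fy by (intro bexI[of _ "s \<oplus> f \<cdot> y"]) auto
qed

text \<open>The last condition concerns only morphisms into the source of \<open>j\<close>. Their
  extensions land one stage later, so injectivity itself appears only in the limit.\<close>

definition cell_attachment :: "'b \<Rightarrow> bool" where
  "cell_attachment j \<longleftrightarrow> monic C j \<and> cofibration j \<and>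
     (\<forall>k\<in>test_monos. \<forall>a\<in>Hom C (Dom C k) (Dom C j). \<exists>b\<in>Hom C (Cod C k) (Cod C j). b \<cdot> k = j \<cdot> a)"

text \<open>All problems \<open>(k, a)\<close> are solved at once: the coproduct of the
  \<open>k\<close> is pushed out along the morphism to \<open>X\<close> with components
  \<open>a\<close>. The index set is small because \<open>test_monos\<close> is and because the
  sources of the \<open>k\<close> are finitely presented.\<close>

lemma ex_cell_attachment:
  assumes X: "X \<in> Ob C"
  shows "\<exists>j. Dom C j = X \<and> cell_attachment j"
proof -
  let ?J = "Sigma test_monos (\<lambda>k. Hom C (Dom C k) X)"
  have kS: "Dom C k \<in> \<S>" "Cod C k \<in> \<S>" "k \<in> Ar C" "monic C k" if "k \<in> test_monos" for k
  proof -
    obtain c where "short_exact C k c" "Dom C k \<in> \<S>" "Cod C k \<in> \<S>" "k \<in> Ar C"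
      using test_monosE[OF \<open>k \<in> test_monos\<close>] by blast
    then show "Dom C k \<in> \<S>" "Cod C k \<in> \<S>" "k \<in> Ar C" "monic C k" using short_exactD(3) by auto
  qed
  have J: "small \<kappa> ?J"
    by (intro small_Sigma small_test_monos small_Hom[OF finitely_presented X] kS)
  have JD: "fst i \<in> test_monos" "fst i \<in> Ar C" "snd i \<in> Hom C (Dom C (fst i)) X" if "i \<in> ?J" for i
    using that kS by (auto simp del: Hom_iff)
  obtain A \<iota> where A: "is_coproduct C ?J (\<lambda>i. Dom C (fst i)) A \<iota>"
    using ex_coproduct_any[OF J, of "\<lambda>i. Dom C (fst i)"] JD by auto
  obtain B \<iota>' where B: "is_coproduct C ?J (\<lambda>i. Cod C (fst i)) B \<iota>'"
    using ex_coproduct_any[OF J, of "\<lambda>i. Cod C (fst i)"] JD by auto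
  note AD = is_coproductD[OF A] and BD = is_coproductD[OF B]
  have ik: "\<iota>' i \<cdot> fst i \<in> Hom C (Dom C (fst i)) B" if "i \<in> ?J" for i using BD(3)[OF that] JD[OF that] by auto
  obtain m where m: "m \<in> Hom C A B" "\<And>i. i \<in> ?J \<Longrightarrow> m \<cdot> \<iota> i = \<iota>' i \<cdot> fst i"
    using coproduct_desc[OF A BD(1), of "\<lambda>i. \<iota>' i \<cdot> fst i"] ik by blast
  obtain \<alpha> where \<alpha>: "\<alpha> \<in> Hom C A X" "\<And>i. i \<in> ?J \<Longrightarrow> \<alpha> \<cdot> \<iota> i = snd i"
    using coproduct_desc[OF A X, of snd] JD(3) by blast
  obtain \<pi> where \<pi>: "coproduct_projections ?J (\<lambda>i. Dom C (fst i)) A \<iota> \<pi>"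
    using ex_coproduct_projections[OF A] by blast
  obtain \<pi>' where \<pi>': "coproduct_projections ?J (\<lambda>i. Cod C (fst i)) B \<iota>' \<pi>'"
    using ex_coproduct_projections[OF B] by blast
  have \<pi>H: "\<pi> i \<in> Hom C A (Dom C (fst i))" "\<pi>' i \<in> Hom C B (Cod C (fst i))" if "i \<in> ?J" for i
    using \<pi> \<pi>' that unfolding coproduct_projections_def by blast+
  have \<pi>\<iota>: "\<pi> i \<cdot> \<iota> l = (if l = i then Id C (Dom C (fst i)) else Zero C (Dom C (fst l)) (Dom C (fst i)))"
    "\<pi>' i \<cdot> \<iota>' l = (if l = i then Id C (Cod C (fst i)) else Zero C (Cod C (fst l)) (Cod C (fst i)))"
    if "i \<in> ?J" "l \<in> ?J" for i l
    using \<pi> \<pi>' that unfolding coproduct_projections_def by blast+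
  have \<pi>m: "\<pi>' i \<cdot> m = fst i \<cdot> \<pi> i" if i: "i \<in> ?J" for i
  proof (rule coproduct_eqI[OF A])
    show "\<pi>' i \<cdot> m \<in> Hom C A (Cod C (fst i))" "fst i \<cdot> \<pi> i \<in> Hom C A (Cod C (fst i))"
      using \<pi>H[OF i] m(1) JD(2)[OF i] by auto
    fix l assume l: "l \<in> ?J"
    have "(\<pi>' i \<cdot> m) \<cdot> \<iota> l = (\<pi>' i \<cdot> \<iota>' l) \<cdot> fst l"
      using \<pi>H(2)[OF i] m(1) m(2)[OF l] AD(3)[OF l] BD(3)[OF l] JD(2)[OF l] by auto
    also have "\<dots> = fst i \<cdot> (\<pi> i \<cdot> \<iota> l)"
      unfolding \<pi>\<iota>[OF i l] using JD(2)[OF i] JD(2)[OF l] by auto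
    also have "\<dots> = (fst i \<cdot> \<pi> i) \<cdot> \<iota> l" using \<pi>H(1)[OF i] JD(2)[OF i] AD(3)[OF l] by auto
    finally show "(\<pi>' i \<cdot> m) \<cdot> \<iota> l = (fst i \<cdot> \<pi> i) \<cdot> \<iota> l" .
  qed
  \<comment> \<open>It is enough to test with generators. A morphism \<open>h\<close> from a
    generator to \<open>A\<close> is a finite sum of its components, and each component is killed by
    the monomorphism \<open>fst i\<close>, hence zero.\<close>
  have "monic C m"
  proof (rule separating_monicI[OF gens(3) m(1)])
    fix G h assume G: "G \<in> gens" and h: "h \<in> Hom C G A" "m \<cdot> h = Zero C G B"
    have GO: "G \<in> Ob C" using h(1) Ar_Ob(1)[of h] by auto
    have Gf: "finitely_presented C \<kappa> G" using G gens(1) finitely_presented by blast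
    show "h = Zero C G A"
    proof (rule coproduct_finitely_presented_induct[OF A \<pi> J Gf h(1)])
      fix i assume i: "i \<in> ?J"
      have "fst i \<cdot> (\<pi> i \<cdot> h) = \<pi>' i \<cdot> (m \<cdot> h)"
        using Comp_eq_right[OF \<pi>m[OF i], of h] \<pi>H[OF i] m(1) h(1) JD(2)[OF i] by auto
      also have "\<dots> = Zero C G (Cod C (fst i))" unfolding h(2) using \<pi>H(2)[OF i] GO by auto
      finally have "\<pi> i \<cdot> h = Zero C G (Dom C (fst i))"
        by (rule monicD0[OF kS(4)[OF JD(1)[OF i]]]) (use \<pi>H(1)[OF i] h(1) JD(2)[OF i] in auto)
      then show "\<iota> i \<cdot> (\<pi> i \<cdot> h) = Zero C G A" using AD(3)[OF i] GO by simp
    qed (use GO AD(1) in auto)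
  qed
  then obtain c where c: "short_exact C m c" using ex_short_exact_monic by blast
  note cD = short_exactD[OF c]
  have DC: "Dom C m = A" "Dom C c = B" using m(1) cD(7) by auto
  have \<alpha>': "\<alpha> \<in> Hom C (Dom C m) X" using \<alpha>(1) DC by simp
  show ?thesis
  proof (rule pushout_short_exact[OF c \<alpha>', unfolded DC])
    fix E' j g' h'
    assume s: "short_exact C j g'" and j: "j \<in> Hom C X E'" and h': "h' \<in> Hom C B E'"
      and sq: "h' \<cdot> m = j \<cdot> \<alpha>"
      and univ: "\<And>W a b. a \<in> Hom C B W \<Longrightarrow> b \<in> Hom C X W \<Longrightarrow> a \<cdot> m = b \<cdot> \<alpha> \<Longrightarrow>
        \<exists>y\<in>Hom C E' W. y \<cdot> h' = a \<and> y \<cdot> j = b"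
      and epi: "\<And>W y y'. y \<in> Hom C E' W \<Longrightarrow> y' \<in> Hom C E' W \<Longrightarrow> y \<cdot> h' = y' \<cdot> h' \<Longrightarrow>
        y \<cdot> j = y' \<cdot> j \<Longrightarrow> y = y'"
    have ja: "j \<cdot> snd i = h' \<cdot> (\<iota>' i \<cdot> fst i)" if i: "i \<in> ?J" for i
    proof -
      have "j \<cdot> snd i = (j \<cdot> \<alpha>) \<cdot> \<iota> i" using \<alpha>(1) \<alpha>(2)[OF i] j AD(3)[OF i] by auto
      also have "\<dots> = h' \<cdot> (m \<cdot> \<iota> i)" unfolding sq[symmetric] using h' m(1) AD(3)[OF i] by auto
      finally show ?thesis unfolding m(2)[OF i] .
    qed
    have "cofibration j"
      unfolding cofibration_def
    proof (intro conjI allI impI ballI)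
      show "j \<in> Ar C" using j by simp
      fix g a b assume g: "fibration g" and a': "a \<in> Hom C (Dom C j) (Dom C g)"
        and b': "b \<in> Hom C (Cod C j) (Cod C g)" and eq: "g \<cdot> a = b \<cdot> j"
      have gA: "g \<in> Ar C" using g by (simp add: fibration_def)
      have a: "a \<in> Hom C X (Dom C g)" and b: "b \<in> Hom C E' (Cod C g)" using a' b' j by auto
      \<comment> \<open>On each summand of \<open>B\<close> the lifting problem is one against a
        test monomorphism; the solutions are glued over the coproduct and then over the
        pushout.\<close>
      have "\<forall>i\<in>?J. \<exists>y. y \<in> Hom C (Cod C (fst i)) (Dom C g) \<and> y \<cdot> fst i = a \<cdot> snd i \<and> g \<cdot> y = b \<cdot> (h' \<cdot> \<iota>' i)"
      proof
        fix i assume i: "i \<in> ?J"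
        have "g \<cdot> (a \<cdot> snd i) = b \<cdot> (j \<cdot> snd i)"
          using Comp_eq_right[OF eq, of "snd i"] a b gA j JD(3)[OF i] by auto
        also have "\<dots> = (b \<cdot> (h' \<cdot> \<iota>' i)) \<cdot> fst i"
          unfolding ja[OF i] using b h' BD(3)[OF i] JD(2)[OF i] by auto
        finally have "g \<cdot> (a \<cdot> snd i) = (b \<cdot> (h' \<cdot> \<iota>' i)) \<cdot> fst i" .
        moreover have "a \<cdot> snd i \<in> Hom C (Dom C (fst i)) (Dom C g)" using a JD(3)[OF i] by auto
        moreover have "b \<cdot> (h' \<cdot> \<iota>' i) \<in> Hom C (Cod C (fst i)) (Cod C g)" using b h' BD(3)[OF i] by auto
        ultimately obtain y where "y \<in> Hom C (Cod C (fst i)) (Dom C g)" "y \<cdot> fst i = a \<cdot> snd i"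
          "g \<cdot> y = b \<cdot> (h' \<cdot> \<iota>' i)"
          using fibrationD[OF g JD(1)[OF i]] by blast
        then show "\<exists>y. y \<in> Hom C (Cod C (fst i)) (Dom C g) \<and> y \<cdot> fst i = a \<cdot> snd i \<and> g \<cdot> y = b \<cdot> (h' \<cdot> \<iota>' i)"
          by blast
      qed
      from bchoice[OF this] obtain Y where Y: "\<And>i. i \<in> ?J \<Longrightarrow> Y i \<in> Hom C (Cod C (fst i)) (Dom C g) \<and>
          Y i \<cdot> fst i = a \<cdot> snd i \<and> g \<cdot> Y i = b \<cdot> (h' \<cdot> \<iota>' i)"
        by blast
      have GO: "Dom C g \<in> Ob C" using gA by simp
      obtain y where y: "y \<in> Hom C B (Dom C g)" "\<And>i. i \<in> ?J \<Longrightarrow> y \<cdot> \<iota>' i = Y i"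
        using coproduct_desc[OF B GO, of Y] Y by blast
      have "y \<cdot> m = a \<cdot> \<alpha>"
      proof (rule coproduct_eqI[OF A])
        show "y \<cdot> m \<in> Hom C A (Dom C g)" "a \<cdot> \<alpha> \<in> Hom C A (Dom C g)" using y(1) m(1) a \<alpha>(1) by auto
        fix i assume i: "i \<in> ?J"
        have "(y \<cdot> m) \<cdot> \<iota> i = y \<cdot> (\<iota>' i \<cdot> fst i)" using y(1) m(1) m(2)[OF i] AD(3)[OF i] by auto
        also have "\<dots> = Y i \<cdot> fst i"
          using Comp_eq_right[OF y(2)[OF i], of "fst i"] y(1) BD(3)[OF i] JD(2)[OF i] by auto
        also have "\<dots> = a \<cdot> snd i" using Y[OF i] by blast
        also have "\<dots> = (a \<cdot> \<alpha>) \<cdot> \<iota> i" using a \<alpha>(1) \<alpha>(2)[OF i] AD(3)[OF i] by auto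
        finally show "(y \<cdot> m) \<cdot> \<iota> i = (a \<cdot> \<alpha>) \<cdot> \<iota> i" .
      qed
      then obtain u where u: "u \<in> Hom C E' (Dom C g)" "u \<cdot> h' = y" "u \<cdot> j = a"
        using univ[OF y(1) a] by blast
      have "g \<cdot> u = b"
      proof (rule epi)
        show "g \<cdot> u \<in> Hom C E' (Cod C g)" "b \<in> Hom C E' (Cod C g)" using u(1) gA b by auto
        show "(g \<cdot> u) \<cdot> j = b \<cdot> j" using u j gA eq by auto
        have "g \<cdot> y = b \<cdot> h'"
        proof (rule coproduct_eqI[OF B])
          show "g \<cdot> y \<in> Hom C B (Cod C g)" "b \<cdot> h' \<in> Hom C B (Cod C g)" using y(1) gA b h' by auto
          fix i assume i: "i \<in> ?J"
          show "(g \<cdot> y) \<cdot> \<iota>' i = (b \<cdot> h') \<cdot> \<iota>' i"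
            using y(1) y(2)[OF i] Y[OF i] gA b h' BD(3)[OF i] by auto
        qed
        then show "(g \<cdot> u) \<cdot> h' = b \<cdot> h'" using u(1,2) h' gA by auto
      qed
      then show "\<exists>y\<in>Hom C (Cod C j) (Dom C g). y \<cdot> j = a \<and> g \<cdot> y = b" using u j by auto
    qed
    moreover have "\<exists>b\<in>Hom C (Cod C k) (Cod C j). b \<cdot> k = j \<cdot> a"
      if k: "k \<in> test_monos" and a: "a \<in> Hom C (Dom C k) (Dom C j)" for k a
    proof -
      have i: "(k, a) \<in> ?J" using k a j by auto
      have "(h' \<cdot> \<iota>' (k, a)) \<cdot> k = j \<cdot> a" using ja[OF i] h' BD(3)[OF i] kS(3)[OF k] by auto
      moreover have "h' \<cdot> \<iota>' (k, a) \<in> Hom C (Cod C k) (Cod C j)" using h' BD(3)[OF i] j by auto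
      ultimately show ?thesis by blast
    qed
    ultimately have "cell_attachment j"
      unfolding cell_attachment_def using short_exactD(3)[OF s] by blast
    then show "\<exists>j. Dom C j = X \<and> cell_attachment j" using j by auto
  qed
qed

section \<open>The tower of cell attachments and its limit\<close>

definition cell :: "'a \<Rightarrow> 'b" where
  "cell X = (SOME j. Dom C j = X \<and> cell_attachment j)"

primrec tower :: "'a \<Rightarrow> nat \<Rightarrow> 'a" where
  "tower X 0 = X"
| "tower X (Suc n) = Cod C (cell (tower X n))"

lemma tower_cell:
  assumes "X \<in> Ob C"
  shows "cell (tower X n) \<in> Hom C (tower X n) (tower X (Suc n))" "cell_attachment (cell (tower X n))"
proof -
  have cell: "Dom C (cell Y) = Y" "cell_attachment (cell Y)" "cell Y \<in> Ar C" if "Y \<in> Ob C" for Y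
  proof -
    show *: "Dom C (cell Y) = Y" "cell_attachment (cell Y)"
      using someI_ex[OF ex_cell_attachment[OF that]] unfolding cell_def by blast+
    then show "cell Y \<in> Ar C" by (simp add: cell_attachment_def monic_def)
  qed
  have "tower X n \<in> Ob C" by (induction n) (use assms cell(3) in auto)
  then show "cell (tower X n) \<in> Hom C (tower X n) (tower X (Suc n))" "cell_attachment (cell (tower X n))"
    using cell by auto
qed

lemma ex_cofibration_to_perp:
  assumes X: "X \<in> Ob C"
  obtains j where "Dom C j = X" "monic C j" "cofibration j" "Cod C j \<in> perp1 C \<S>"
proof -
  let ?X = "tower X" and ?j = "\<lambda>n. cell (tower X n)"
  note jH = tower_cell(1)[OF X] and jc = tower_cell(2)[OF X]
  have jm: "monic C (?j n)" for n using jc[of n] by (simp add: cell_attachment_def)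
  obtain L l where L: "is_direct_limit C UNIV {(m, n). m \<le> n} ?X (\<lambda>m n. seq_map ?X ?j m (n - m)) L l"
    using ex_seq_limit[of ?j ?X, OF jH] by blast
  have LO: "L \<in> Ob C" and lH: "l n \<in> Hom C (?X n) L" and lj: "l (Suc n) \<cdot> ?j n = l n" for n
    using L seq_cocone_iff[where j = ?j and X = ?X, OF jH] unfolding is_direct_limit_def by blast+
  have lim: "\<exists>!h. h \<in> Hom C L L' \<and> (\<forall>n\<in>UNIV. h \<cdot> l n = l' n)"
    if "L' \<in> Ob C" "\<And>n. l' n \<in> Hom C (?X n) L'" "\<And>n. l' (Suc n) \<cdot> ?j n = l' n" for L' l'
    using L seq_cocone_iff[where j = ?j and X = ?X, OF jH, of L' l'] that unfolding is_direct_limit_def by blast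
  have l0: "l 0 \<in> Hom C X L" using lH[of 0] by simp
  \<comment> \<open>A morphism from a generator to \<open>X\<close> that dies in the limit dies at a
    finite stage, and the map from \<open>X\<close> to that stage is monic.\<close>
  have "monic C (l 0)"
  proof (rule separating_monicI[OF gens(3) l0])
    fix G h assume G: "G \<in> gens" and h: "h \<in> Hom C G X" "l 0 \<cdot> h = Zero C G L"
    have GO: "G \<in> Ob C" using h(1) Ar_Ob(1)[of h] by auto
    have Gf: "finitely_presented C \<kappa> G" using G gens(1) finitely_presented by blast
    have "l 0 \<cdot> h = l 0 \<cdot> Zero C G X" unfolding h(2) using l0 GO by auto
    then have "\<exists>k\<in>UNIV. (0, k) \<in> {(m, n). m \<le> n} \<and>
        seq_map ?X ?j 0 (k - 0) \<cdot> h = seq_map ?X ?j 0 (k - 0) \<cdot> Zero C G X"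
      by (intro finitely_presented_eq[OF Gf small_nat L UNIV_I]) (use h(1) GO X in auto)
    then obtain k where k: "seq_map ?X ?j 0 k \<cdot> h = seq_map ?X ?j 0 k \<cdot> Zero C G X" by auto
    have kH: "seq_map ?X ?j 0 k \<in> Hom C X (?X k)"
      using seq_map_Hom[where j = ?j and X = ?X, OF jH, of 0 k] by simp
    show "h = Zero C G X"
      by (rule monicD[OF monic_seq_map[where j = ?j and X = ?X, OF jH jm] k kH h(1)]) (use GO X in auto)
  qed
  moreover have "L \<in> perp1 C \<S>"
    unfolding perp_iff test_injective_def
  proof (intro conjI LO ballI)
    fix k a assume k: "k \<in> test_monos" and a: "a \<in> Hom C (Dom C k) L"
    have kA: "k \<in> Ar C" and kS: "Dom C k \<in> \<S>" using test_monosE[OF k] by blast+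
    \<comment> \<open>Finite presentation of \<open>Dom C k\<close> puts \<open>a\<close> on some
      stage \<open>n\<close>; the extension then exists on stage \<open>n + 1\<close>.\<close>
    obtain n g where g: "g \<in> Hom C (Dom C k) (?X n)" "a = l n \<cdot> g"
      using finitely_presented_factor[OF finitely_presented[OF kS] small_nat L a] by blast
    have "g \<in> Hom C (Dom C k) (Dom C (?j n))" using g(1) jH[of n] by auto
    then obtain b where b: "b \<in> Hom C (Cod C k) (Cod C (?j n))" "b \<cdot> k = ?j n \<cdot> g"
      using jc[of n] k unfolding cell_attachment_def by blast
    have bH: "b \<in> Hom C (Cod C k) (?X (Suc n))" using b(1) by simp
    have "(l (Suc n) \<cdot> b) \<cdot> k = l (Suc n) \<cdot> (?j n \<cdot> g)"
      unfolding b(2)[symmetric] using bH kA lH[of "Suc n"] by auto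
    also have "\<dots> = a" unfolding g(2) using Comp_eq_right[OF lj[of n], of g] g(1) jH[of n] lH[of "Suc n"] by auto
    finally show "\<exists>b\<in>Hom C (Cod C k) L. b \<cdot> k = a"
      using bH lH[of "Suc n"] by (intro bexI[of _ "l (Suc n) \<cdot> b"]) auto
  qed
  moreover have "cofibration (l 0)"
    unfolding cofibration_def
  proof (intro conjI allI impI ballI)
    show "l 0 \<in> Ar C" using l0 by simp
    fix g a b assume g: "fibration g" and a': "a \<in> Hom C (Dom C (l 0)) (Dom C g)"
      and b': "b \<in> Hom C (Cod C (l 0)) (Cod C g)" and eq: "g \<cdot> a = b \<cdot> l 0"
    have gA: "g \<in> Ar C" using g by (simp add: fibration_def)
    have a: "a \<in> Hom C X (Dom C g)" and b: "b \<in> Hom C L (Cod C g)" using a' b' l0 by auto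
    \<comment> \<open>The clause for \<open>n = 0\<close> pins the start of the sequence to
      \<open>a\<close>; \<open>dependent_nat_choice\<close> would otherwise supply just some lift on
      stage 0.\<close>
    define P where "P n y \<longleftrightarrow> y \<in> Hom C (?X n) (Dom C g) \<and> g \<cdot> y = b \<cdot> l n \<and> (n = 0 \<longrightarrow> y = a)" for n y
    have "\<exists>y. \<forall>n. P n (y n) \<and> y (Suc n) \<cdot> ?j n = y n"
    proof (rule dependent_nat_choice)
      show "\<exists>y. P 0 y" using a eq unfolding P_def by auto
      fix y n assume y: "P n y"
      have yH: "y \<in> Hom C (Dom C (?j n)) (Dom C g)" using y jH[of n] unfolding P_def by auto
      have bH: "b \<cdot> l (Suc n) \<in> Hom C (Cod C (?j n)) (Cod C g)" using b lH[of "Suc n"] by auto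
      have "(b \<cdot> l (Suc n)) \<cdot> ?j n = b \<cdot> (l (Suc n) \<cdot> ?j n)" using b lH[of "Suc n"] jH[of n] by auto
      then have sq: "g \<cdot> y = (b \<cdot> l (Suc n)) \<cdot> ?j n" using y unfolding lj P_def by simp
      have "cofibration (?j n)" using jc[of n] by (simp add: cell_attachment_def)
      from cofibrationD[OF this g yH bH sq] obtain y' where
        "y' \<in> Hom C (Cod C (?j n)) (Dom C g)" "y' \<cdot> ?j n = y" "g \<cdot> y' = b \<cdot> l (Suc n)" .
      then show "\<exists>y'. P (Suc n) y' \<and> y' \<cdot> ?j n = y" unfolding P_def by auto
    qed
    then obtain y where y: "\<And>n. P n (y n)" "\<And>n. y (Suc n) \<cdot> ?j n = y n" by blast
    have GO: "Dom C g \<in> Ob C" using gA by simp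
    have yH: "y n \<in> Hom C (?X n) (Dom C g)" and gy: "g \<cdot> y n = b \<cdot> l n" for n
      using y(1)[of n] unfolding P_def by blast+
    obtain h where h: "h \<in> Hom C L (Dom C g)" "\<And>n. h \<cdot> l n = y n"
      using lim[OF GO yH y(2)] by blast
    have bl: "(b \<cdot> l (Suc n)) \<cdot> ?j n = b \<cdot> l n" for n
    proof -
      have "(b \<cdot> l (Suc n)) \<cdot> ?j n = b \<cdot> (l (Suc n) \<cdot> ?j n)" using b lH[of "Suc n"] jH[of n] by auto
      then show ?thesis unfolding lj .
    qed
    have GC: "Cod C g \<in> Ob C" using gA by simp
    have blH: "b \<cdot> l n \<in> Hom C (?X n) (Cod C g)" for n using b lH[of n] by auto
    have "g \<cdot> h \<in> Hom C L (Cod C g) \<and> (\<forall>n\<in>UNIV. (g \<cdot> h) \<cdot> l n = b \<cdot> l n)"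
      using h gA gy lH by auto
    moreover have "b \<in> Hom C L (Cod C g) \<and> (\<forall>n\<in>UNIV. b \<cdot> l n = b \<cdot> l n)" using b by blast
    ultimately have "g \<cdot> h = b" using lim[OF GC blH bl] by blast
    moreover have "h \<cdot> l 0 = a" using h(2)[of 0] y(1)[of 0] unfolding P_def by simp
    ultimately show "\<exists>y\<in>Hom C (Cod C (l 0)) (Dom C g). y \<cdot> l 0 = a \<and> g \<cdot> y = b"
      using h(1) l0 by (intro bexI[of _ h]) auto
  qed
  ultimately show ?thesis using that[of "l 0"] l0 by auto
qed

lemma perp_biproduct:
  assumes "X \<in> perp1 C \<S>" "Y \<in> perp1 C \<S>" "is_biproduct C X Y B"
  shows "B \<in> perp1 C \<S>"
  unfolding perp_iff test_injective_def
proof (intro conjI ballI)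
  obtain i j p q where bp: "biproduct_maps X Y B i j p q" and BO: "B \<in> Ob C"
    using is_biproductE[OF assms(3)] .
  note ijpq = biproduct_mapsD[OF bp]
  show "B \<in> Ob C" by (rule BO)
  fix k a assume k: "k \<in> test_monos" and a: "a \<in> Hom C (Dom C k) B"
  have kA: "k \<in> Ar C" using test_monosE[OF k] by blast
  have "p \<cdot> a \<in> Hom C (Dom C k) X" "q \<cdot> a \<in> Hom C (Dom C k) Y" using a ijpq(3,4) by auto
  then obtain b b' where b: "b \<in> Hom C (Cod C k) X" "b \<cdot> k = p \<cdot> a" "b' \<in> Hom C (Cod C k) Y" "b' \<cdot> k = q \<cdot> a"
    using assms(1,2) k unfolding perp_iff test_injective_def by blast
  obtain h where h: "h \<in> Hom C (Cod C k) B" "p \<cdot> h = b" "q \<cdot> h = b'"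
    using biproduct_pair[OF bp b(1,3)] .
  have "h \<cdot> k = a"
  proof (rule biproduct_arrow_eqI'[OF bp _ a])
    show "h \<cdot> k \<in> Hom C (Dom C k) B" using h(1) kA by auto
    show "p \<cdot> (h \<cdot> k) = p \<cdot> a" "q \<cdot> (h \<cdot> k) = q \<cdot> a"
      using Comp_eq_right[OF h(2), of k] Comp_eq_right[OF h(3), of k] h(1) b kA ijpq(3,4) by auto
  qed
  then show "\<exists>b\<in>Hom C (Cod C k) B. b \<cdot> k = a" using h(1) by blast
qed

section \<open>The tilting object\<close>

theorem ex_tilting: "\<exists>T. tilting C \<kappa> T \<and> perp1 C {T} = perp1 C \<S>"
proof -
  have gensO: "G \<in> Ob C" if "G \<in> gens" for G using that gens(1) S_Ob by blast
  obtain X \<iota> where X: "is_coproduct C gens (\<lambda>G. G) X \<iota>"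
    using ex_coproduct_any[OF gens(2), of "\<lambda>G. G"] gensO by blast
  note XD = is_coproductD[OF X]
  obtain j where j: "Dom C j = X" "monic C j" "cofibration j" "Cod C j \<in> perp1 C \<S>"
    using ex_cofibration_to_perp[OF XD(1)] .
  obtain c where c: "short_exact C j c" using ex_short_exact_monic[OF j(2)] .
  note cD = short_exactD[OF c]
  define T\<^sub>0 where "T\<^sub>0 = Cod C j"
  define T\<^sub>1 where "T\<^sub>1 = Cod C c"
  have jH: "j \<in> Hom C X T\<^sub>0" and cH: "c \<in> Hom C T\<^sub>0 T\<^sub>1" using cD j(1) by (auto simp: T\<^sub>0_def T\<^sub>1_def)
  have T0P: "T\<^sub>0 \<in> perp1 C \<S>" using j(4) by (simp add: T\<^sub>0_def)
  have T1P: "T\<^sub>1 \<in> perp1 C \<S>" using perp_quotient[OF cD(4)] cD(7) j(4) by (simp add: T\<^sub>1_def)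
  have TO: "T\<^sub>0 \<in> Ob C" "T\<^sub>1 \<in> Ob C" using cH Ar_Ob[of c] by auto
  obtain T where T: "is_biproduct C T\<^sub>0 T\<^sub>1 T" using ex_biproduct[OF TO] by blast
  obtain i i' p p' where bp: "biproduct_maps T\<^sub>0 T\<^sub>1 T i i' p p'" and TO': "T \<in> Ob C"
    using is_biproductE[OF T] .
  note ip = biproduct_mapsD[OF bp] TO'
  have 1: "Gen_class C \<kappa> T \<subseteq> perp1 C \<S>"
    by (rule Gen_class_subset_perp[OF perp_biproduct[OF T0P T1P T]])
  have 2: "perp1 C \<S> \<subseteq> perp1 C {T}"
  proof
    fix F assume F: "F \<in> perp1 C \<S>"
    have FO: "F \<in> Ob C" using F by (simp add: perp1_def)
    have "Ext_zero C 1 T F"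
    proof (subst Ext_zero_1_iff[OF ip(10) FO], intro allI impI)
      fix f g assume fg: "short_exact C f g \<and> Dom C f = F \<and> Cod C g = T"
      then have s: "short_exact C f g" "Dom C f = F" "Cod C g = T" by auto
      note sD = short_exactD[OF s(1)]
      have g: "g \<in> Hom C (Dom C g) T" using sD(6) s(3) by auto
      have GO: "Dom C g \<in> Ob C" using g by auto
      have fib: "fibration g" using fibrationI[OF s(1)] s(2) F by simp
      \<comment> \<open>On \<open>X\<close> a lift exists because \<open>X\<close> is a coproduct of
        objects of \<open>\<S>\<close>, each with vanishing \<open>Ext\<close> into
        \<open>F\<close>. The cofibration \<open>j\<close> then prolongs it to
        \<open>T\<^sub>0\<close>.\<close>
      have "\<exists>y\<in>Hom C X (Dom C g). g \<cdot> y = i \<cdot> j"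
      proof -
        have "\<exists>y. y \<in> Hom C G (Dom C g) \<and> g \<cdot> y = i \<cdot> (j \<cdot> \<iota> G)" if G: "G \<in> gens" for G
        proof -
          have "Ext_zero C 1 G F" using F G gens(1) unfolding perp1_def by blast
          moreover have "i \<cdot> (j \<cdot> \<iota> G) \<in> Hom C G (Cod C g)" using ip(1) jH XD(3)[OF G] s(3) by auto
          ultimately show ?thesis using Ext_zero_lift[OF _ s(1,2)] by metis
        qed
        then obtain Y where Y: "\<And>G. G \<in> gens \<Longrightarrow> Y G \<in> Hom C G (Dom C g) \<and> g \<cdot> Y G = i \<cdot> (j \<cdot> \<iota> G)"
          by metis
        obtain y where y: "y \<in> Hom C X (Dom C g)" "\<And>G. G \<in> gens \<Longrightarrow> y \<cdot> \<iota> G = Y G"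
          using coproduct_desc[OF X GO, of Y] Y by blast
        have "g \<cdot> y = i \<cdot> j"
        proof (rule coproduct_eqI[OF X])
          show "g \<cdot> y \<in> Hom C X T" "i \<cdot> j \<in> Hom C X T" using g y(1) ip(1) jH by auto
          show "(g \<cdot> y) \<cdot> \<iota> G = (i \<cdot> j) \<cdot> \<iota> G" if "G \<in> gens" for G
            using g y(1) y(2)[OF that] Y[OF that] ip(1) jH XD(3)[OF that] by auto
        qed
        then show ?thesis using y(1) by blast
      qed
      then obtain y where y: "y \<in> Hom C X (Dom C g)" "g \<cdot> y = i \<cdot> j" by blast
      obtain s\<^sub>0 where s0: "s\<^sub>0 \<in> Hom C T\<^sub>0 (Dom C g)" "g \<cdot> s\<^sub>0 = i"
      proof (rule cofibrationD[OF j(3) fib _ _ y(2)])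
        show "y \<in> Hom C (Dom C j) (Dom C g)" using y(1) j(1) by simp
        show "i \<in> Hom C (Cod C j) (Cod C g)" using ip(1) s(3) T\<^sub>0_def by simp
      qed (simp add: T\<^sub>0_def)
      \<comment> \<open>For \<open>T\<^sub>1\<close> the prescribed lift on \<open>X\<close> is
        zero, which is compatible because \<open>c \<cdot> j\<close> vanishes. The resulting
        \<open>t\<close> kills \<open>j\<close> and so descends to \<open>T\<^sub>1\<close>.\<close>
      have jc: "c \<cdot> j = Zero C X T\<^sub>1" using cD(8) j(1) by (simp add: T\<^sub>1_def)
      have z: "g \<cdot> Zero C X (Dom C g) = (i' \<cdot> c) \<cdot> j" using g ip(2,10) cH jH jc XD(1) by auto
      obtain t where t: "t \<in> Hom C T\<^sub>0 (Dom C g)" "t \<cdot> j = Zero C X (Dom C g)" "g \<cdot> t = i' \<cdot> c"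
      proof (rule cofibrationD[OF j(3) fib _ _ z])
        show "Zero C X (Dom C g) \<in> Hom C (Dom C j) (Dom C g)" using XD(1) GO j(1) by simp
        show "i' \<cdot> c \<in> Hom C (Cod C j) (Cod C g)" using ip(2) cH s(3) T\<^sub>0_def by simp
      qed (simp add: T\<^sub>0_def)
      obtain s\<^sub>1 where s1: "s\<^sub>1 \<in> Hom C T\<^sub>1 (Dom C g)" "s\<^sub>1 \<cdot> c = t"
        using short_exact_desc[OF c, of t "Dom C g"] t(1,2) j(1) cH T\<^sub>1_def by auto
      have "(g \<cdot> s\<^sub>1) \<cdot> c = i' \<cdot> c" unfolding t(3)[symmetric] s1(2)[symmetric] using g s1(1) cH by auto
      then have gs1: "g \<cdot> s\<^sub>1 = i'"
        by (rule epicD[OF cD(4) _ cH]) (use g s1(1) ip(2) in auto)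
      obtain r where r: "r \<in> Hom C T (Dom C g)" "r \<cdot> i = s\<^sub>0" "r \<cdot> i' = s\<^sub>1"
        using biproduct_copair[OF bp s0(1) s1(1)] .
      have "g \<cdot> r = Id C T"
      proof (rule biproduct_arrow_eqI[OF bp])
        show "g \<cdot> r \<in> Hom C T T" "Id C T \<in> Hom C T T" using g r(1) ip(10) by auto
        show "(g \<cdot> r) \<cdot> i = Id C T \<cdot> i" "(g \<cdot> r) \<cdot> i' = Id C T \<cdot> i'"
          using g r s0(2) gs1 ip(1,2) by auto
      qed
      then show "\<exists>s\<in>Hom C T (Dom C g). g \<cdot> s = Id C T" using r(1) by blast
    qed
    then show "F \<in> perp1 C {T}" using FO by (simp add: perp1_def)
  qed
  have 3: "perp1 C {T} \<subseteq> Gen_class C \<kappa> T"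
  proof
    fix F assume "F \<in> perp1 C {T}"
    then have FO: "F \<in> Ob C" and F: "Ext_zero C 1 T F" by (auto simp: perp1_def)
    \<comment> \<open>Vanishing passes to the summand \<open>T\<^sub>1\<close>: the projection
      \<open>p'\<close> is lifted, and the lift is restricted along \<open>i'\<close>.\<close>
    have F1: "Ext_zero C 1 T\<^sub>1 F"
    proof (subst Ext_zero_1_iff[OF TO(2) FO], intro allI impI)
      fix f g assume fg: "short_exact C f g \<and> Dom C f = F \<and> Cod C g = T\<^sub>1"
      then have s: "short_exact C f g" "Dom C f = F" "Cod C g = T\<^sub>1" by auto
      obtain y where y: "y \<in> Hom C T (Dom C g)" "g \<cdot> y = p'"
        using Ext_zero_lift[OF F s(1,2), of p'] ip(4) s(3) by auto
      have "g \<cdot> (y \<cdot> i') = Id C T\<^sub>1"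
        using Comp_eq_right[OF y(2), of i'] y(1) ip(2,6) short_exactD(6)[OF s(1)] by auto
      then show "\<exists>s\<in>Hom C T\<^sub>1 (Dom C g). g \<cdot> s = Id C T\<^sub>1"
        using y(1) ip(2) by (intro bexI[of _ "y \<cdot> i'"]) auto
    qed
    have factor: "\<exists>h. h \<in> Hom C T F \<and> (\<exists>e\<in>Hom C G T. h \<cdot> e = x)" if G: "G \<in> gens" and x: "x \<in> Hom C G F" for G x
    proof -
      \<comment> \<open>\<open>x\<close> is extended by zero on the other generators to a morphism
        on \<open>X\<close>, and from there to \<open>T\<^sub>0\<close>, since the obstruction lies
        in \<open>Ext C 1 T\<^sub>1 F\<close>.\<close>
      obtain x' where x': "x' \<in> Hom C X F" "x' \<cdot> \<iota> G = x"
      proof (rule coproduct_desc[OF X FO, of "\<lambda>G'. if G' = G then x else Zero C G' F"])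
        show "(if G' = G then x else Zero C G' F) \<in> Hom C G' F" if "G' \<in> gens" for G'
          using x gensO[OF that] FO by auto
      qed (use G in auto)
      have "x' \<in> Hom C (Dom C j) F" using x'(1) j(1) by simp
      then obtain y where y: "y \<in> Hom C T\<^sub>0 F" "y \<cdot> j = x'"
        using Ext_zero_extend[OF F1 c] cD(7) T\<^sub>0_def T\<^sub>1_def by metis
      have "(y \<cdot> p) \<cdot> (i \<cdot> (j \<cdot> \<iota> G)) = y \<cdot> ((p \<cdot> i) \<cdot> (j \<cdot> \<iota> G))"
        using y(1) ip(1,3) jH XD(3)[OF G] by auto
      also have "\<dots> = x" unfolding ip(5)
        using Comp_eq_right[OF y(2), of "\<iota> G"] x'(2) y(1) jH XD(3)[OF G] by auto
      finally have "(y \<cdot> p) \<cdot> (i \<cdot> (j \<cdot> \<iota> G)) = x" .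
      moreover have "i \<cdot> (j \<cdot> \<iota> G) \<in> Hom C G T" "y \<cdot> p \<in> Hom C T F"
        using y(1) ip(1,3) jH XD(3)[OF G] by auto
      ultimately show ?thesis by blast
    qed
    \<comment> \<open>One copy of \<open>T\<close> is taken for each morphism from a generator to
      \<open>F\<close>; the induced \<open>\<phi>\<close> is epic because all these morphisms factor
      through it.\<close>
    let ?I = "\<Union>G\<in>gens. Hom C G F"
    have I: "small \<kappa> ?I"
    proof (rule small_UN[OF gens(2)])
      show "small \<kappa> (Hom C G F)" if "G \<in> gens" for G
        using that gens(1) by (intro small_Hom[OF finitely_presented FO]) blast
    qed
    have "\<exists>h. h \<in> Hom C T F \<and> (\<exists>e\<in>Hom C (Dom C x) T. h \<cdot> e = x)" if x: "x \<in> ?I" for x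
      using factor[of "Dom C x" x] x by auto
    then obtain H where H: "\<And>x. x \<in> ?I \<Longrightarrow> H x \<in> Hom C T F \<and> (\<exists>e\<in>Hom C (Dom C x) T. H x \<cdot> e = x)" by metis
    \<comment> \<open>\<open>Add_class\<close> admits only index sets in the type of
      \<open>\<kappa>\<close>, so the set of morphisms is moved there.\<close>
    obtain e :: "_ \<Rightarrow> 'c" where e: "inj_on e ?I" "small \<kappa> (e ` ?I)" using ex_small_index[OF I] .
    obtain B \<iota>' where B: "is_coproduct C (e ` ?I) (\<lambda>_. T) B \<iota>'"
      using ex_coproduct[OF e(2), of "\<lambda>_. T"] ip(10) by auto
    note BD = is_coproductD[OF B]
    have "(H \<circ> inv_into ?I e) x \<in> Hom C T F" if "x \<in> e ` ?I" for x
      using H[OF inv_into_into[OF that]] by simp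
    then obtain \<phi> where \<phi>: "\<phi> \<in> Hom C B F" "\<And>x. x \<in> e ` ?I \<Longrightarrow> \<phi> \<cdot> \<iota>' x = (H \<circ> inv_into ?I e) x"
      using coproduct_desc[OF B FO, of "H \<circ> inv_into ?I e"] by blast
    have "epic C \<phi>"
    proof (rule epicI[OF \<phi>(1)])
      fix W t assume t: "t \<in> Hom C F W" "t \<cdot> \<phi> = Zero C B W"
      have WO: "W \<in> Ob C" using t(1) Ar_Ob(2)[of t] by auto
      show "t = Zero C F W"
      proof (rule separating_zero[OF gens(3) t(1)])
        fix G x assume G: "G \<in> gens" and x: "x \<in> Hom C G F"
        then have xI: "x \<in> ?I" by blast
        then have exI: "e x \<in> e ` ?I" by blast
        obtain z where z: "z \<in> Hom C G T" "H x \<cdot> z = x" using H[OF xI] x by auto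
        have \<phi>x: "\<phi> \<cdot> \<iota>' (e x) = H x" using \<phi>(2)[OF exI] inv_into_f_f[OF e(1) xI] by simp
        have "t \<cdot> H x = Zero C T W"
          unfolding \<phi>x[symmetric]
          using Comp_eq_right[OF t(2), of "\<iota>' (e x)"] t(1) \<phi>(1) BD(3)[OF exI] WO by auto
        then have "(t \<cdot> H x) \<cdot> z = Zero C G W" using z(1) WO by auto
        moreover have "(t \<cdot> H x) \<cdot> z = t \<cdot> x" using z t(1) H[OF xI] by auto
        ultimately show "t \<cdot> x = Zero C G W" by simp
      qed
    qed
    moreover have "B \<in> Add_class C \<kappa> T"
    proof -
      obtain Z where "zero_object C Z" using ex_zero_object by blast
      then have "direct_summand C B B" using zero_object_biproduct(2) BD(1) unfolding direct_summand_def by blast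
      then show ?thesis using e(2) B unfolding Add_class_def by blast
    qed
    ultimately show "F \<in> Gen_class C \<kappa> T" using \<phi>(1) unfolding Gen_class_def by blast
  qed
  have "tilting C \<kappa> T" unfolding tilting_def using ip(10) 1 2 3 by blast
  then show ?thesis using 1 2 3 by blast
qed

end

theorem theorem1:
  fixes C :: "('o, 'm) cat" and \<kappa> :: "'u rel" and \<S> :: "'o set"
  assumes "locally_coherent_grothendieck_category C \<kappa>"
    and "\<S> \<subseteq> {X. finitely_presented C \<kappa> X}"
    and "resolving C \<kappa> \<S>"
    and "\<And>S. S \<in> \<S> \<Longrightarrow> proj_dim_le C S 1"
  shows "\<exists>T. tilting C \<kappa> T \<and> perp1 C {T} = perp1 C \<S>"
proof -
  interpret locally_coherent_grothendieck_category C \<kappa> by (rule assms(1))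
  interpret resolving_class C \<kappa> \<S> by unfold_locales (use assms(2-4) in blast)+
  show ?thesis by (rule ex_tilting)
qed

end
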